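(* Let $G$ be a countable group with a metric $d$ (with finite integer balls $B_k=\{g:d(g,e)\le k\}$) having an ergodic non-singular action on a standard probability space $(X,\mu)$. Suppose: (i) $(G,d)$ is well-separable; (ii) $(B_k)$ has the multiplicative doubling property; (iii) there is a voidless group $\tilde G\supseteq G$ (with $G$ a subgroup) with a right-invariant metric $\tilde d$ extending $d$; (iv) $(G,d)$ has finite intersection dimension with respect to $(\tilde G,\tilde d)$; (v) $(G,d)$ has the Besicovitch covering property. Then for every $f\in L^1(\mu)$, $$\lim_{k\to\infty}\frac{\sum_{g\in B_k}\hat gf}{\sum_{g\in B_k}\hat g1}=\int f\,d\mu\quad\text{a.e.}$$
   Context: $\omega_g=\frac{d(\mu\circ g)}{d\mu}$, $\hat gf(x)=f(gx)\omega_g(x)$. Well-separable: there is $\chi\in\mathbb{N}$ such that for every finite $E$ and every carpet $\{B_{r(x)}(x):x\in E\}$ some subcollection covers $E$ and splits into $\chi$ subcollections in each of which distinct balls are at distance $\ge$ the minimal radius. Multiplicative doubling: $|B_kB_k|\le D|B_k|$ for $k\ge K$. Voidless: for all $x$, $r>0$, every closed ball meeting both $\{d(x,\cdot)<r\}$ and $\{d(x,\cdot)>r\}$ meets $\{d(x,\cdot)=r\}$. With $\partial_tB_r(x)=\{y\in G:\tilde d(y,\{z\in\tilde G:\tilde d(z,x)=r\})\le t\}$, finite intersection dimension means: there are $\kappa\in\mathbb{N}$, $R>1$ such that whenever $t(i)\ge1$, $r(i)\ge t(1)\cdots t(i)R$, $x_i\in\bigcap_{j<i}\partial_{t(j)}B_{r(j)}(x_j)$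 ($i\le\kappa$), then $\bigcap_{i\le\kappa}\partial_{t(i)}B_{r(i)}(x_i)=\emptyset$. Besicovitch covering property: a constant $C$ such that every carpet over finite $E$ has a subcollection $\mathcal{V}$ with $\mathbf{1}_E\le\sum_{U\in\mathcal{V}}\mathbf{1}_U\le C$. *)

theory Defs
  imports "HOL-Algebra.Group" "HOL-Probability.Probability"
begin

definition metric_on_set :: "'g set \<Rightarrow> ('g \<Rightarrow> 'g \<Rightarrow> real) \<Rightarrow> bool" where
  "metric_on_set S d \<longleftrightarrow>
     (\<forall>x\<in>S. \<forall>y\<in>S. d x y = 0 \<longleftrightarrow> x = y) \<and>
     (\<forall>x\<in>S. \<forall>y\<in>S. d x y = d y x) \<and>
     (\<forall>x\<in>S. \<forall>y\<in>S. \<forall>z\<in>S. d x z \<le> d x y + d y z)"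

definition cball_in :: "'g set \<Rightarrow> ('g \<Rightarrow> 'g \<Rightarrow> real) \<Rightarrow> 'g \<Rightarrow> real \<Rightarrow> 'g set" where
  "cball_in S d x r = {y\<in>S. d x y \<le> r}"

definition int_ball :: "'g set \<Rightarrow> ('g \<Rightarrow> 'g \<Rightarrow> real) \<Rightarrow> 'g \<Rightarrow> nat \<Rightarrow> 'g set" where
  "int_ball S d e k = {g\<in>S. d g e \<le> real k}"

text \<open>Well-separable. A carpet over a finite set E is given by radii r(x) > 0, x in E;
  a subcollection is indexed by a subset F of the centres; the splitting into chi
  subcollections is given by a colouring c of F with values < chi. Distance between
  two balls is the infimum of the distances of their points.\<close>
definition well_separable :: "'g set \<Rightarrow> ('g \<Rightarrow> 'g \<Rightarrow> real) \<Rightarrow> bool" where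
  "well_separable S d \<longleftrightarrow>
    (\<exists>chi::nat. \<forall>E r. finite E \<and> E \<subseteq> S \<and> (\<forall>x\<in>E. r x > (0::real)) \<longrightarrow>
      (\<exists>F c. F \<subseteq> E \<and> E \<subseteq> (\<Union>x\<in>F. cball_in S d x (r x)) \<and> (\<forall>x\<in>F. c x < chi) \<and>
         (\<forall>i<chi. \<forall>x\<in>F. \<forall>y\<in>F. c x = i \<and> c y = i \<and> cball_in S d x (r x) \<noteq> cball_in S d y (r y)
             \<longrightarrow> (\<forall>a\<in>cball_in S d x (r x). \<forall>b\<in>cball_in S d y (r y).
                    d a b \<ge> Min (r ` {z\<in>F. c z = (i::nat)})))))"

definition mult_doubling :: "('g, 'b) monoid_scheme \<Rightarrow> 'g set \<Rightarrow> ('g \<Rightarrow> 'g \<Rightarrow> real) \<Rightarrow> bool" where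
  "mult_doubling Gr S d \<longleftrightarrow>
    (\<exists>D::real. \<exists>K::nat. \<forall>k\<ge>K.
       real (card {a \<otimes>\<^bsub>Gr\<^esub> b | a b. a \<in> int_ball S d \<one>\<^bsub>Gr\<^esub> k \<and> b \<in> int_ball S d \<one>\<^bsub>Gr\<^esub> k})
         \<le> D * real (card (int_ball S d \<one>\<^bsub>Gr\<^esub> k)))"

definition voidless :: "'g set \<Rightarrow> ('g \<Rightarrow> 'g \<Rightarrow> real) \<Rightarrow> bool" where
  "voidless T dt \<longleftrightarrow>
    (\<forall>x\<in>T. \<forall>r>0. \<forall>y\<in>T. \<forall>s\<ge>0.
       (\<exists>z\<in>cball_in T dt y s. dt x z < r) \<and> (\<exists>z\<in>cball_in T dt y s. dt x z > r)
         \<longrightarrow> (\<exists>z\<in>cball_in T dt y s. dt x z = r))"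

definition right_invariant :: "('g, 'b) monoid_scheme \<Rightarrow> ('g \<Rightarrow> 'g \<Rightarrow> real) \<Rightarrow> bool" where
  "right_invariant Gr dt \<longleftrightarrow>
    (\<forall>x\<in>carrier Gr. \<forall>y\<in>carrier Gr. \<forall>z\<in>carrier Gr. dt (x \<otimes>\<^bsub>Gr\<^esub> z) (y \<otimes>\<^bsub>Gr\<^esub> z) = dt x y)"

text \<open>Thickened boundary: points y of S with dt(y, {z in T. dt(z,x) = r}) <= t;
  the distance to a set is an infimum (infinite for the empty set).\<close>
definition thick_bdry :: "'g set \<Rightarrow> 'g set \<Rightarrow> ('g \<Rightarrow> 'g \<Rightarrow> real) \<Rightarrow> real \<Rightarrow> real \<Rightarrow> 'g \<Rightarrow> 'g set" where
  "thick_bdry S T dt t r x =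
     {y\<in>S. (INF z\<in>{z\<in>T. dt z x = r}. ereal (dt y z)) \<le> ereal t}"

definition finite_intersection_dim :: "'g set \<Rightarrow> 'g set \<Rightarrow> ('g \<Rightarrow> 'g \<Rightarrow> real) \<Rightarrow> bool" where
  "finite_intersection_dim S T dt \<longleftrightarrow>
    (\<exists>kappa::nat. \<exists>R::real. R > 1 \<and>
      (\<forall>t r x. (\<forall>i\<in>{1..kappa}. t i \<ge> 1 \<and> r i \<ge> (\<Prod>j=1..i. t j) * R \<and> x i \<in> S \<and>
                  (\<forall>j\<in>{1..<i}. x i \<in> thick_bdry S T dt (t j) (r j) (x j)))
         \<longrightarrow> (\<Inter>i\<in>{1..kappa}. thick_bdry S T dt (t i) (r i) (x i)) = {}))"

definition besicovitch :: "'g set \<Rightarrow> ('g \<Rightarrow> 'g \<Rightarrow> real) \<Rightarrow> bool" where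
  "besicovitch S d \<longleftrightarrow>
    (\<exists>C::real. \<forall>E r. finite E \<and> E \<subseteq> S \<and> (\<forall>x\<in>E. r x > (0::real)) \<longrightarrow>
      (\<exists>F\<subseteq>E. \<forall>y\<in>S. (indicator E y :: real) \<le> (\<Sum>x\<in>F. indicator (cball_in S d x (r x)) y)
                   \<and> (\<Sum>x\<in>F. indicator (cball_in S d x (r x)) y) \<le> C))"

definition nonsingular_action ::
  "('g, 'b) monoid_scheme \<Rightarrow> 'g set \<Rightarrow> 'x measure \<Rightarrow> ('g \<Rightarrow> 'x \<Rightarrow> 'x) \<Rightarrow> bool" where
  "nonsingular_action Gr S M a \<longleftrightarrow>
     (\<forall>g\<in>S. a g \<in> M \<rightarrow>\<^sub>M M) \<and>
     (\<forall>x\<in>space M. a \<one>\<^bsub>Gr\<^esub> x = x) \<and>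
     (\<forall>g\<in>S. \<forall>h\<in>S. \<forall>x\<in>space M. a (g \<otimes>\<^bsub>Gr\<^esub> h) x = a g (a h x)) \<and>
     (\<forall>g\<in>S. null_sets (distr M M (a g)) = null_sets M)"

definition ergodic_action :: "'g set \<Rightarrow> 'x measure \<Rightarrow> ('g \<Rightarrow> 'x \<Rightarrow> 'x) \<Rightarrow> bool" where
  "ergodic_action S M a \<longleftrightarrow>
     (\<forall>A\<in>sets M. (\<forall>g\<in>S. a g -` A \<inter> space M = A) \<longrightarrow> measure M A = 0 \<or> measure M A = 1)"

text \<open>omega_g = d(mu o g)/d mu, where (mu o g)(A) = mu(gA) = mu((g^-1)^-1 A).\<close>
definition omega :: "('g, 'b) monoid_scheme \<Rightarrow> 'x measure \<Rightarrow> ('g \<Rightarrow> 'x \<Rightarrow> 'x) \<Rightarrow> 'g \<Rightarrow> 'x \<Rightarrow> real" where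
  "omega Gr M a g x = enn2real (RN_deriv M (distr M M (a (inv\<^bsub>Gr\<^esub> g))) x)"

definition hat_op :: "('g, 'b) monoid_scheme \<Rightarrow> 'x measure \<Rightarrow> ('g \<Rightarrow> 'x \<Rightarrow> 'x) \<Rightarrow> 'g \<Rightarrow> ('x \<Rightarrow> real) \<Rightarrow> 'x \<Rightarrow> real" where
  "hat_op Gr M a g f x = f (a g x) * omega Gr M a g x"

end

theory Submission
  imports Defs
begin

text \<open>
  Bounded functions minus their translates, together with the constants, are dense in $L^1$ (an
  exhaustion argument using ergodicity), and the Besicovitch property with doubling gives a maximal
  inequality; so it suffices to treat a bounded coboundary. There the claim is that, for the orbit
  weights $w(g) = \omega_g(x)$, the mass of $B_k \mathbin{\triangle} sB_k$ is negligible against that of $B_k$.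

  Suppose this fails with some fixed proportion on a set of positive measure. By ergodicity, all but a
  small part of an orbit lies within a fixed distance of a centre having heavy boundaries at every
  one of a long, rapidly growing sequence of scales. Working down the scales, well-separability yields a disjoint
  family of balls whose boundaries carry a fixed proportion of the mass; averaging selects one of them.
  By pigeonhole over intermediate scales its boundary can be thickened so that
  almost no mass lies in the next shell, hence almost all mass near the thickened boundary lies on it,
  and the argument repeats with centres on that boundary. After finitely many steps this contradicts finite
  intersection dimension. Voidlessness guarantees that sets such as $B_k \mathbin{\triangle} sB_k$ lie
  in thickened spheres.
\<close>

section \<open>Neighbourhoods and thickened spheres\<close>

text \<open>The weights on an orbit are not invariant, so the doubling bound on cardinalities says
  nothing directly about weighted mass. The bridge is that \<open>hat g\<close> preserves integrals:
  comparing integrals with cardinalities yields one point whose weights double at a single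
  prescribed large ball and give little mass there to bad elements. This is possible because
  \<open>tol\<close> and \<open>depth\<close> depend only on the number of colours,
  \<open>kappa\<close>, the heaviness proportion and the doubling constant, so all scales are fixed
  before the orbit is chosen. Finite intersection dimension compares each radius with the product of
  the thicknesses up to it. Finding a sphere cuts the window into many smaller ones and keeps one of
  them, which is why \<open>depth\<close> is multiplicative. The tolerances are built backwards,
  because selecting a sphere magnifies the relative error by a fixed factor.\<close>

lemma metric_on_set_nonneg: "metric_on_set T d \<Longrightarrow> x \<in> T \<Longrightarrow> y \<in> T \<Longrightarrow> 0 \<le> d x y"
  unfolding metric_on_set_def by (smt (verit))

lemma metric_on_set_sym: "metric_on_set T d \<Longrightarrow> x \<in> T \<Longrightarrow> y \<in> T \<Longrightarrow> d x y = d y x"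
  unfolding metric_on_set_def by simp

lemma metric_on_set_refl: "metric_on_set T d \<Longrightarrow> x \<in> T \<Longrightarrow> d x x = 0"
  unfolding metric_on_set_def by simp

lemma metric_on_set_triangle:
  "metric_on_set T d \<Longrightarrow> x \<in> T \<Longrightarrow> y \<in> T \<Longrightarrow> z \<in> T \<Longrightarrow> d x z \<le> d x y + d y z"
  unfolding metric_on_set_def by simp

lemma metric_on_set_mono: "metric_on_set T d \<Longrightarrow> S \<subseteq> T \<Longrightarrow> metric_on_set S d"
  unfolding metric_on_set_def by (meson subsetD)

definition nbhd :: "'g set \<Rightarrow> ('g \<Rightarrow> 'g \<Rightarrow> real) \<Rightarrow> real \<Rightarrow> 'g set \<Rightarrow> 'g set" where
  "nbhd S d u Y = {z\<in>S. \<exists>y\<in>Y. d y z \<le> u}"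

lemma nbhd_mono: "u \<le> v \<Longrightarrow> Y \<subseteq> Z \<Longrightarrow> nbhd S d u Y \<subseteq> nbhd S d v Z"
  unfolding nbhd_def by force

lemma nbhd_subset_carrier: "nbhd S d u Y \<subseteq> S"
  unfolding nbhd_def by auto

lemma subset_nbhd:
  assumes "metric_on_set S d" "Y \<subseteq> S" "0 \<le> u"
  shows "Y \<subseteq> nbhd S d u Y"
proof
  fix y assume y: "y \<in> Y"
  then have yS: "y \<in> S" using assms(2) by auto
  then have "d y y \<le> u" using metric_on_set_refl[OF assms(1)] assms(3) by simp
  then show "y \<in> nbhd S d u Y" using y yS unfolding nbhd_def by blast
qed

lemma nbhd_nbhd:
  assumes "metric_on_set S d" "Y \<subseteq> S" "u + v \<le> q"
  shows "nbhd S d v (nbhd S d u Y) \<subseteq> nbhd S d q Y"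
proof
  fix z assume "z \<in> nbhd S d v (nbhd S d u Y)"
  then obtain y x where *: "z \<in> S" "y \<in> S" "x \<in> Y" "d x y \<le> u" "d y z \<le> v"
    unfolding nbhd_def by blast
  then have "x \<in> S" using assms(2) by blast
  then have "d x z \<le> d x y + d y z" using metric_on_set_triangle[OF assms(1)] * by simp
  then have "d x z \<le> q" using * assms(3) by linarith
  then show "z \<in> nbhd S d q Y" using * unfolding nbhd_def by blast
qed

lemma nbhd_disjoint:
  assumes "metric_on_set S d" "A \<subseteq> S" "B \<subseteq> S" "\<And>x y. x \<in> A \<Longrightarrow> y \<in> B \<Longrightarrow> L \<le> d x y" "2 * u < L"
  shows "nbhd S d u A \<inter> nbhd S d u B = {}"
proof (rule ccontr)
  assume "\<not> ?thesis"
  then obtain z x y where *: "z \<in> S" "x \<in> A" "y \<in> B" "d x z \<le> u" "d y z \<le> u"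
    unfolding nbhd_def by blast
  moreover have "x \<in> S" "y \<in> S" using * assms(2,3) by auto
  ultimately have "d x y \<le> d x z + d z y" "d z y = d y z"
    using metric_on_set_triangle[OF assms(1), of x z y] metric_on_set_sym[OF assms(1), of z y] * by blast+
  then show False using assms(4)[OF *(2,3)] assms(5) * by linarith
qed

lemma finite_nbhd:
  assumes "\<And>x. x \<in> S \<Longrightarrow> finite (cball_in S d x u)" "finite Y" "Y \<subseteq> S"
  shows "finite (nbhd S d u Y)"
proof -
  have "nbhd S d u Y \<subseteq> (\<Union>y\<in>Y. cball_in S d y u)" unfolding nbhd_def cball_in_def by auto
  then show ?thesis using assms by (meson finite_UN_I finite_subset subsetD)
qed

lemma thick_bdry_mono: "t \<le> t' \<Longrightarrow> thick_bdry S T d t r x \<subseteq> thick_bdry S T d t' r x"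
  unfolding thick_bdry_def by (auto intro: order_trans)

text \<open>The distance to a fixed set is 1-Lipschitz. The argument stays with infima in the
  extended reals because the sphere may be empty and its distance need not be attained.\<close>

lemma thick_bdry_near:
  assumes "metric_on_set T d" "S \<subseteq> T" "y \<in> thick_bdry S T d t r x" "z \<in> S" "d y z \<le> u" "t + u \<le> t'"
  shows "z \<in> thick_bdry S T d t' r x"
proof -
  let ?I = "{z\<in>T. d z x = r}"
  have yS: "y \<in> S" and ty: "(INF p\<in>?I. ereal (d y p)) \<le> ereal t" using assms(3) unfolding thick_bdry_def by auto
  have T: "y \<in> T" "z \<in> T" using yS assms(2,4) by auto
  have zy: "d z y = d y z" using metric_on_set_sym[OF assms(1) T(2,1)] .
  have "(INF p\<in>?I. ereal (d z p)) - ereal u \<le> (INF p\<in>?I. ereal (d y p))"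
  proof (rule INF_greatest)
    fix p assume p: "p \<in> ?I"
    have "d z p \<le> d z y + d y p" using metric_on_set_triangle[OF assms(1)] T p by simp
    then have "ereal (d z p) \<le> ereal (u + d y p)" using zy assms(5) by simp
    moreover have "(INF p\<in>?I. ereal (d z p)) \<le> ereal (d z p)" using p by (rule INF_lower)
    ultimately have "(INF p\<in>?I. ereal (d z p)) \<le> ereal (u + d y p)" by order
    then show "(INF p\<in>?I. ereal (d z p)) - ereal u \<le> ereal (d y p)"
      by (cases "(INF p\<in>?I. ereal (d z p))") auto
  qed
  then have "(INF p\<in>?I. ereal (d z p)) - ereal u \<le> ereal t" using ty by order
  then have "(INF p\<in>?I. ereal (d z p)) \<le> ereal (t + u)"
    by (cases "(INF p\<in>?I. ereal (d z p))") auto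
  also have "\<dots> \<le> ereal t'" using assms by simp
  finally show ?thesis using assms(4) unfolding thick_bdry_def by auto
qed

lemma nbhd_thick_bdry:
  assumes "metric_on_set T d" "S \<subseteq> T" "t + u \<le> t'"
  shows "nbhd S d u (thick_bdry S T d t r x) \<subseteq> thick_bdry S T d t' r x"
  using thick_bdry_near[OF assms(1,2) _ _ _ assms(3)] unfolding nbhd_def by blast

text \<open>The closed \<open>t\<close>-balls about \<open>x\<close> and about \<open>y\<close> each
  contain both points, so each has points inside and outside the sphere and voidlessness makes each
  meet it. A point \<open>x\<close> exactly on the sphere is treated apart, since voidlessness asks
  for strict inequalities on both sides.\<close>

lemma voidless_crossing:
  assumes "metric_on_set T d" "S \<subseteq> T" "voidless T d" "c \<in> S" "x \<in> S" "y \<in> S" "r > 0"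
    and "d x y \<le> t" "d c x \<le> r" "r < d c y"
  shows "x \<in> thick_bdry S T d t r c \<and> y \<in> thick_bdry S T d t r c"
proof -
  have T: "c \<in> T" "x \<in> T" "y \<in> T" using assms by auto
  have t: "0 \<le> t" using assms(8) metric_on_set_nonneg[OF assms(1) T(2,3)] by linarith
  have sym: "\<And>p q. p \<in> T \<Longrightarrow> q \<in> T \<Longrightarrow> d p q = d q p"
    and refl: "\<And>p. p \<in> T \<Longrightarrow> d p p = 0"
    using metric_on_set_sym[OF assms(1)] metric_on_set_refl[OF assms(1)] by blast+
  have near: "p \<in> thick_bdry S T d t r c" if "p \<in> S" "z \<in> T" "d p z \<le> t" "d c z = r" for p z
  proof -
    have "(INF q\<in>{z\<in>T. d z c = r}. ereal (d p q)) \<le> ereal (d p z)"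
      using that sym[OF T(1) that(2)] by (intro INF_lower) auto
    also have "\<dots> \<le> ereal t" using that by simp
    finally show ?thesis using that unfolding thick_bdry_def by simp
  qed
  show ?thesis
  proof (cases "d c x = r")
    case True
    show ?thesis using near[of x x] near[of y x] True T refl sym[OF T(2,3)] t assms by auto
  next
    case False
    have 1: "x \<in> cball_in T d x t" "y \<in> cball_in T d x t" "x \<in> cball_in T d y t" "y \<in> cball_in T d y t"
      using T refl sym[OF T(2,3)] t assms unfolding cball_in_def by auto
    have lt: "d c x < r" using False assms by simp
    have meets: "\<exists>z\<in>cball_in T d p t. d c z = r" if "p \<in> {x, y}" for p
    proof -
      have "x \<in> cball_in T d p t" "y \<in> cball_in T d p t" "p \<in> T" using that 1 T by auto
      then show ?thesis using assms(3,7) T(1) t lt assms(10) unfolding voidless_def by blast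
    qed
    obtain z1 z2 where "z1 \<in> T" "d x z1 \<le> t" "d c z1 = r" "z2 \<in> T" "d y z2 \<le> t" "d c z2 = r"
      using meets[of x] meets[of y] unfolding cball_in_def by auto
    then show ?thesis using near assms by blast
  qed
qed

text \<open>Any common lower bound \<open>L\<close> of the radii may stand for the minimal radius of
  a colour class. Separation is wanted for distinct centres and not only for distinct balls, so that
  halos indexed by centres become disjoint.\<close>

lemma well_separableE:
  assumes "well_separable S d"
  obtains chi :: nat where "0 < chi"
    "\<And>E r L. \<lbrakk>finite E; E \<subseteq> S; 0 < L; \<And>x. x \<in> E \<Longrightarrow> L \<le> r x\<rbrakk> \<Longrightarrow>
       \<exists>F c. F \<subseteq> E \<and> E \<subseteq> (\<Union>x\<in>F. cball_in S d x (r x)) \<and> (\<forall>x\<in>F. c x < chi) \<and>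
         (\<forall>x\<in>F. \<forall>y\<in>F. c x = c y \<longrightarrow> x \<noteq> y \<longrightarrow>
            (\<forall>p\<in>cball_in S d x (r x). \<forall>q\<in>cball_in S d y (r y). L \<le> d p q))"
proof -
  from assms obtain chi :: nat where chi: "\<forall>E r. finite E \<and> E \<subseteq> S \<and> (\<forall>x\<in>E. r x > (0::real)) \<longrightarrow>
      (\<exists>F c. F \<subseteq> E \<and> E \<subseteq> (\<Union>x\<in>F. cball_in S d x (r x)) \<and> (\<forall>x\<in>F. c x < chi) \<and>
         (\<forall>i<chi. \<forall>x\<in>F. \<forall>y\<in>F. c x = i \<and> c y = i \<and> cball_in S d x (r x) \<noteq> cball_in S d y (r y)
             \<longrightarrow> (\<forall>a\<in>cball_in S d x (r x). \<forall>b\<in>cball_in S d y (r y).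
                    d a b \<ge> Min (r ` {z\<in>F. c z = (i::nat)}))))"
    unfolding well_separable_def by (rule exE)
  show ?thesis
  \<comment> \<open>One spare colour keeps the number of colours positive, so that it can be divided
    by.\<close>
  proof (rule that[of "Suc chi"])
    show "0 < Suc chi" by simp
    fix E r and L :: real
    assume E: "finite E" "E \<subseteq> S" "0 < L" "\<And>x. x \<in> E \<Longrightarrow> L \<le> r x"
    let ?B = "\<lambda>x. cball_in S d x (r x)"
    have pos: "finite E \<and> E \<subseteq> S \<and> (\<forall>x\<in>E. r x > 0)" using E by force
    obtain F c where F: "F \<subseteq> E" "E \<subseteq> (\<Union>x\<in>F. ?B x)" "\<forall>x\<in>F. c x < chi"
      "\<forall>i<chi. \<forall>x\<in>F. \<forall>y\<in>F. c x = i \<and> c y = i \<and> ?B x \<noteq> ?B y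
             \<longrightarrow> (\<forall>a\<in>?B x. \<forall>b\<in>?B y. d a b \<ge> Min (r ` {z\<in>F. c z = (i::nat)}))"
      using chi[THEN spec, THEN spec, THEN mp, OF pos] by (elim exE conjE) (rule that; assumption)
    have "finite F" using F(1) E(1) finite_subset by blast
    \<comment> \<open>Different centres may give the same ball, so one centre is kept for each ball.\<close>
    define F' where "F' = inv_into F ?B ` (?B ` F)"
    have F'F: "F' \<subseteq> F" unfolding F'_def by (auto intro: inv_into_into)
    have inj: "x = y" if "x \<in> F'" "y \<in> F'" "?B x = ?B y" for x y
    proof -
      obtain x' where x': "x' \<in> F" "x = inv_into F ?B (?B x')" using \<open>x \<in> F'\<close> unfolding F'_def by blast
      obtain y' where y': "y' \<in> F" "y = inv_into F ?B (?B y')" using \<open>y \<in> F'\<close> unfolding F'_def by blast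
      have "?B x = ?B x'" "?B y = ?B y'" using x' y' by (metis f_inv_into_f image_eqI)+
      then show ?thesis using that(3) x' y' by metis
    qed
    have cover: "(\<Union>x\<in>F. ?B x) \<subseteq> (\<Union>x\<in>F'. ?B x)"
    proof
      fix z assume "z \<in> (\<Union>x\<in>F. ?B x)"
      then obtain x where x: "x \<in> F" "z \<in> ?B x" by blast
      then have "?B (inv_into F ?B (?B x)) = ?B x" by (metis f_inv_into_f image_eqI)
      then have "z \<in> ?B (inv_into F ?B (?B x))" using x by blast
      then show "z \<in> (\<Union>x\<in>F'. ?B x)" unfolding F'_def using x by blast
    qed
    have sep: "L \<le> d p q" if "x \<in> F'" "y \<in> F'" "c x = c y" "x \<noteq> y" "p \<in> ?B x" "q \<in> ?B y" for x y p q
    proof -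
      have xy: "x \<in> F" "y \<in> F" "?B x \<noteq> ?B y" using that F'F inj by blast+
      have cx: "c x < chi" using F(3) xy(1) by blast
      have "L \<le> Min (r ` {z\<in>F. c z = c x})"
        using xy \<open>finite F\<close> E(4) F(1) by (subst Min_ge_iff) auto
      also have "\<dots> \<le> d p q"
        by (rule F(4)[rule_format, OF cx xy(1,2) _ that(5,6)]) (simp add: that(3) xy(3))
      finally show ?thesis .
    qed
    have "\<forall>x\<in>F'. \<forall>y\<in>F'. c x = c y \<longrightarrow> x \<noteq> y \<longrightarrow> (\<forall>p\<in>?B x. \<forall>q\<in>?B y. L \<le> d p q)"
      by (intro ballI impI) (rule sep)
    moreover have "\<forall>x\<in>F'. c x < Suc chi" using F(3) F'F by (meson less_SucI subsetD)
    moreover have "F' \<subseteq> E" using F(1) F'F by (rule order_trans[rotated])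
    moreover have "E \<subseteq> (\<Union>x\<in>F'. ?B x)" using F(2) cover by (rule order_trans)
    ultimately show "\<exists>F c. F \<subseteq> E \<and> E \<subseteq> (\<Union>x\<in>F. ?B x) \<and> (\<forall>x\<in>F. c x < Suc chi) \<and>
         (\<forall>x\<in>F. \<forall>y\<in>F. c x = c y \<longrightarrow> x \<noteq> y \<longrightarrow> (\<forall>p\<in>?B x. \<forall>q\<in>?B y. L \<le> d p q))"
      by (intro exI[of _ F'] exI[of _ c] conjI)
  qed
qed

section \<open>Mass concentrating on intersecting spheres\<close>

text \<open>Pigeonhole by telescoping. It is applied to the masses of a growing chain of
  neighbourhoods, to find a shell with little mass.\<close>

lemma small_increment:
  fixes f :: "nat \<Rightarrow> real"
  assumes "0 < n" "f n - f 0 \<le> c"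
  shows "\<exists>k<n. f (Suc k) - f k \<le> c / real n"
proof (rule ccontr)
  assume "\<not> ?thesis"
  then have "\<And>k. k \<in> {..<n} \<Longrightarrow> c / real n < f (Suc k) - f k" by force
  then have "(\<Sum>k<n. c / real n) < (\<Sum>k<n. f (Suc k) - f k)"
    using assms by (intro sum_strict_mono) auto
  also have "\<dots> = f n - f 0" by (rule sum_lessThan_telescope)
  finally show False using assms by simp
qed

text \<open>Error tolerance and number of scales that suffice when n more spheres have to be found.\<close>
primrec tol :: "real \<Rightarrow> nat \<Rightarrow> real" where
  "tol c 0 = 1"
| "tol c (Suc n) = tol c n / 4 * c"

primrec depth :: "real \<Rightarrow> real \<Rightarrow> nat \<Rightarrow> nat" where
  "depth c D 0 = 1"
| "depth c D (Suc n) = nat \<lceil>4 * D / (c * tol c n)\<rceil> * (depth c D n + 2) + 5"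

lemma tol_bounds: "0 < c \<Longrightarrow> c \<le> 1 \<Longrightarrow> 0 < tol c n \<and> tol c n \<le> 1"
proof (induction n)
  case (Suc n)
  have "tol c n / 4 * c \<le> 1 * 1" using Suc by (intro mult_mono) auto
  then show ?case using Suc by simp
qed simp

text \<open>Every point y outside bad has a nearby centre ctr y whose sphere of radius rad i, with b i as the
  i-th scale, carries the proportion th of the mass w of the fattened ball, for all scales i below Q.\<close>
locale heavy_spheres =
  fixes T S :: "'g set" and d :: "'g \<Rightarrow> 'g \<Rightarrow> real"
    and chi kappa Q :: nat and R th D sg :: real
    and b :: "nat \<Rightarrow> real" and w :: "'g \<Rightarrow> real" and bad :: "'g set"
    and ctr :: "'g \<Rightarrow> 'g" and rad :: "nat \<Rightarrow> 'g \<Rightarrow> real"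
  assumes metric_T: "metric_on_set T d" and S_T: "S \<subseteq> T"
    and fin_ball: "\<And>x r. x \<in> S \<Longrightarrow> finite (cball_in S d x r)"
    and chi_pos: "0 < chi"
    and sep: "\<And>E r L. \<lbrakk>finite E; E \<subseteq> S; 0 < L; \<And>x. x \<in> E \<Longrightarrow> L \<le> r x\<rbrakk> \<Longrightarrow>
       \<exists>F c. F \<subseteq> E \<and> E \<subseteq> (\<Union>x\<in>F. cball_in S d x (r x)) \<and> (\<forall>x\<in>F. c x < chi) \<and>
         (\<forall>x\<in>F. \<forall>y\<in>F. c x = c y \<longrightarrow> x \<noteq> y \<longrightarrow>
            (\<forall>p\<in>cball_in S d x (r x). \<forall>q\<in>cball_in S d y (r y). L \<le> d p q))"
    and fid: "\<And>t r x. (\<forall>i\<in>{1..kappa}. t i \<ge> 1 \<and> r i \<ge> (\<Prod>j=1..i. t j) * R \<and> x i \<in> S \<and>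
                  (\<forall>j\<in>{1..<i}. x i \<in> thick_bdry S T d (t j) (r j) (x j)))
         \<Longrightarrow> (\<Inter>i\<in>{1..kappa}. thick_bdry S T d (t i) (r i) (x i)) = {}"
    and R: "1 < R" and th: "0 < th" "th \<le> 1" and D: "2 \<le> D" and sg: "1 \<le> sg"
    and b0: "sg \<le> b 0" and b_step: "\<And>i. 4 * b i \<le> b (Suc i)" "\<And>i. b i ^ kappa * R \<le> b (Suc i)"
    and w: "\<And>y. y \<in> S \<Longrightarrow> 0 \<le> w y"
    and ctr: "\<And>y. y \<in> S - bad \<Longrightarrow> ctr y \<in> S \<and> d y (ctr y) \<le> sg"
    and rad: "\<And>y i. y \<in> S - bad \<Longrightarrow> i < Q \<Longrightarrow> b i \<le> rad i (ctr y) \<and> rad i (ctr y) \<le> b (Suc i)"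
    and heavy: "\<And>y i. y \<in> S - bad \<Longrightarrow> i < Q \<Longrightarrow>
        th * sum w (nbhd S d sg (cball_in S d (ctr y) (rad i (ctr y))))
          \<le> sum w (nbhd S d sg (cball_in S d (ctr y) (rad i (ctr y)))
                   \<inter> thick_bdry S T d sg (rad i (ctr y)) (ctr y))"
begin

abbreviation "N \<equiv> nbhd S d"
abbreviation "B i x \<equiv> cball_in S d x (rad i x)"
abbreviation "thick_sphere i x \<equiv> N sg (B i x) \<inter> thick_bdry S T d sg (rad i x) x"

section \<open>Elementary bounds for scales and weights\<close>

lemma metric: "metric_on_set S d" by (rule metric_on_set_mono[OF metric_T S_T])

lemma b_ge1: "1 \<le> b i"
proof (induction i)
  case 0
  show ?case using sg b0 by linarith
next
  case (Suc i)
  then show ?case using b_step(1)[of i] by linarith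
qed

lemma b_mono: "i \<le> j \<Longrightarrow> b i \<le> b j"
proof (rule lift_Suc_mono_le[of b])
  show "b n \<le> b (Suc n)" for n using b_step(1)[of n] b_ge1[of n] by linarith
qed

lemma b_ge_sg: "sg \<le> b i"
  using b_mono[of 0 i] b0 by simp

lemma finN: "finite Y \<Longrightarrow> Y \<subseteq> S \<Longrightarrow> finite (N u Y)"
  by (rule finite_nbhd[OF fin_ball])

lemma W_nonneg: "A \<subseteq> S \<Longrightarrow> 0 \<le> sum w A"
  using w by (intro sum_nonneg) auto

lemma W_mono: "A \<subseteq> A' \<Longrightarrow> finite A' \<Longrightarrow> A' \<subseteq> S \<Longrightarrow> sum w A \<le> sum w A'"
  using w by (intro sum_mono2) auto

lemma W_UN: "finite I \<Longrightarrow> (\<And>i. i \<in> I \<Longrightarrow> finite (A i)) \<Longrightarrow> (\<And>i. i \<in> I \<Longrightarrow> A i \<subseteq> S) \<Longrightarrow>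
   sum w (\<Union>i\<in>I. A i) \<le> (\<Sum>i\<in>I. sum w (A i))"
proof (induction I rule: finite_induct)
  case (insert i I)
  have "sum w (A i \<union> (\<Union>i\<in>I. A i)) \<le> sum w (A i) + sum w (\<Union>i\<in>I. A i)"
  proof -
    have fin: "finite (A i)" "finite (\<Union>i\<in>I. A i)" and sub: "A i \<inter> (\<Union>i\<in>I. A i) \<subseteq> S"
      using insert.hyps(1) insert.prems by blast+
    show ?thesis using sum.union_inter[OF fin, of w] W_nonneg[OF sub] by linarith
  qed
  moreover have "sum w (\<Union>i\<in>I. A i) \<le> (\<Sum>i\<in>I. sum w (A i))"
    by (rule insert.IH) (use insert.prems in blast)+
  ultimately show ?case using insert.hyps by simp
qed simp

text \<open>One colour class of a well-separated cover carries a fixed proportion of the mass, its halos are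
  disjoint, and averaging over its members selects a centre.\<close>
lemma select_centre:
  assumes Y: "finite Y" "Y \<subseteq> S" "0 < sum w Y" and k: "1 \<le> k" "k < Q" and e: "0 < e" "e \<le> 1"
    and ND: "sum w (N (b (k+2)) Y) \<le> D * sum w Y"
    and Nb: "sum w (N (b (k+2)) Y - Om) + sum w (N (b (k+2)) Y \<inter> bad) \<le> e * (th / (8 * chi)) * sum w Y"
  obtains x y where "y \<in> Y" "x \<in> S" "d y x \<le> sg" "b k \<le> rad k x" "N (b (k-1)) (B k x) \<subseteq> N (b (k+2)) Y"
    "th / (8 * chi * D) * sum w (N (b (k-1)) (B k x))
       + (sum w (N (b (k-1)) (B k x) - Om) + sum w (N (b (k-1)) (B k x) \<inter> bad)) / e < sum w (thick_sphere k x)"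
proof -
  let ?NY = "N (b (k+2)) Y" and ?Z = "\<lambda>x. N (b (k-1)) (B k x)"
  define E where "E = Y - bad"
  have finNY: "finite ?NY" "?NY \<subseteq> S" by (rule finN[OF Y(1,2)], rule nbhd_subset_carrier)
  have E: "finite E" "E \<subseteq> S - bad" "E \<subseteq> Y" unfolding E_def using Y by auto
  have YNY: "Y \<subseteq> ?NY" using subset_nbhd[OF metric Y(2)] b_ge1[of "k+2"] by simp
  \<comment> \<open>The permitted bad mass is at most half of the mass of \<open>Y\<close>, so the
    good part \<open>E\<close> keeps the other half.\<close>
  have "e * (th / (8 * chi)) \<le> 1 * (1 / 2)"
    using e th chi_pos by (intro mult_mono) (auto simp: field_simps)
  then have "e * (th / (8 * chi)) * sum w Y \<le> 1/2 * sum w Y" using Y(3) by (intro mult_right_mono) auto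
  moreover have "sum w (Y \<inter> bad) \<le> sum w (?NY \<inter> bad)" using finNY YNY by (intro W_mono) auto
  moreover have "0 \<le> sum w (?NY - Om)" using finNY by (intro W_nonneg) auto
  moreover have "sum w Y = sum w E + sum w (Y \<inter> bad)"
    unfolding E_def using sum.Int_Diff[OF Y(1), of w bad] by simp
  ultimately have wE: "sum w Y / 2 \<le> sum w E" using Nb by linarith
  define C where "C = ctr ` E"
  have C: "finite C" "C \<subseteq> S" unfolding C_def using E ctr by auto
  have Cb: "b k \<le> rad k x \<and> rad k x \<le> b (Suc k) \<and> th * sum w (N sg (B k x)) \<le> sum w (thick_sphere k x)"
    if "x \<in> C" for x
    using that E(2) rad[OF _ k(2)] heavy[OF _ k(2)] unfolding C_def by blast
  have Lpos: "0 < b k" using b_ge1[of k] by simp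
  have "\<exists>F c. F \<subseteq> C \<and> C \<subseteq> (\<Union>x\<in>F. B k x) \<and> (\<forall>x\<in>F. c x < chi) \<and>
         (\<forall>x\<in>F. \<forall>y\<in>F. c x = c y \<longrightarrow> x \<noteq> y \<longrightarrow> (\<forall>p\<in>B k x. \<forall>q\<in>B k y. b k \<le> d p q))"
    by (rule sep[OF C Lpos]) (use Cb in blast)
  then obtain F and c :: "'g \<Rightarrow> nat" where F: "F \<subseteq> C" "C \<subseteq> (\<Union>x\<in>F. B k x)" "\<forall>x\<in>F. c x < chi"
    and Fsep: "\<forall>x\<in>F. \<forall>y\<in>F. c x = c y \<longrightarrow> x \<noteq> y \<longrightarrow> (\<forall>p\<in>B k x. \<forall>q\<in>B k y. b k \<le> d p q)"
    by (elim exE conjE) (rule that; assumption)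
  have finF: "finite F" using F(1) C(1) finite_subset by blast
  have BS: "B k x \<subseteq> S" "finite (B k x)" if "x \<in> F" for x
    using that F(1) C(2) fin_ball unfolding cball_in_def by auto
  have finNB: "finite (N u (B k x))" "N u (B k x) \<subseteq> S" if "x \<in> F" for x u
    by (rule finN[OF BS(2,1)[OF that]], rule nbhd_subset_carrier)
  \<comment> \<open>The balls cover only the centres \<open>ctr y\<close>; enlarging each by
    \<open>sg\<close> catches the points \<open>y\<close> themselves.\<close>
  have "E \<subseteq> (\<Union>x\<in>F. N sg (B k x))"
  proof
    fix y assume y: "y \<in> E"
    then have "ctr y \<in> (\<Union>x\<in>F. B k x)" using F(2) unfolding C_def by blast
    then obtain x where x: "x \<in> F" "ctr y \<in> B k x" by blast
    have "y \<in> S \<and> ctr y \<in> S \<and> d y (ctr y) \<le> sg" using y E(2) ctr by blast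
    then have "d (ctr y) y \<le> sg" using metric_on_set_sym[OF metric, of y "ctr y"] by linarith
    then show "y \<in> (\<Union>x\<in>F. N sg (B k x))" using x y E(2) unfolding nbhd_def by auto
  qed
  then have "sum w E \<le> sum w (\<Union>x\<in>F. N sg (B k x))" 
    by (rule W_mono) (use finF finNB in blast)+
  also have "\<dots> \<le> (\<Sum>x\<in>F. sum w (N sg (B k x)))" using finF finNB by (intro W_UN) auto
  also have "\<dots> = (\<Sum>i<chi. \<Sum>x\<in>{x\<in>F. c x = i}. sum w (N sg (B k x)))"
    using F(3) finF by (intro sum.group[symmetric]) auto
  finally have sumE: "sum w E \<le> (\<Sum>i<chi. \<Sum>x\<in>{x\<in>F. c x = i}. sum w (N sg (B k x)))" .
  \<comment> \<open>Pigeonhole over the colours: some class carries at least the average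
    share.\<close>
  have "\<exists>i<chi. sum w E / chi \<le> (\<Sum>x\<in>{x\<in>F. c x = i}. sum w (N sg (B k x)))"
  proof (rule ccontr)
    assume "\<not> ?thesis"
    then have "(\<Sum>i<chi. \<Sum>x\<in>{x\<in>F. c x = i}. sum w (N sg (B k x))) < (\<Sum>i<chi. sum w E / chi)"
      using chi_pos by (intro sum_strict_mono) (auto simp: not_le)
    then show False using sumE chi_pos by simp
  qed
  then obtain i where i: "sum w E / chi \<le> (\<Sum>x\<in>{x\<in>F. c x = i}. sum w (N sg (B k x)))" by blast
  define V where "V = {x\<in>F. c x = i}"
  have V: "finite V" "V \<subseteq> F" unfolding V_def using finF by auto
  \<comment> \<open>A path from \<open>Y\<close> to a centre, across its ball and through the halo
    has length at most \<open>sg + b (k+1) + b (k-1)\<close>. The growth by a factor 4 fits this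
    below \<open>b (k+2)\<close>.\<close>
  have ZNY: "?Z x \<subseteq> ?NY" if "x \<in> V" for x
  proof
    fix z assume "z \<in> ?Z x"
    then obtain p where p: "z \<in> S" "p \<in> S" "d x p \<le> rad k x" "d p z \<le> b (k-1)"
      unfolding nbhd_def cball_in_def by blast
    have xC: "x \<in> C" using that V F by blast
    then obtain y where y: "y \<in> E" "x = ctr y" unfolding C_def by blast
    then have yS: "y \<in> S" "x \<in> S" "d y x \<le> sg" using E(2) ctr by blast+
    have "d y z \<le> d y x + (d x p + d p z)"
      using metric_on_set_triangle[OF metric, of y x z] metric_on_set_triangle[OF metric, of x p z] yS p by force
    also have "\<dots> \<le> sg + (b (Suc k) + b (k-1))" using yS p Cb[OF xC] by linarith
    also have "\<dots> \<le> b (k+2)"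
    proof -
      have "b (k-1) \<le> b (Suc k)" by (intro b_mono) simp
      then show ?thesis using b_step(1)[of "Suc k"] b_ge_sg[of "Suc k"] b_ge1[of "Suc k"] by simp
    qed
    finally show "z \<in> ?NY" using y E(3) p unfolding nbhd_def by blast
  qed
  \<comment> \<open>Balls of one colour are \<open>b k\<close> apart, and \<open>b (k-1)\<close> is
    less than half of that.\<close>
  have disj: "?Z x \<inter> ?Z y = {}" if "x \<in> V" "y \<in> V" "x \<noteq> y" for x y
  proof (rule nbhd_disjoint[OF metric])
    show "2 * b (k-1) < b k" using b_step(1)[of "k-1"] b_ge1[of "k-1"] k by simp
    have xy: "x \<in> F" "y \<in> F" "c x = c y" using that unfolding V_def by auto
    show "B k x \<subseteq> S" "B k y \<subseteq> S" using BS xy by blast+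
    fix p q assume "p \<in> B k x" "q \<in> B k y"
    then show "b k \<le> d p q" using Fsep xy that(3) by blast
  qed
  have part: "(\<Sum>x\<in>V. sum w (?Z x \<inter> P)) \<le> sum w (?NY \<inter> P)" for P
  proof -
    have "(\<Sum>x\<in>V. sum w (?Z x \<inter> P)) = sum w (\<Union>x\<in>V. ?Z x \<inter> P)"
    proof (rule sum.UNION_disjoint[symmetric])
      show "\<forall>i\<in>V. \<forall>j\<in>V. i \<noteq> j \<longrightarrow> (?Z i \<inter> P) \<inter> (?Z j \<inter> P) = {}" using disj by blast
    qed (use V finNB in auto)
    also have "\<dots> \<le> sum w (?NY \<inter> P)" using ZNY finNY by (intro W_mono) auto
    finally show ?thesis .
  qed
  \<comment> \<open>Measured in units of \<open>th / (8 * chi) * sum w Y\<close>, the spheres of the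
    class carry at least four units in total, while each of the two subtracted terms sums to at most
    one. So \<open>?g\<close> has a positive sum and is positive at some centre.\<close>
  let ?g = "\<lambda>x. sum w (thick_sphere k x) - (th / (8 * chi * D) * sum w (?Z x) + (sum w (?Z x - Om) + sum w (?Z x \<inter> bad)) / e)"
  have s1: "th * (sum w Y / (2 * chi)) \<le> (\<Sum>x\<in>V. sum w (thick_sphere k x))"
  proof -
    have "sum w Y / (2 * chi) \<le> sum w E / chi" using wE chi_pos by (simp add: field_simps)
    then have "th * (sum w Y / (2 * chi)) \<le> th * (\<Sum>x\<in>V. sum w (N sg (B k x)))"
      using i th unfolding V_def by (intro mult_left_mono) linarith+
    also have "\<dots> \<le> (\<Sum>x\<in>V. sum w (thick_sphere k x))"
    proof (subst sum_distrib_left, rule sum_mono)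
      fix x assume "x \<in> V"
      then have "x \<in> C" using V F(1) by blast
      then show "th * sum w (N sg (B k x)) \<le> sum w (thick_sphere k x)" using Cb by blast
    qed
    finally show ?thesis .
  qed
  have s2: "(\<Sum>x\<in>V. sum w (?Z x)) \<le> D * sum w Y" using part[of UNIV] ND by simp
  have "(\<Sum>x\<in>V. sum w (?Z x - Om)) + (\<Sum>x\<in>V. sum w (?Z x \<inter> bad)) \<le> e * (th / (8 * chi)) * sum w Y"
    using part[of "-Om"] part[of bad] Nb by (simp add: Diff_eq)
  then have s3: "((\<Sum>x\<in>V. sum w (?Z x - Om)) + (\<Sum>x\<in>V. sum w (?Z x \<inter> bad))) / e \<le> th / (8 * chi) * sum w Y"
    using e by (simp add: field_simps)
  have "th / (8 * chi * D) * (\<Sum>x\<in>V. sum w (?Z x)) \<le> th / (8 * chi * D) * (D * sum w Y)"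
    using s2 th D by (intro mult_left_mono) auto
  also have "\<dots> = th / (8 * chi) * sum w Y" using D by simp
  finally have s4: "th / (8 * chi * D) * (\<Sum>x\<in>V. sum w (?Z x)) \<le> th / (8 * chi) * sum w Y" .
  have "sum ?g V = (\<Sum>x\<in>V. sum w (thick_sphere k x)) - (th / (8 * chi * D) * (\<Sum>x\<in>V. sum w (?Z x))
        + ((\<Sum>x\<in>V. sum w (?Z x - Om)) + (\<Sum>x\<in>V. sum w (?Z x \<inter> bad))) / e)"
    by (simp add: sum_subtractf sum.distrib sum_distrib_left sum_divide_distrib add_divide_distrib)
  moreover have "th * (sum w Y / (2 * chi)) = 4 * (th / (8 * chi) * sum w Y)" by simp
  moreover have "0 < th / (8 * chi) * sum w Y" using th chi_pos Y by simp
  ultimately have "0 < sum ?g V" using s1 s3 s4 by linarith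
  then obtain x where x: "x \<in> V" "0 < ?g x" by (meson not_le sum_nonpos)
  then have xC: "x \<in> C" using V F by blast
  then obtain y where y: "y \<in> E" "x = ctr y" unfolding C_def by blast
  show ?thesis
    using that[of y x] y E ctr Cb[OF xC] ZNY[OF x(1)] x(2) by auto
qed


text \<open>All spheres share one thickness, although finite intersection dimension allows a
  separate one for each: thickening the whole intersection is then a change of a single number. For
  \<open>m = 0\<close> the set is all of \<open>S\<close>.\<close>

definition inter_bdry :: "nat \<Rightarrow> real \<Rightarrow> (nat \<Rightarrow> real) \<Rightarrow> (nat \<Rightarrow> 'g) \<Rightarrow> 'g set" where
  "inter_bdry m t r x = {y\<in>S. \<forall>l\<in>{1..m}. y \<in> thick_bdry S T d t (r l) (x l)}"

text \<open>State of the descent through the scales: i measures the thickness of the m spheres already found,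
  j bounds their radii from below and gives the size of the halo of Y in which almost all
  mass must be good and lie on the spheres. The scales strictly between i and j are still available.\<close>
definition concentrated :: "nat \<Rightarrow> nat \<Rightarrow> nat \<Rightarrow> real \<Rightarrow> bool" where
  "concentrated m i j e \<longleftrightarrow> (\<exists>Y x r. finite Y \<and> Y \<subseteq> inter_bdry m (b i) r x \<and> 0 < sum w Y \<and>
     (\<forall>l\<in>{1..m}. x l \<in> S \<and> b j \<le> r l \<and> x l \<in> inter_bdry (l - 1) (b i) r x) \<and>
     sum w (N (b j) Y) \<le> D * sum w Y \<and>
     sum w (N (b j) Y - inter_bdry m (b i) r x) + sum w (N (b j) Y \<inter> bad) \<le> e * sum w Y)"

lemma inter_bdry_subset: "inter_bdry m t r x \<subseteq> S"
  unfolding inter_bdry_def by auto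

lemma nbhd_inter_bdry: "t + u \<le> t' \<Longrightarrow> N u (inter_bdry m t r x) \<subseteq> inter_bdry m t' r x"
  using nbhd_thick_bdry[OF metric_T S_T] unfolding inter_bdry_def nbhd_def by blast

lemma inter_bdry_mono: "t \<le> t' \<Longrightarrow> inter_bdry m t r x \<subseteq> inter_bdry m t' r x"
  unfolding inter_bdry_def by (auto intro: subsetD[OF thick_bdry_mono])

lemma inter_bdry_cong:
  "(\<And>l. l \<in> {1..m} \<Longrightarrow> r l = r' l \<and> x l = x' l) \<Longrightarrow> inter_bdry m t r x = inter_bdry m t r' x'"
  unfolding inter_bdry_def by simp

lemma inter_bdry_Suc:
  "inter_bdry (Suc m) t r x = inter_bdry m t r x \<inter> thick_bdry S T d t (r (Suc m)) (x (Suc m))"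
proof -
  have "{1..Suc m} = insert (Suc m) {1..m}" by auto
  then show ?thesis unfolding inter_bdry_def by auto
qed

text \<open>With every thickness equal to \<open>b i\<close>, the product of thicknesses is at most
  \<open>b i ^ kappa\<close>. The growth condition \<open>b i ^ kappa * R \<le> b (Suc i)\<close>
  then makes all radii admissible, and finite intersection dimension empties a set that contains
  \<open>Y\<close>.\<close>

lemma not_concentrated_kappa:
  assumes "i < j"
  shows "\<not> concentrated kappa i j e"
proof
  assume "concentrated kappa i j e"
  then obtain Y x r where Y: "Y \<subseteq> inter_bdry kappa (b i) r x" "0 < sum w Y"
    and x: "\<forall>l\<in>{1..kappa}. x l \<in> S \<and> b j \<le> r l \<and> x l \<in> inter_bdry (l - 1) (b i) r x"
    unfolding concentrated_def by (elim exE conjE) (rule that)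
  have "(\<Inter>l\<in>{1..kappa}. thick_bdry S T d (b i) (r l) (x l)) = {}"
  proof (rule fid[of "\<lambda>_. b i"], rule ballI)
    fix l assume l: "l \<in> {1..kappa}"
    have "(\<Prod>j=1..l. b i) * R \<le> b i ^ kappa * R"
      using l R b_ge1[of i] by (auto intro: power_increasing)
    also have "\<dots> \<le> b (Suc i)" by (rule b_step)
    also have "\<dots> \<le> r l" using b_mono[of "Suc i" j] assms x l by force
    finally have "(\<Prod>j=1..l. b i) * R \<le> r l" .
    moreover have "\<forall>k\<in>{1..<l}. x l \<in> thick_bdry S T d (b i) (r k) (x k)"
      using x l unfolding inter_bdry_def by auto
    ultimately show "b i \<ge> 1 \<and> r l \<ge> (\<Prod>j=1..l. b i) * R \<and> x l \<in> S \<and>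
        (\<forall>k\<in>{1..<l}. x l \<in> thick_bdry S T d (b i) (r k) (x k))"
      using b_ge1 x l by blast
  qed
  moreover have "Y \<subseteq> (\<Inter>l\<in>{1..kappa}. thick_bdry S T d (b i) (r l) (x l))"
    using Y(1) unfolding inter_bdry_def by blast
  ultimately have "Y = {}" by blast
  then show False using Y(2) by simp
qed

text \<open>Between \<open>i\<close> and \<open>j\<close> there is room for \<open>n\<close>
  consecutive windows of length \<open>q + 2\<close>, with a margin of 5 for the ball at scale
  \<open>j - 2\<close> and its halo. One light window supplies the next thickness and
  \<open>q\<close> free scales above it. The relative error grows from
  \<open>e/4 * (th / (8 * chi))\<close> to \<open>e\<close>.\<close>

lemma concentrated_step:
  assumes conc: "concentrated m i j (e/4 * (th / (8 * chi)))" and e: "0 < e" "e \<le> 1"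
    and n: "32 * chi * D / (th * e) \<le> real n" and j: "i + n * (q + 2) + 5 \<le> j" "j \<le> Q"
  shows "\<exists>i' \<ge> i. i' + q < j \<and> concentrated (Suc m) i' (i' + q) e"
proof -
  obtain Y x r where Y: "finite Y" "Y \<subseteq> inter_bdry m (b i) r x" "0 < sum w Y"
    and x: "\<forall>l\<in>{1..m}. x l \<in> S \<and> b j \<le> r l \<and> x l \<in> inter_bdry (l - 1) (b i) r x"
    and NY: "sum w (N (b j) Y) \<le> D * sum w Y"
      "sum w (N (b j) Y - inter_bdry m (b i) r x) + sum w (N (b j) Y \<inter> bad) \<le> e/4 * (th / (8 * chi)) * sum w Y"
    using conc unfolding concentrated_def by (elim exE conjE) (rule that)
  define Om where "Om = inter_bdry m (b i) r x"
  \<comment> \<open>\<open>select_centre\<close> at scale \<open>k\<close> uses the halo of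
    \<open>Y\<close> up to scale \<open>k + 2\<close>, and the halo is controlled up to
    \<open>b j\<close>.\<close>
  define k where "k = j - 2"
  have jk: "j = k + 2" "1 \<le> k" "k < Q" using j unfolding k_def by auto
  have "0 < 32 * chi * D / (th * e)" using chi_pos D th e by simp
  then have n0: "0 < n" using n by (cases n) auto
  have YS: "Y \<subseteq> S" using Y(2) inter_bdry_subset by blast
  obtain y c where y: "y \<in> Y" and c: "c \<in> S" "d y c \<le> sg" "b k \<le> rad k c"
      and ZNY: "N (b (k-1)) (B k c) \<subseteq> N (b (k+2)) Y"
      and sel: "th / (8 * chi * D) * sum w (N (b (k-1)) (B k c))
       + (sum w (N (b (k-1)) (B k c) - Om) + sum w (N (b (k-1)) (B k c) \<inter> bad)) / (e/4) < sum w (thick_sphere k c)"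
    by (rule select_centre[OF Y(1) YS Y(3) jk(2,3), of "e/4" Om])
       (use e NY jk(1) in \<open>auto simp: Om_def\<close>)
  define Z where "Z = N (b (k-1)) (B k c)"
  define H where "H = thick_sphere k c"
  have BS: "B k c \<subseteq> S" "finite (B k c)" using fin_ball[OF c(1)] unfolding cball_in_def by auto
  have Z: "finite Z" "Z \<subseteq> S" unfolding Z_def by (rule finN[OF BS(2,1)], rule nbhd_subset_carrier)
  have HZ: "H \<subseteq> Z" using nbhd_mono[of sg "b (k-1)" "B k c" "B k c" S d] b_ge_sg[of "k-1"] unfolding H_def Z_def by blast
  have ZO: "0 \<le> sum w (Z - Om)" "0 \<le> sum w (Z \<inter> bad)" "0 \<le> sum w Z" using Z by (auto intro!: W_nonneg)
  have c1: "0 \<le> th / (8 * chi * D)" using th D by simp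
  have out: "sum w (Z - Om) + sum w (Z \<inter> bad) \<le> e/4 * sum w H"
  proof -
    have "(sum w (Z - Om) + sum w (Z \<inter> bad)) / (e/4) \<le> sum w H"
      using sel mult_nonneg_nonneg[OF c1 ZO(3)] unfolding Z_def H_def by linarith
    then show ?thesis using e by (simp add: field_simps)
  qed
  have H0: "0 < sum w H"
  proof -
    have "0 \<le> (sum w (Z - Om) + sum w (Z \<inter> bad)) / (e/4)" using ZO e by simp
    then show ?thesis using sel mult_nonneg_nonneg[OF c1 ZO(3)] unfolding Z_def H_def by linarith
  qed
  have ZH: "sum w Z \<le> 8 * chi * D / th * sum w H"
  proof -
    have "0 \<le> (sum w (Z - Om) + sum w (Z \<inter> bad)) / (e/4)" using ZO e by simp
    then have "th / (8 * chi * D) * sum w Z \<le> sum w H" using sel unfolding Z_def H_def by linarith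
    then show ?thesis using th D chi_pos by (simp add: field_simps)
  qed
  \<comment> \<open>Only the part of the new sphere that also lies on the old ones is kept. The
    discarded mass is at most \<open>e/4\<close> of that of \<open>H\<close>, so at least half
    remains.\<close>
  define H' where "H' = H \<inter> Om"
  have H'S: "H' \<subseteq> S" "finite H'" using HZ Z unfolding H'_def by (auto intro: finite_subset)
  have H'H: "sum w H / 2 \<le> sum w H'"
  proof -
    have "sum w H = sum w H' + sum w (H - Om)"
      unfolding H'_def using sum.Int_Diff[of H w Om] finite_subset[OF HZ Z(1)] by simp
    moreover have "sum w (H - Om) \<le> sum w (Z - Om)" using HZ Z by (intro W_mono) auto
    moreover have "e/4 * sum w H \<le> 1/2 * sum w H" using e H0 by (intro mult_right_mono) auto
    ultimately show ?thesis using out ZO by linarith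
  qed
  \<comment> \<open>The endpoints of the windows. The last, \<open>a n\<close>, is at most
    \<open>k - 2\<close>, so every neighbourhood \<open>M l\<close> stays inside \<open>Z\<close>,
    whose mass is controlled by that of \<open>H\<close>.\<close>
  define a where "a l = i + 1 + l * (q + 2)" for l
  define M where "M l = N (b (a l)) H'" for l
  have al: "a l \<le> k - 2" if "l \<le> n" for l
  proof -
    have "l * (q + 2) \<le> n * (q + 2)" using that by (intro mult_right_mono) auto
    then show ?thesis using j unfolding a_def k_def by linarith
  qed
  have MZ: "M l \<subseteq> Z" if "l \<le> n" for l
  proof -
    have "M l \<subseteq> N (b (a l)) (N sg (B k c))" unfolding M_def H'_def H_def by (intro nbhd_mono) auto
    also have "\<dots> \<subseteq> Z" unfolding Z_def
    proof (rule nbhd_nbhd[OF metric BS(1)])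
      have "k - 1 = Suc (k - 2)" using j unfolding k_def by linarith
      then show "sg + b (a l) \<le> b (k - 1)"
        using b_step(1)[of "k-2"] b_mono[OF al[OF that]] b_ge_sg[of "k-2"] b_ge1[of "k-2"] by simp
    qed
    finally show ?thesis .
  qed
  have "sum w (M n) - sum w (M 0) \<le> sum w Z"
    using W_mono[OF MZ[of n] Z] W_nonneg[OF order_trans[OF MZ[of 0] Z(2)]] by simp
  from small_increment[OF n0 this] obtain l where l: "l < n" "sum w (M (Suc l)) - sum w (M l) \<le> sum w Z / n" by blast
  have MS: "M l \<subseteq> M (Suc l)" unfolding M_def a_def by (intro nbhd_mono b_mono) auto
  have finM: "finite (M (Suc l))" "M (Suc l) \<subseteq> S" using MZ[of "Suc l"] l Z by (auto intro: finite_subset)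
  \<comment> \<open>The lower bound for \<open>n\<close> is the factor
    \<open>8 * chi * D / th\<close> of \<open>ZH\<close> divided by the desired proportion
    \<open>e/4\<close>.\<close>
  have incr: "sum w (M (Suc l) - M l) \<le> e/4 * sum w H"
  proof -
    have "sum w (M (Suc l) - M l) \<le> sum w Z / n"
      using l(2) sum_diff[OF finM(1) MS, of w] by simp
    also have "\<dots> \<le> (8 * chi * D / th * sum w H) / (32 * chi * D / (th * e))"
      using ZH n ZO H0 th D chi_pos e by (intro frac_le) auto
    also have "\<dots> = e/4 * sum w H" using th D chi_pos e by (simp add: field_simps)
    finally show ?thesis .
  qed
  \<comment> \<open>The new set is the whole inner neighbourhood \<open>M l\<close>, cut down to the
    old spheres, and not just \<open>H'\<close>: the halo of \<open>Y'\<close> then reaches beyond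
    \<open>M l\<close> only into the light shell.\<close>
  define Y' where "Y' = M l \<inter> Om"
  define i' where "i' = a l + 1"
  define x' where "x' = x(Suc m := c)"
  define r' where "r' = r(Suc m := rad k c)"
  have i'q: "Suc (i' + q) = a (Suc l)" unfolding i'_def a_def by simp
  have i'k: "i' + q < k - 2" using al[of "Suc l"] l i'q by simp
  have ii': "i < i'" "a l < i'" unfolding i'_def a_def by auto
  have HY': "H' \<subseteq> Y'"
    using subset_nbhd[OF metric H'S(1), of "b (a l)"] b_ge1[of "a l"] unfolding Y'_def M_def H'_def by auto
  have Y'M: "Y' \<subseteq> M l" "finite Y'" "Y' \<subseteq> S" unfolding Y'_def using MS finM by (auto intro: finite_subset)
  have Y'H: "sum w H / 2 \<le> sum w Y'" using H'H W_mono[OF HY' Y'M(2,3)] by simp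
  have NY': "N (b (i' + q)) Y' \<subseteq> M (Suc l)"
  proof -
    have "N (b (i' + q)) Y' \<subseteq> N (b (i' + q)) (N (b (a l)) H')" using Y'M(1) unfolding M_def by (rule nbhd_mono[OF order_refl])
    also have "\<dots> \<subseteq> M (Suc l)" unfolding M_def
    proof (rule nbhd_nbhd[OF metric H'S(1)])
      have "b (a l) \<le> b (i' + q)" using ii' by (intro b_mono) simp
      then show "b (a l) + b (i' + q) \<le> b (a (Suc l))"
        using b_step(1)[of "i' + q"] b_ge1[of "i' + q"] unfolding i'q by simp
    qed
    finally show ?thesis .
  qed
  have old: "inter_bdry m' t r' x' = inter_bdry m' t r x" if "m' \<le> m" for m' t
    using that unfolding r'_def x'_def by (intro inter_bdry_cong) auto
  have bii': "b i + sg \<le> b i'" "b (a l) + sg \<le> b i'"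
  proof -
    have "b (Suc i) \<le> b i'" "b (Suc (a l)) \<le> b i'" using ii' by (auto intro!: b_mono)
    then show "b i + sg \<le> b i'" "b (a l) + sg \<le> b i'"
      using b_step(1)[of i] b_ge_sg[of i] b_step(1)[of "a l"] b_ge_sg[of "a l"] sg by linarith+
  qed
  have MOm: "M l \<inter> Om \<subseteq> inter_bdry (Suc m) (b i') r' x'"
  proof -
    have "M l \<subseteq> N (b (a l)) (thick_bdry S T d sg (rad k c) c)"
      unfolding M_def H'_def H_def by (intro nbhd_mono) auto
    also have "\<dots> \<subseteq> thick_bdry S T d (b i') (rad k c) c"
      using bii'(2) by (intro nbhd_thick_bdry[OF metric_T S_T]) simp
    finally have "M l \<subseteq> thick_bdry S T d (b i') (rad k c) c" .
    moreover have "Om \<subseteq> inter_bdry m (b i') r x" unfolding Om_def using ii' by (intro inter_bdry_mono b_mono) simp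
    ultimately show ?thesis unfolding inter_bdry_Suc old[OF order_refl] by (auto simp: r'_def x'_def)
  qed
  have chain: "\<forall>l\<in>{1..Suc m}. x' l \<in> S \<and> b (i' + q) \<le> r' l \<and> x' l \<in> inter_bdry (l - 1) (b i') r' x'"
  proof
    fix p assume p: "p \<in> {1..Suc m}"
    show "x' p \<in> S \<and> b (i' + q) \<le> r' p \<and> x' p \<in> inter_bdry (p - 1) (b i') r' x'"
    proof (cases "p = Suc m")
      case True
      \<comment> \<open>The new centre inherits its position on all earlier spheres from the point
        \<open>y\<close> of \<open>Y\<close> within distance \<open>sg\<close>; the extra thickness
        is absorbed in passing from \<open>i\<close> to \<open>i'\<close>.\<close>
      have "c \<in> N sg (inter_bdry m (b i) r x)" using y Y(2) c unfolding nbhd_def by blast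
      then have "c \<in> inter_bdry m (b i') r x" using nbhd_inter_bdry[OF bii'(1)] by blast
      moreover have "b (i' + q) \<le> rad k c" using b_mono[of "i' + q" k] i'k c(3) by linarith
      ultimately show ?thesis using True c old[of m] by (simp add: x'_def r'_def)
    next
      case False
      then have p': "p \<in> {1..m}" using p by auto
      have "x p \<in> inter_bdry (p - 1) (b i') r x"
        using x p' inter_bdry_mono[OF b_mono[of i i']] ii' by fastforce
      moreover have "b (i' + q) \<le> r p" using b_mono[of "i' + q" j] i'k jk x p' by fastforce
      ultimately show ?thesis using x p' False old[of "p - 1"] by (auto simp: x'_def r'_def)
    qed
  qed
  let ?N' = "N (b (i' + q)) Y'"
  have N'Z: "?N' \<subseteq> Z" using NY' MZ[of "Suc l"] l by auto
  have N'Y': "?N' - Y' \<subseteq> (M (Suc l) - M l) \<union> (Z - Om)" using NY' N'Z unfolding Y'_def by auto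
  have "sum w (?N' - Y') \<le> sum w ((M (Suc l) - M l) \<union> (Z - Om))"
    using N'Y' finM Z by (intro W_mono) auto
  also have "\<dots> \<le> sum w (M (Suc l) - M l) + sum w (Z - Om)"
  proof -
    have "0 \<le> sum w ((M (Suc l) - M l) \<inter> (Z - Om))" using finM by (intro W_nonneg) auto
    then show ?thesis using sum.union_inter[of "M (Suc l) - M l" "Z - Om" w] finM Z by simp
  qed
  finally have N'1: "sum w (?N' - Y') \<le> sum w (M (Suc l) - M l) + sum w (Z - Om)" .
  have N'2: "sum w (?N' \<inter> bad) \<le> sum w (Z \<inter> bad)" using N'Z Z by (intro W_mono) auto
  have N'3: "sum w (?N' - inter_bdry (Suc m) (b i') r' x') \<le> sum w (?N' - Y')"
    using MOm N'Z Z unfolding Y'_def by (intro W_mono) (auto intro: finite_subset)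
  \<comment> \<open>The shell contributes \<open>e/4\<close>, and the mass off the old spheres
    together with the bad mass another \<open>e/4\<close>, relative to \<open>H\<close>. Since
    \<open>Y'\<close> has at least half the mass of \<open>H\<close>, the sum \<open>e/2\<close>
    becomes \<open>e\<close>.\<close>
  have tot: "sum w (?N' - Y') + sum w (?N' \<inter> bad) \<le> e * sum w Y'"
  proof -
    have "sum w (?N' - Y') + sum w (?N' \<inter> bad) \<le> e * (sum w H / 2)" using N'1 N'2 out incr by linarith
    also have "\<dots> \<le> e * sum w Y'" using Y'H e by (intro mult_left_mono) auto
    finally show ?thesis .
  qed
  \<comment> \<open>Past the initial ball, the doubling bound comes from concentration: the halo
    adds at most \<open>e * sum w Y'\<close>, and \<open>1 + e \<le> 2 \<le> D\<close>.\<close>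
  have "sum w ?N' \<le> D * sum w Y'"
  proof -
    have "Y' \<subseteq> ?N'" using subset_nbhd[OF metric Y'M(3)] b_ge1[of "i' + q"] by simp
    then have "sum w ?N' = sum w (?N' - Y') + sum w Y'"
      using sum.subset_diff[of Y' ?N' w] N'Z Z finite_subset by blast
    moreover have "0 \<le> sum w (?N' \<inter> bad)" using N'Z Z by (intro W_nonneg) auto
    moreover have "e * sum w Y' \<le> 1 * sum w Y'" using e Y'H H0 by (intro mult_right_mono) auto
    moreover have "2 * sum w Y' \<le> D * sum w Y'" using D Y'H H0 by (intro mult_right_mono) auto
    ultimately show ?thesis using tot by linarith
  qed
  moreover have "Y' \<subseteq> inter_bdry (Suc m) (b i') r' x'" using MOm unfolding Y'_def .
  moreover have "0 < sum w Y'" using Y'H H0 by simp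
  ultimately have "concentrated (Suc m) i' (i' + q) e"
    unfolding concentrated_def using Y'M(2) chain tot N'3
    by (intro exI[of _ Y'] exI[of _ x'] exI[of _ r'] conjI) (assumption | linarith)+
  moreover have "i' + q < j" using i'k unfolding k_def by simp
  ultimately show ?thesis using ii' by (intro exI[of _ i']) simp
qed


text \<open>The induction is on the number \<open>n\<close> of spheres still missing, since both the
  tolerance and the supply of scales are dictated by the steps to come.\<close>

lemma not_concentrated:
  "m + n = kappa \<Longrightarrow> i + depth (th / (8 * chi)) D n \<le> j \<Longrightarrow> j \<le> Q \<Longrightarrow>
     \<not> concentrated m i j (tol (th / (8 * chi)) n)"
proof (induction n arbitrary: m i j)
  case 0
  then show ?case using not_concentrated_kappa[of i j] by simp
next
  case (Suc n)
  let ?c = "th / (8 * chi)"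
  let ?n = "nat \<lceil>4 * D / (?c * tol ?c n)\<rceil>"
  have c: "0 < ?c" "?c \<le> 1" using th chi_pos by (auto simp: field_simps)
  have e: "0 < tol ?c n" "tol ?c n \<le> 1" using tol_bounds[OF c] by auto
  show ?case
  proof
    assume "concentrated m i j (tol ?c (Suc n))"
    then have conc: "concentrated m i j (tol ?c n / 4 * ?c)" by simp
    have "32 * chi * D / (th * tol ?c n) = 4 * D / (?c * tol ?c n)" by simp
    also have "\<dots> \<le> real ?n" by linarith
    finally have "\<exists>i'\<ge>i. i' + depth ?c D n < j \<and> concentrated (Suc m) i' (i' + depth ?c D n) (tol ?c n)"
      using Suc.prems by (intro concentrated_step[OF conc e]) auto
    then obtain i' where "i' + depth ?c D n < j" "concentrated (Suc m) i' (i' + depth ?c D n) (tol ?c n)" by blast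
    then show False using Suc.IH[of "Suc m" i' "i' + depth ?c D n"] Suc.prems by simp
  qed
qed

text \<open>Before any sphere is chosen the intersection is all of \<open>S\<close>, so the starting
  state asks only for doubling of \<open>Y\<close> and for little bad mass. As that state is
  impossible, the bad mass must be large.\<close>

theorem bad_mass_lower_bound:
  assumes "depth (th / (8 * chi)) D kappa \<le> Q" "finite Y" "Y \<subseteq> S" "0 < sum w Y"
    and "sum w (N (b Q) Y) \<le> D * sum w Y"
  shows "tol (th / (8 * chi)) kappa * sum w Y < sum w (N (b Q) Y \<inter> bad)"
proof (rule ccontr)
  assume "\<not> ?thesis"
  moreover have "inter_bdry 0 t r x = S" for t r x unfolding inter_bdry_def by simp
  moreover have "sum w (N (b Q) Y - S) = 0" using nbhd_subset_carrier[of S d "b Q" Y] by (simp add: Diff_eq_empty_iff[THEN iffD2])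
  ultimately have "concentrated 0 0 Q (tol (th / (8 * chi)) kappa)"
    unfolding concentrated_def using assms(2-5)
    by (intro exI[of _ Y]) auto
  then show False using not_concentrated[of 0 kappa 0 Q] assms(1) by simp
qed

end

section \<open>Nonsingular actions\<close>

locale nonsingular_system = prob_space M + Gt: group Gt
  for M :: "'x measure" and Gt :: "('g, 'b) monoid_scheme" (structure) +
  fixes G :: "'g set" and a :: "'g \<Rightarrow> 'x \<Rightarrow> 'x"
  assumes sub: "subgroup G Gt" and countable_G: "countable G"
    and action: "nonsingular_action Gt G M a"
begin

abbreviation "om \<equiv> omega Gt M a"
abbreviation "hat \<equiv> hat_op Gt M a"

lemma G_closed [simp, intro]:
  "\<one>\<^bsub>Gt\<^esub> \<in> G" "g \<in> G \<Longrightarrow> h \<in> G \<Longrightarrow> g \<otimes>\<^bsub>Gt\<^esub> h \<in> G" "g \<in> G \<Longrightarrow> inv\<^bsub>Gt\<^esub> g \<in> G" "g \<in> G \<Longrightarrow> g \<in> carrier Gt"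
  using sub by (auto simp: subgroup.one_closed subgroup.m_closed subgroup.m_inv_closed subgroup.mem_carrier)

lemma a_meas [measurable]: "g \<in> G \<Longrightarrow> a g \<in> M \<rightarrow>\<^sub>M M"
  using action unfolding nonsingular_action_def by simp

lemma a_space: "g \<in> G \<Longrightarrow> x \<in> space M \<Longrightarrow> a g x \<in> space M"
  by (rule measurable_space[OF a_meas])

lemma a_one: "x \<in> space M \<Longrightarrow> a \<one>\<^bsub>Gt\<^esub> x = x"
  using action unfolding nonsingular_action_def by simp

lemma a_mult: "g \<in> G \<Longrightarrow> h \<in> G \<Longrightarrow> x \<in> space M \<Longrightarrow> a (g \<otimes>\<^bsub>Gt\<^esub> h) x = a g (a h x)"
  using action unfolding nonsingular_action_def by simp

lemma a_inv: "g \<in> G \<Longrightarrow> x \<in> space M \<Longrightarrow> a (inv\<^bsub>Gt\<^esub> g) (a g x) = x" "g \<in> G \<Longrightarrow> x \<in> space M \<Longrightarrow> a g (a (inv\<^bsub>Gt\<^esub> g) x) = x"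
  using a_mult[of "inv\<^bsub>Gt\<^esub> g" g x] a_mult[of g "inv\<^bsub>Gt\<^esub> g" x] a_one[of x] by simp_all

lemma null_distr: "g \<in> G \<Longrightarrow> null_sets (distr M M (a g)) = null_sets M"
  using action unfolding nonsingular_action_def by simp

lemma AE_act:
  assumes "g \<in> G" "AE x in M. P x"
  shows "AE x in M. P (a g x)"
proof -
  have "AE x in distr M M (a g). P x"
    using assms(2) null_distr[OF assms(1)] unfolding eventually_ae_filter by simp
  then show ?thesis by (rule AE_distrD[OF a_meas[OF assms(1)]])
qed

lemma om_nonneg [simp]: "0 \<le> om g x"
  unfolding omega_def by simp

lemma om_meas [measurable]: "om g \<in> borel_measurable M"
  unfolding omega_def by measurable

lemma hat_meas [measurable]: "g \<in> G \<Longrightarrow> F \<in> borel_measurable M \<Longrightarrow> hat g F \<in> borel_measurable M"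
  unfolding hat_op_def
  by (intro borel_measurable_times om_meas measurable_compose[OF a_meas])

lemma hat_one: "hat g (\<lambda>_. 1) x = om g x"
  unfolding hat_op_def by simp

text \<open>Change of variables: \<open>om g\<close> is the density of the push-forward under the
  inverse of \<open>g\<close>, against which \<open>F (a g x)\<close> integrates to the integral of
  \<open>F\<close>.\<close>

lemma
  assumes g: "g \<in> G" and F: "integrable M F"
  shows integrable_hat: "integrable M (hat g F)"
    and integral_hat: "(\<integral>x. hat g F x \<partial>M) = (\<integral>x. F x \<partial>M)"
proof -
  let ?N = "distr M M (a (inv\<^bsub>Gt\<^esub> g))"
  have ig: "inv\<^bsub>Gt\<^esub> g \<in> G" using g by simp
  have mF [measurable]: "F \<in> borel_measurable M" using F by simp
  have mFg: "(\<lambda>x. F (a g x)) \<in> borel_measurable M" by (rule measurable_compose[OF a_meas[OF g] mF])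
  have ac: "absolutely_continuous M ?N" "sets ?N = sets M"
    using null_distr[OF ig] unfolding absolutely_continuous_def by simp_all
  interpret N: prob_space ?N by (rule prob_space_distr[OF a_meas[OF ig]])
  have N: "sigma_finite_measure ?N" by unfold_locales
  have "integrable ?N (\<lambda>x. F (a g x)) \<longleftrightarrow> integrable M (\<lambda>x. F (a g (a (inv\<^bsub>Gt\<^esub> g) x)))"
    by (rule integrable_distr_eq[OF a_meas[OF ig] mFg])
  also have "\<dots> \<longleftrightarrow> integrable M F"
    using a_inv(2)[OF g] by (intro Bochner_Integration.integrable_cong) auto
  finally have "integrable ?N (\<lambda>x. F (a g x))" using F by simp
  then show "integrable M (hat g F)"
    unfolding RN_deriv_integrable[OF N ac mFg] hat_op_def omega_def by (simp add: mult.commute)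
  have "(\<integral>x. F (a g x) \<partial>?N) = (\<integral>x. F (a g (a (inv\<^bsub>Gt\<^esub> g) x)) \<partial>M)"
    by (rule integral_distr[OF a_meas[OF ig] mFg])
  also have "\<dots> = (\<integral>x. F x \<partial>M)"
    using a_inv(2)[OF g] by (intro Bochner_Integration.integral_cong) auto
  finally show "(\<integral>x. hat g F x \<partial>M) = (\<integral>x. F x \<partial>M)"
    unfolding RN_deriv_integral[OF N ac mFg] hat_op_def omega_def by (simp add: mult.commute)
qed

lemma integrable_bounded:
  assumes "F \<in> borel_measurable M" "\<And>x. x \<in> space M \<Longrightarrow> \<bar>F x\<bar> \<le> (c::real)"
  shows "integrable M F"
  by (rule integrable_const_bound[of _ c]) (use assms in auto)

text \<open>Both sides have the same integral over every measurable \<open>A\<close>. The test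
  function is the indicator of \<open>A\<close> precomposed with the inverse of the product;
  applying \<open>hat\<close> for the product, or the two \<open>hat\<close>s in turn, preserves its
  integral and restores the indicator of \<open>A\<close>.\<close>

lemma om_cocycle_AE:
  assumes s: "s \<in> G" and g: "g \<in> G"
  shows "AE x in M. om (s \<otimes>\<^bsub>Gt\<^esub> g) x = om s (a g x) * om g x"
proof -
  have one: "integrable M (\<lambda>_. 1 :: real)" by simp
  have eq1: "hat (s \<otimes>\<^bsub>Gt\<^esub> g) (\<lambda>_. 1) = om (s \<otimes>\<^bsub>Gt\<^esub> g)" "hat g (hat s (\<lambda>_. 1)) = (\<lambda>x. om s (a g x) * om g x)"
    unfolding hat_op_def by auto
  have sg: "s \<otimes>\<^bsub>Gt\<^esub> g \<in> G" using s g by simp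
  show ?thesis
  proof (rule density_unique_real)
    show "integrable M (om (s \<otimes>\<^bsub>Gt\<^esub> g))" using integrable_hat[OF sg one] unfolding eq1 .
    show "integrable M (\<lambda>x. om s (a g x) * om g x)"
      using integrable_hat[OF g integrable_hat[OF s one]] unfolding eq1 .
    fix A assume A: "A \<in> sets M"
    let ?F = "\<lambda>x. indicator A (a (inv\<^bsub>Gt\<^esub> (s \<otimes>\<^bsub>Gt\<^esub> g)) x) :: real"
    have F: "integrable M ?F"
      by (rule integrable_bounded[of _ 1]) (use A sg in \<open>auto simp: indicator_def\<close>)
    have "(\<integral>x. hat (s \<otimes>\<^bsub>Gt\<^esub> g) ?F x \<partial>M) = (\<integral>x. hat g (hat s ?F) x \<partial>M)"
      unfolding integral_hat[OF g integrable_hat[OF s F]] integral_hat[OF s F] integral_hat[OF sg F] ..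
    moreover have "(\<integral>x. hat (s \<otimes>\<^bsub>Gt\<^esub> g) ?F x \<partial>M) = set_lebesgue_integral M A (om (s \<otimes>\<^bsub>Gt\<^esub> g))"
      unfolding set_lebesgue_integral_def
      by (intro Bochner_Integration.integral_cong) (simp_all add: hat_op_def a_inv[OF sg] del: Gt.inv_mult_group)
    moreover have "(\<integral>x. hat g (hat s ?F) x \<partial>M) = set_lebesgue_integral M A (\<lambda>x. om s (a g x) * om g x)"
      unfolding set_lebesgue_integral_def
    proof (intro Bochner_Integration.integral_cong refl)
      fix x assume "x \<in> space M"
      then show "hat g (hat s ?F) x = indicator A x *\<^sub>R (om s (a g x) * om g x)"
        using a_mult[OF s g, of x, symmetric] a_inv(1)[OF sg, of x] unfolding hat_op_def by simp
    qed
    ultimately show "set_lebesgue_integral M A (om (s \<otimes>\<^bsub>Gt\<^esub> g)) = set_lebesgue_integral M A (\<lambda>x. om s (a g x) * om g x)"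
      by simp
  qed
qed

lemma om_one_AE: "AE x in M. om \<one>\<^bsub>Gt\<^esub> x = 1"
proof (rule density_unique_real)
  have one: "integrable M (\<lambda>_. 1 :: real)" by simp
  show "integrable M (om \<one>\<^bsub>Gt\<^esub>)" using integrable_hat[OF G_closed(1) one] unfolding hat_op_def by simp
  show "integrable M (\<lambda>_. 1 :: real)" by simp
  fix A assume A: "A \<in> sets M"
  have F: "integrable M (indicator A :: _ \<Rightarrow> real)"
    by (rule integrable_bounded[of _ 1]) (use A in \<open>auto simp: indicator_def\<close>)
  have "set_lebesgue_integral M A (om \<one>\<^bsub>Gt\<^esub>) = (\<integral>x. hat \<one>\<^bsub>Gt\<^esub> (indicator A) x \<partial>M)"
    unfolding set_lebesgue_integral_def
    by (intro Bochner_Integration.integral_cong) (simp_all add: hat_op_def a_one)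
  also have "\<dots> = (\<integral>x. indicator A x \<partial>M)" by (rule integral_hat[OF G_closed(1) F])
  finally show "set_lebesgue_integral M A (om \<one>\<^bsub>Gt\<^esub>) = set_lebesgue_integral M A (\<lambda>_. 1)"
    unfolding set_lebesgue_integral_def by simp
qed

text \<open>Countability of \<open>G\<close> collects the exceptional sets of all cocycle identities
  into one null set. The property is demanded only of the base point \<open>x\<close>; statements
  about \<open>a c x\<close> are always pulled back to \<open>x\<close>.\<close>

definition nice :: "'x \<Rightarrow> bool" where
  "nice x \<longleftrightarrow> x \<in> space M \<and> om \<one>\<^bsub>Gt\<^esub> x = 1 \<and>
     (\<forall>s\<in>G. \<forall>g\<in>G. om (s \<otimes>\<^bsub>Gt\<^esub> g) x = om s (a g x) * om g x)"

lemma AE_nice: "AE x in M. nice x"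
proof -
  have "AE x in M. \<forall>s\<in>G. \<forall>g\<in>G. om (s \<otimes>\<^bsub>Gt\<^esub> g) x = om s (a g x) * om g x"
    using om_cocycle_AE by (simp add: AE_ball_countable countable_G)
  then show ?thesis using om_one_AE AE_space unfolding nice_def by eventually_elim simp
qed

lemma nice_space: "nice x \<Longrightarrow> x \<in> space M"
  unfolding nice_def by simp

lemma nice_cocycle: "nice x \<Longrightarrow> s \<in> G \<Longrightarrow> g \<in> G \<Longrightarrow> om (s \<otimes>\<^bsub>Gt\<^esub> g) x = om s (a g x) * om g x"
  unfolding nice_def by simp

lemma nice_inv: "nice x \<Longrightarrow> g \<in> G \<Longrightarrow> om (inv\<^bsub>Gt\<^esub> g) (a g x) * om g x = 1"
  "nice x \<Longrightarrow> g \<in> G \<Longrightarrow> om g (a (inv\<^bsub>Gt\<^esub> g) x) * om (inv\<^bsub>Gt\<^esub> g) x = 1"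
  using nice_cocycle[of x "inv\<^bsub>Gt\<^esub> g" g] nice_cocycle[of x g "inv\<^bsub>Gt\<^esub> g"] unfolding nice_def by simp_all

lemma nice_pos: "nice x \<Longrightarrow> g \<in> G \<Longrightarrow> 0 < om g x"
  using nice_inv(1)[of x g] om_nonneg[of g x] by (cases "om g x = 0") (auto simp: less_le)

text \<open>Transference: the factor \<open>om c x\<close> depends only on the orbit point and
  cancels in ratios, so averages at \<open>a c x\<close> become sums over right translates at
  \<open>x\<close>.\<close>

lemma hat_orbit: "nice x \<Longrightarrow> h \<in> G \<Longrightarrow> c \<in> G \<Longrightarrow> hat h F (a c x) * om c x = hat (h \<otimes>\<^bsub>Gt\<^esub> c) F x"
  unfolding hat_op_def using nice_cocycle[of x h c] a_mult[of h c x] nice_space by simp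

lemma integrable_hat_sum: "A \<subseteq> G \<Longrightarrow> integrable M F \<Longrightarrow> integrable M (\<lambda>x. \<Sum>g\<in>A. hat g F x)"
  using integrable_hat by (intro Bochner_Integration.integrable_sum) auto

lemma integral_hat_sum:
  "A \<subseteq> G \<Longrightarrow> integrable M F \<Longrightarrow> (\<integral>x. (\<Sum>g\<in>A. hat g F x) \<partial>M) = card A * (\<integral>x. F x \<partial>M)"
  using integrable_hat integral_hat by (subst Bochner_Integration.integral_sum) (auto simp: subset_eq)

lemma orbit_sets:
  assumes "A \<in> sets M"
  shows "{x\<in>space M. \<exists>g\<in>G. a g x \<in> A} \<in> sets M"
proof -
  have "{x\<in>space M. \<exists>g\<in>G. a g x \<in> A} = (\<Union>g\<in>G. a g -` A \<inter> space M)" by auto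
  also have "\<dots> \<in> sets M"
    by (rule sets.countable_UN'[OF countable_G]) (use a_meas assms in \<open>auto intro: measurable_sets\<close>)
  finally show ?thesis .
qed

text \<open>The action laws hold at every point of the space, so the saturation is strictly
  invariant, as \<open>ergodic_action\<close> requires.\<close>

lemma ergodic_orbit:
  assumes erg: "ergodic_action G M a" and A: "A \<in> sets M"
  shows "prob {x\<in>space M. \<exists>g\<in>G. a g x \<in> A} = 0 \<or> prob {x\<in>space M. \<exists>g\<in>G. a g x \<in> A} = 1"
proof -
  let ?O = "{x\<in>space M. \<exists>g\<in>G. a g x \<in> A}"
  have "a g -` ?O \<inter> space M = ?O" if g: "g \<in> G" for g
  proof (intro equalityI subsetI)
    fix x assume "x \<in> a g -` ?O \<inter> space M"
    then obtain h where "x \<in> space M" "h \<in> G" "a h (a g x) \<in> A" by blast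
    then have "x \<in> space M \<and> h \<otimes>\<^bsub>Gt\<^esub> g \<in> G \<and> a (h \<otimes>\<^bsub>Gt\<^esub> g) x \<in> A" using a_mult[of h g x] g by simp
    then show "x \<in> ?O" by blast
  next
    fix x assume "x \<in> ?O"
    then obtain h where h: "x \<in> space M" "h \<in> G" "a h x \<in> A" by blast
    have "a (h \<otimes>\<^bsub>Gt\<^esub> inv\<^bsub>Gt\<^esub> g) (a g x) = a h x"
      using a_mult[of h "inv\<^bsub>Gt\<^esub> g" "a g x"] a_inv(1)[OF g h(1)] a_space[OF g h(1)] h g by simp
    then have "h \<otimes>\<^bsub>Gt\<^esub> inv\<^bsub>Gt\<^esub> g \<in> G \<and> a (h \<otimes>\<^bsub>Gt\<^esub> inv\<^bsub>Gt\<^esub> g) (a g x) \<in> A" using h g by simp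
    then have "a g x \<in> ?O" using a_space[OF g h(1)] by blast
    then show "x \<in> a g -` ?O \<inter> space M" using h by simp
  qed
  then have "\<forall>g\<in>G. a g -` ?O \<inter> space M = ?O" by blast
  then show ?thesis by (rule erg[unfolded ergodic_action_def, THEN bspec, OF orbit_sets[OF A], THEN mp])
qed

text \<open>A measure-theoretic exhaustion: greedily move the mass of u onto the constant function with the
  same integral along the group elements; by ergodicity nothing is left over. This replaces the
  duality argument for the density of the coboundaries.\<close>
lemma coboundary_approx:
  assumes erg: "ergodic_action G M a" and u: "u \<in> borel_measurable M" "\<And>x. 0 \<le> u x \<and> u x \<le> c" and "0 < \<delta>"
  shows "\<exists>(n::nat) F s. (\<forall>j<n. F j \<in> borel_measurable M \<and> (\<forall>x. \<bar>F j x\<bar> \<le> c) \<and> s j \<in> G) \<and>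
     (\<integral>x. \<bar>u x - (\<integral>y. u y \<partial>M) - (\<Sum>j<n. F j x - hat (s j) (F j) x)\<bar> \<partial>M) < \<delta>"
proof -
  define s where "s = from_nat_into G"
  have Gne: "G \<noteq> {}" using G_closed(1) by blast
  have sG [simp]: "s j \<in> G" for j unfolding s_def by (rule from_nat_into[OF Gne])
  have s_surj: "\<exists>j. s j = g" if "g \<in> G" for g
    unfolding s_def using from_nat_into_surj[OF countable_G that] by blast
  \<comment> \<open>\<open>fst p\<close> is the mass still to be moved and \<open>snd p\<close> the
    room left in the target. \<open>hat\<close> of the inverse carries the room to the source point,
    where the minimum is taken. The \<open>max 0\<close> guards the null set on which the room may
    be negative.\<close>
  define step where "step g p x = max 0 (min (fst p x) (hat (inv\<^bsub>Gt\<^esub> g) (snd p) x))"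
    for g and p :: "('x \<Rightarrow> real) \<times> ('x \<Rightarrow> real)" and x
  define P where "P = rec_nat (u, \<lambda>_. \<integral>y. u y \<partial>M)
     (\<lambda>j p. (\<lambda>x. fst p x - step (s j) p x, \<lambda>x. snd p x - hat (s j) (step (s j) p) x))"
  define U where "U j = fst (P j)" for j
  define V where "V j = snd (P j)" for j
  define F where "F j = step (s j) (P j)" for j
  have U0: "U 0 = u" and V0: "V 0 = (\<lambda>_. \<integral>y. u y \<partial>M)" unfolding U_def V_def P_def by simp_all
  have US: "U (Suc j) x = U j x - F j x" and VS: "V (Suc j) x = V j x - hat (s j) (F j) x" for j x
    unfolding U_def V_def F_def P_def by simp_all
  have Fx: "F j x = max 0 (min (U j x) (hat (inv\<^bsub>Gt\<^esub> (s j)) (V j) x))" for j x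
    unfolding F_def step_def U_def V_def ..
  have meas: "U j \<in> borel_measurable M \<and> V j \<in> borel_measurable M" for j
  proof (induction j)
    case 0
    then show ?case using u(1) by (simp add: U0 V0)
  next
    case (Suc j)
    have [measurable]: "U j \<in> borel_measurable M" "V j \<in> borel_measurable M" using Suc by auto
    have "hat (inv\<^bsub>Gt\<^esub> (s j)) (V j) \<in> borel_measurable M" by (intro hat_meas) simp_all
    then have Fm: "F j \<in> borel_measurable M" unfolding Fx[abs_def] by simp
    then have "hat (s j) (F j) \<in> borel_measurable M" by (intro hat_meas) simp_all
    then show ?case using Fm unfolding US[abs_def] VS[abs_def] by simp
  qed
  have Um [measurable]: "U j \<in> borel_measurable M" and Vm [measurable]: "V j \<in> borel_measurable M" for j
    using meas by auto
  have Fm [measurable]: "F j \<in> borel_measurable M" for j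
    unfolding Fx[abs_def] by (intro borel_measurable_max borel_measurable_min hat_meas) simp_all
  have U: "0 \<le> U j x \<and> U j x \<le> c" for j x
  proof (induction j)
    case 0
    then show ?case using u(2) by (simp add: U0)
  next
    case (Suc j)
    then show ?case unfolding US Fx by (auto simp: max_def min_def)
  qed
  have F: "0 \<le> F j x" "F j x \<le> U j x" "F j x \<le> c" for j x
    using U[of j x] unfolding Fx by (auto simp: max_def min_def)
  have iU: "integrable M (U j)" for j by (rule integrable_bounded[of _ c]) (use U in auto)
  have iF: "integrable M (F j)" for j by (rule integrable_bounded[of _ c]) (use F in auto)
  have iH: "integrable M (hat (s j) (F j))" for j by (rule integrable_hat[OF sG iF])
  have iV: "integrable M (V j)" for j
    by (induction j) (use iH in \<open>simp_all add: V0 VS[abs_def]\<close>)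
  have eqI: "(\<integral>x. U j x \<partial>M) = (\<integral>x. V j x \<partial>M)" for j
  proof (induction j)
    case 0
    then show ?case by (simp add: U0 V0 prob_space)
  next
    case (Suc j)
    then show ?case using iU iV iF iH integral_hat[OF sG iF] by (simp add: US VS)
  qed
  have hF: "0 \<le> hat (s j) (F j) x" for j x unfolding hat_op_def using F by simp
  have decU: "decseq (\<lambda>j. U j x)" for x by (rule decseq_SucI) (simp add: US F)
  have decV: "decseq (\<lambda>j. V j x)" for x by (rule decseq_SucI) (simp add: VS hF)
  \<comment> \<open>The amount moved is at most the room carried to the source. Carrying it back
    cancels the two weights, so no more than \<open>V j\<close> is removed.\<close>
  have Vpos: "AE x in M. 0 \<le> V j x" for j
  proof (induction j)
    case 0
    have "0 \<le> (\<integral>y. u y \<partial>M)" using u(2) by simp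
    then show ?case by (simp add: V0)
  next
    case (Suc j)
    show ?case using Suc AE_nice
    proof eventually_elim
      case (elim x)
      have "F j (a (s j) x) \<le> max 0 (hat (inv\<^bsub>Gt\<^esub> (s j)) (V j) (a (s j) x))" unfolding Fx by simp
      also have "hat (inv\<^bsub>Gt\<^esub> (s j)) (V j) (a (s j) x) = V j x * om (inv\<^bsub>Gt\<^esub> (s j)) (a (s j) x)"
        unfolding hat_op_def using a_inv(1)[OF sG nice_space[OF elim(2)]] by simp
      also have "max 0 \<dots> = \<dots>" using elim by simp
      finally have "hat (s j) (F j) x \<le> (V j x * om (inv\<^bsub>Gt\<^esub> (s j)) (a (s j) x)) * om (s j) x"
        unfolding hat_op_def by (intro mult_right_mono) simp_all
      also have "\<dots> = V j x" using nice_inv(1)[OF elim(2) sG] by (simp add: mult.assoc)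
      finally show ?case by (simp add: VS)
    qed
  qed
  define good where "good x \<longleftrightarrow> nice x \<and> (\<forall>j. 0 \<le> V j x) \<and> (\<forall>g\<in>G. \<forall>j. 0 \<le> V j (a g x))" for x
  have AE_V: "AE x in M. \<forall>j. 0 \<le> V j x" using Vpos by (simp add: AE_all_countable)
  have AE_good: "AE x in M. good x"
  proof -
    have "AE x in M. \<forall>g\<in>G. \<forall>j. 0 \<le> V j (a g x)"
      using AE_act[OF _ AE_V] by (simp add: AE_ball_countable countable_G)
    then show ?thesis using AE_nice AE_V unfolding good_def by eventually_elim simp
  qed
  define Ui where "Ui x = lim (\<lambda>j. U j x)" for x
  define Vi where "Vi x = lim (\<lambda>j. V j x)" for x
  have [measurable]: "Ui \<in> borel_measurable M" "Vi \<in> borel_measurable M"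
    unfolding Ui_def Vi_def by measurable
  have limU: "(\<lambda>j. U j x) \<longlonglongrightarrow> Ui x" for x
  proof -
    have "convergent (\<lambda>j. U j x)"
      using decseq_convergent[OF decU[of x], of 0] U by (metis convergentI)
    then show ?thesis unfolding Ui_def convergent_LIMSEQ_iff .
  qed
  have limV: "(\<lambda>j. V j x) \<longlonglongrightarrow> Vi x" if "\<forall>j. 0 \<le> V j x" for x
  proof -
    have "convergent (\<lambda>j. V j x)"
      using decseq_convergent[OF decV[of x], of 0] that by (metis convergentI)
    then show ?thesis unfolding Vi_def convergent_LIMSEQ_iff .
  qed
  have Ui: "0 \<le> Ui x" "Ui x \<le> U j x" for x j
    using LIMSEQ_le_const[OF limU] U decseq_ge[OF decU limU] by blast+
  have Vi: "0 \<le> Vi x" "Vi x \<le> V j x" if "\<forall>j. 0 \<le> V j x" for x j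
    using LIMSEQ_le_const[OF limV[OF that], of 0] that decseq_ge[OF decV limV[OF that]] by blast+
  \<comment> \<open>If mass stays at \<open>x\<close> forever, the minimum in step \<open>j\<close>
    was not attained by \<open>U j x\<close>, so the room at the other end was filled completely.
    Since \<open>s\<close> reaches every group element, no room is left anywhere on the
    orbit.\<close>
  have key: "Vi (a (inv\<^bsub>Gt\<^esub> g) x) = 0" if x: "good x" "0 < Ui x" and g: "g \<in> G" for x g
  proof -
    obtain j where j: "s j = g" using s_surj[OF g] by blast
    have nx: "nice x" and Vx: "\<forall>j. 0 \<le> V j (a (inv\<^bsub>Gt\<^esub> g) x)" using x g unfolding good_def by auto
    have "F j x < U j x" using Ui(2)[of x "Suc j"] x(2) unfolding US by simp
    moreover have h: "hat (inv\<^bsub>Gt\<^esub> g) (V j) x = V j (a (inv\<^bsub>Gt\<^esub> g) x) * om (inv\<^bsub>Gt\<^esub> g) x" unfolding hat_op_def ..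
    moreover have "0 \<le> V j (a (inv\<^bsub>Gt\<^esub> g) x) * om (inv\<^bsub>Gt\<^esub> g) x" using Vx by simp
    ultimately have Fj: "F j x = V j (a (inv\<^bsub>Gt\<^esub> g) x) * om (inv\<^bsub>Gt\<^esub> g) x"
      unfolding Fx j by (auto simp: max_def min_def split: if_splits)
    have "hat g (F j) (a (inv\<^bsub>Gt\<^esub> g) x) = F j x * om g (a (inv\<^bsub>Gt\<^esub> g) x)"
      unfolding hat_op_def using a_inv(2)[OF g nice_space[OF nx]] by simp
    also have "\<dots> = V j (a (inv\<^bsub>Gt\<^esub> g) x)"
      using nice_inv(2)[OF nx g] unfolding Fj by (simp add: algebra_simps)
    finally have "V (Suc j) (a (inv\<^bsub>Gt\<^esub> g) x) = 0" unfolding VS j by simp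
    then show ?thesis using Vi(2)[OF Vx, of "Suc j"] Vi(1)[OF Vx] by simp
  qed
  have cU: "(\<lambda>j. \<integral>x. U j x \<partial>M) \<longlonglongrightarrow> (\<integral>x. Ui x \<partial>M)"
  proof (rule integral_dominated_convergence[where w = "\<lambda>_. c"])
    show "AE x in M. (\<lambda>j. U j x) \<longlonglongrightarrow> Ui x" by (rule AE_I2) (rule limU)
    show "AE x in M. norm (U j x) \<le> c" for j by (rule AE_I2) (use U in auto)
  qed auto
  have cV: "(\<lambda>j. \<integral>x. V j x \<partial>M) \<longlonglongrightarrow> (\<integral>x. Vi x \<partial>M)"
  proof (rule integral_dominated_convergence[where w = "V 0"])
    show "AE x in M. (\<lambda>j. V j x) \<longlonglongrightarrow> Vi x" using AE_V by eventually_elim (rule limV)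
    fix j show "AE x in M. norm (V j x) \<le> V 0 x"
      using AE_V by eventually_elim (use decseqD[OF decV, of 0 j] in auto)
  qed (use iV in auto)
  \<comment> \<open>The orbits with room left in the limit. If they form a null set, the remaining
    room vanishes; if they have full measure, \<open>key\<close> shows that the remaining mass
    vanishes. The two have equal integrals, so both vanish.\<close>
  define O1 where "O1 = {x\<in>space M. \<exists>g\<in>G. 0 < Vi (a g x)}"
  have O1: "O1 = {x\<in>space M. \<exists>g\<in>G. a g x \<in> {x\<in>space M. 0 < Vi x}}"
    unfolding O1_def using a_space by auto
  have Vpm: "{x\<in>space M. 0 < Vi x} \<in> sets M" by simp
  have O1m: "O1 \<in> sets M" unfolding O1 by (rule orbit_sets[OF Vpm])
  have "prob O1 = 0 \<or> prob O1 = 1" unfolding O1 by (rule ergodic_orbit[OF erg Vpm])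
  then have "(\<integral>x. Ui x \<partial>M) = 0 \<or> (\<integral>x. Vi x \<partial>M) = 0"
  proof
    assume "prob O1 = 0"
    then have "AE x in M. x \<notin> O1" using O1m by (intro AE_not_in) (simp add: null_setsI emeasure_eq_measure)
    then have "AE x in M. Vi x = 0" using AE_good
    proof eventually_elim
      case (elim x)
      then have "\<not> 0 < Vi x" using a_one[of x] unfolding O1_def good_def nice_def by force
      then show ?case using Vi(1)[of x] elim unfolding good_def by simp
    qed
    then have "(\<integral>x. Vi x \<partial>M) = (\<integral>x. 0 \<partial>M)" by (intro integral_cong_AE) auto
    then show ?thesis by simp
  next
    assume "prob O1 = 1"
    then have "AE x in M. x \<in> O1" using O1m by (simp add: prob_eq_1)
    then have "AE x in M. Ui x = 0" using AE_good
    proof eventually_elim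
      case (elim x)
      then obtain g where g: "g \<in> G" "0 < Vi (a g x)" unfolding O1_def by blast
      have "\<not> 0 < Ui x" using key[OF elim(2) _ G_closed(3)[OF g(1)]] g by auto
      then show ?case using Ui(1)[of x] by simp
    qed
    then have "(\<integral>x. Ui x \<partial>M) = (\<integral>x. 0 \<partial>M)" by (intro integral_cong_AE) auto
    then show ?thesis by simp
  qed
  moreover have "(\<integral>x. Ui x \<partial>M) = (\<integral>x. Vi x \<partial>M)"
    using cU cV unfolding eqI by (rule LIMSEQ_unique)
  ultimately have "(\<lambda>j. \<integral>x. U j x \<partial>M) \<longlonglongrightarrow> 0" using cU by simp
  then have "eventually (\<lambda>j. (\<integral>x. U j x \<partial>M) < \<delta> / 2) sequentially"
    by (rule order_tendstoD) (use \<open>0 < \<delta>\<close> in simp)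
  then obtain n where n: "(\<integral>x. U n x \<partial>M) < \<delta> / 2" unfolding eventually_sequentially by blast
  have tele: "U n x - V n x = u x - (\<integral>y. u y \<partial>M) - (\<Sum>j<n. F j x - hat (s j) (F j) x)" for x n
    by (induction n) (simp_all add: U0 V0 US VS)
  \<comment> \<open>The remaining mass and the remaining room have the same integral, below
    \<open>\<delta> / 2\<close>.\<close>
  have "(\<integral>x. \<bar>U n x - V n x\<bar> \<partial>M) \<le> (\<integral>x. U n x + V n x \<partial>M)"
  proof (rule integral_mono_AE)
    show "AE x in M. \<bar>U n x - V n x\<bar> \<le> U n x + V n x"
      using Vpos[of n] by eventually_elim (use U in \<open>simp add: abs_le_iff\<close>)
  qed (use iU iV in auto)
  also have "\<dots> < \<delta>" using n eqI[of n] iU iV by simp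
  finally have fin: "(\<integral>x. \<bar>u x - (\<integral>y. u y \<partial>M) - (\<Sum>j<n. F j x - hat (s j) (F j) x)\<bar> \<partial>M) < \<delta>"
    unfolding tele .
  have "\<forall>j<n. F j \<in> borel_measurable M \<and> (\<forall>x. \<bar>F j x\<bar> \<le> c) \<and> s j \<in> G"
    using F by simp
  with fin show ?thesis by blast
qed

end

section \<open>Averages over balls\<close>

locale ball_system = nonsingular_system M Gt G a
  for M :: "'x measure" and Gt :: "('g, 'b) monoid_scheme" (structure)
    and G :: "'g set" and a :: "'g \<Rightarrow> 'x \<Rightarrow> 'x" +
  fixes d :: "'g \<Rightarrow> 'g \<Rightarrow> real"
  assumes metric_d: "metric_on_set (carrier Gt) d"
    and rinv: "right_invariant Gt d"
    and finite_balls: "\<And>k. finite (int_ball G d \<one>\<^bsub>Gt\<^esub> k)"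
begin

abbreviation "Bl k \<equiv> int_ball G d \<one>\<^bsub>Gt\<^esub> k"
abbreviation "BB k \<equiv> {p \<otimes>\<^bsub>Gt\<^esub> q | p q. p \<in> Bl k \<and> q \<in> Bl k}"

section \<open>Balls of a right-invariant metric and sums along orbits\<close>

lemma G_carrier: "G \<subseteq> carrier Gt"
  by auto

lemma metric_G: "metric_on_set G d"
  by (rule metric_on_set_mono[OF metric_d G_carrier])

lemma d_sym: "x \<in> G \<Longrightarrow> y \<in> G \<Longrightarrow> d x y = d y x"
  by (rule metric_on_set_sym[OF metric_G])

lemma d_shift: "x \<in> G \<Longrightarrow> y \<in> G \<Longrightarrow> z \<in> G \<Longrightarrow> d (x \<otimes>\<^bsub>Gt\<^esub> z) (y \<otimes>\<^bsub>Gt\<^esub> z) = d x y"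
  using rinv unfolding right_invariant_def by simp

lemma Bl_G: "Bl k \<subseteq> G"
  unfolding int_ball_def by auto

lemma one_Bl: "\<one>\<^bsub>Gt\<^esub> \<in> Bl k"
  unfolding int_ball_def using metric_on_set_refl[OF metric_G, of "\<one>\<^bsub>Gt\<^esub>"] by simp

lemma card_Bl: "0 < card (Bl k)"
  using one_Bl finite_balls by (auto simp: card_gt_0_iff)

lemma Bl_mono: "k \<le> l \<Longrightarrow> Bl k \<subseteq> Bl l"
  unfolding int_ball_def by force

lemma BB_G: "BB k \<subseteq> G"
  using Bl_G by blast

lemma finite_BB: "finite (BB k)"
proof -
  have "BB k = (\<lambda>(p, q). p \<otimes>\<^bsub>Gt\<^esub> q) ` (Bl k \<times> Bl k)" by auto
  then show ?thesis using finite_balls by simp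
qed

text \<open>Right invariance makes right translates of \<open>Bl k\<close> metric balls, which is
  what lets covering properties act on orbit sums.\<close>

lemma ball_translate:
  assumes c: "c \<in> G"
  shows "bij_betw (\<lambda>h. h \<otimes>\<^bsub>Gt\<^esub> c) (Bl k) (cball_in G d c (real k))"
proof (rule bij_betw_byWitness[where f' = "\<lambda>y. y \<otimes>\<^bsub>Gt\<^esub> inv\<^bsub>Gt\<^esub> c"])
  have dc: "d c (h \<otimes>\<^bsub>Gt\<^esub> c) = d h \<one>\<^bsub>Gt\<^esub>" if "h \<in> G" for h
    using d_shift[of "\<one>\<^bsub>Gt\<^esub>" h c] d_sym[of h "\<one>\<^bsub>Gt\<^esub>"] c that by simp
  have inv1: "h \<otimes>\<^bsub>Gt\<^esub> c \<otimes>\<^bsub>Gt\<^esub> inv\<^bsub>Gt\<^esub> c = h" "h \<otimes>\<^bsub>Gt\<^esub> inv\<^bsub>Gt\<^esub> c \<otimes>\<^bsub>Gt\<^esub> c = h" if "h \<in> G" for h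
    using c that by (simp_all add: Gt.m_assoc)
  show "\<forall>h\<in>Bl k. h \<otimes>\<^bsub>Gt\<^esub> c \<otimes>\<^bsub>Gt\<^esub> inv\<^bsub>Gt\<^esub> c = h" using inv1 Bl_G by blast
  show "\<forall>y\<in>cball_in G d c (real k). y \<otimes>\<^bsub>Gt\<^esub> inv\<^bsub>Gt\<^esub> c \<otimes>\<^bsub>Gt\<^esub> c = y"
    unfolding cball_in_def using inv1(2) by simp
  show "(\<lambda>h. h \<otimes>\<^bsub>Gt\<^esub> c) ` Bl k \<subseteq> cball_in G d c (real k)"
  proof (rule image_subsetI)
    fix h assume "h \<in> Bl k"
    then have "h \<in> G" "d h \<one>\<^bsub>Gt\<^esub> \<le> k" unfolding int_ball_def by auto
    then show "h \<otimes>\<^bsub>Gt\<^esub> c \<in> cball_in G d c (real k)" using dc[of h] c unfolding cball_in_def by simp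
  qed
  show "(\<lambda>y. y \<otimes>\<^bsub>Gt\<^esub> inv\<^bsub>Gt\<^esub> c) ` cball_in G d c (real k) \<subseteq> Bl k"
  proof (rule image_subsetI)
    fix y assume "y \<in> cball_in G d c (real k)"
    then have y: "y \<in> G" "d c y \<le> k" unfolding cball_in_def by auto
    then have "y \<otimes>\<^bsub>Gt\<^esub> inv\<^bsub>Gt\<^esub> c \<in> G" using c by simp
    then show "y \<otimes>\<^bsub>Gt\<^esub> inv\<^bsub>Gt\<^esub> c \<in> Bl k"
      unfolding int_ball_def using dc[of "y \<otimes>\<^bsub>Gt\<^esub> inv\<^bsub>Gt\<^esub> c"] inv1(2)[OF y(1)] y(2) by simp
  qed
qed

lemma finite_cball: "c \<in> G \<Longrightarrow> finite (cball_in G d c r)"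
proof -
  assume c: "c \<in> G"
  have "finite (cball_in G d c (real (nat \<lceil>r\<rceil>)))"
    using bij_betw_finite[OF ball_translate[OF c]] finite_balls by blast
  moreover have "cball_in G d c r \<subseteq> cball_in G d c (real (nat \<lceil>r\<rceil>))"
    unfolding cball_in_def using real_nat_ceiling_ge[of r] by (auto intro: order_trans)
  ultimately show ?thesis by (rule finite_subset[rotated])
qed

lemma orbit_sum:
  assumes x: "nice x" and c: "c \<in> G"
  shows "(\<Sum>h\<in>Bl k. hat h F (a c x)) * om c x = (\<Sum>y\<in>cball_in G d c (real k). hat y F x)"
proof -
  have "(\<Sum>h\<in>Bl k. hat h F (a c x)) * om c x = (\<Sum>h\<in>Bl k. hat (h \<otimes>\<^bsub>Gt\<^esub> c) F x)"
    unfolding sum_distrib_right using hat_orbit[OF x _ c] Bl_G by (intro sum.cong) auto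
  also have "\<dots> = (\<Sum>y\<in>cball_in G d c (real k). hat y F x)"
    by (rule sum.reindex_bij_betw[OF ball_translate[OF c]])
  finally show ?thesis .
qed

lemma orbit_sum_om:
  assumes x: "nice x" and c: "c \<in> G"
  shows "(\<Sum>h\<in>Bl k. om h (a c x)) * om c x = (\<Sum>y\<in>cball_in G d c (real k). om y x)"
  using orbit_sum[OF assms, where k = k and F = "\<lambda>_. 1"] unfolding hat_one .

text \<open>Write \<open>z\<close> as the product of \<open>z\<close> times the inverse of
  \<open>y\<close> with \<open>y\<close>; by right invariance the first factor has length
  \<open>d y z\<close>. Multiplicative doubling thus controls neighbourhoods of balls.\<close>

lemma nbhd_Bl:
  assumes "u \<le> real n"
  shows "nbhd G d u (Bl n) \<subseteq> BB n"
proof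
  fix z assume "z \<in> nbhd G d u (Bl n)"
  then obtain y where z: "z \<in> G" "y \<in> Bl n" "d y z \<le> u" unfolding nbhd_def by blast
  have y: "y \<in> G" using z(2) Bl_G by blast
  have g: "z \<otimes>\<^bsub>Gt\<^esub> inv\<^bsub>Gt\<^esub> y \<in> G" using z y by simp
  have e: "z \<otimes>\<^bsub>Gt\<^esub> inv\<^bsub>Gt\<^esub> y \<otimes>\<^bsub>Gt\<^esub> y = z" using z y by (simp add: Gt.m_assoc)
  have "d (z \<otimes>\<^bsub>Gt\<^esub> inv\<^bsub>Gt\<^esub> y) \<one>\<^bsub>Gt\<^esub> = d y z"
    using d_shift[OF g G_closed(1) y] d_sym[OF y z(1)] y unfolding e by simp
  then have "z \<otimes>\<^bsub>Gt\<^esub> inv\<^bsub>Gt\<^esub> y \<in> Bl n" using g z(3) assms unfolding int_ball_def by simp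
  then show "z \<in> BB n" using e[symmetric] z(2) by blast
qed

lemma cball_BB:
  assumes "c \<in> Bl n" "r \<le> real n"
  shows "cball_in G d c r \<subseteq> BB n"
  using nbhd_Bl[OF assms(2)] assms(1) unfolding nbhd_def cball_in_def by blast

lemma Bl_BB: "Bl n \<subseteq> BB n"
  using one_Bl[of n] Bl_G[of n] Gt.l_one G_carrier by (smt (verit) mem_Collect_eq subset_iff)

lemma doubling_constant:
  assumes "mult_doubling Gt G d"
  obtains D K where "1 \<le> D" "\<And>k. K \<le> k \<Longrightarrow> real (card (BB k)) \<le> D * real (card (Bl k))"
proof -
  obtain D :: real and K :: nat where DK: "\<forall>k\<ge>K. real (card (BB k)) \<le> D * real (card (Bl k))"
    using assms unfolding mult_doubling_def by (elim exE) (rule that)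
  have "real (card (BB k)) \<le> max 1 D * real (card (Bl k))" if "K \<le> k" for k
  proof -
    have "real (card (BB k)) \<le> D * real (card (Bl k))" using DK that by blast
    also have "\<dots> \<le> max 1 D * real (card (Bl k))" by (intro mult_right_mono) auto
    finally show ?thesis .
  qed
  then show ?thesis using that[of "max 1 D" K] by simp
qed

text \<open>The maximal inequality by transference: the covering property is applied on almost every orbit.\<close>
lemma maximal_inequality:
  assumes bcp: "besicovitch G d" and dbl: "mult_doubling Gt G d"
  obtains C where "0 < C" "\<And>f l. integrable M f \<Longrightarrow> 0 < l \<Longrightarrow>
     prob {x\<in>space M. \<exists>k\<ge>1. l * (\<Sum>g\<in>Bl k. om g x) < (\<Sum>g\<in>Bl k. hat g (\<lambda>x. \<bar>f x\<bar>) x)} \<le> C / l * (\<integral>x. \<bar>f x\<bar> \<partial>M)"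
proof -
  obtain D K0 where D: "1 \<le> D" and dblD: "\<And>k. K0 \<le> k \<Longrightarrow> real (card (BB k)) \<le> D * real (card (Bl k))"
    by (rule doubling_constant[OF dbl]) blast
  obtain C0 :: real where C0: "\<forall>E r. finite E \<and> E \<subseteq> G \<and> (\<forall>x\<in>E. r x > (0::real)) \<longrightarrow>
      (\<exists>F\<subseteq>E. \<forall>y\<in>G. (indicator E y :: real) \<le> (\<Sum>x\<in>F. indicator (cball_in G d x (r x)) y)
                   \<and> (\<Sum>x\<in>F. indicator (cball_in G d x (r x)) y) \<le> C0)"
    using bcp unfolding besicovitch_def by (rule exE)
  define C where "C = max 1 C0"
  have C: "1 \<le> C" "C0 \<le> C" unfolding C_def by auto
  have main: "prob {x\<in>space M. \<exists>k\<ge>1. l * (\<Sum>g\<in>Bl k. om g x) < (\<Sum>g\<in>Bl k. hat g (\<lambda>x. \<bar>f x\<bar>) x)}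
       \<le> (C * D) / l * (\<integral>x. \<bar>f x\<bar> \<partial>M)" if f: "integrable M f" and l: "0 < l" for f l
  proof -
    define h where "h x = \<bar>f x\<bar>" for x
    have h: "integrable M h" "\<And>x. 0 \<le> h x" using f unfolding h_def[abs_def] by auto
    have [measurable]: "h \<in> borel_measurable M" using h(1) by simp
    define big where "big k x \<longleftrightarrow> l * (\<Sum>g\<in>Bl k. om g x) < (\<Sum>g\<in>Bl k. hat g h x)" for k x
    \<comment> \<open>Bounding the scale by \<open>K\<close> bounds the radii, so balls centred in
      \<open>Bl n\<close> stay in \<open>BB n\<close> once \<open>n \<ge> K\<close>. The bound is
      removed by letting \<open>K\<close> grow.\<close>
    define E where "E K = {x\<in>space M. \<exists>k\<in>{1..K}. big k x}" for K
    have Em [measurable]: "E K \<in> sets M" for K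
    proof -
      have hm: "hat g h \<in> borel_measurable M" if "g \<in> Bl k" for g k using that Bl_G by (intro hat_meas) auto
      have "E K = (\<Union>k\<in>{1..K}. {x\<in>space M. big k x})" unfolding E_def by auto
      also have "\<dots> \<in> sets M" unfolding big_def
        by (intro sets.finite_UN borel_measurable_less borel_measurable_times borel_measurable_const borel_measurable_sum hm om_meas) auto
      finally show ?thesis .
    qed
    have EK: "prob (E K) \<le> (C * D) / l * (\<integral>x. h x \<partial>M)" for K
    proof -
      define n where "n = max K0 K"
      have iE: "integrable M (indicator (E K) :: _ \<Rightarrow> real)"
        by (rule integrable_bounded[of _ 1]) (auto simp: indicator_def)
      \<comment> \<open>The centres are the elements of \<open>Bl n\<close> sending \<open>x\<close>
        into \<open>E K\<close>, with a scale witnessing \<open>big\<close> as radius. Their mass is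
        at most that of the selected balls, each of which carries at least \<open>l\<close> times as
        much \<open>h\<close>-mass as weight; the multiplicity bound prevents overcounting.\<close>
      have pt: "(\<Sum>g\<in>Bl n. hat g (indicator (E K)) x) \<le> C / l * (\<Sum>y\<in>BB n. hat y h x)" if x: "nice x" for x
      proof -
        define Ex where "Ex = {g\<in>Bl n. a g x \<in> E K}"
        define kk where "kk g = (SOME k. k \<in> {1..K} \<and> big k (a g x))" for g
        have kk: "kk g \<in> {1..K} \<and> big (kk g) (a g x)" if "g \<in> Ex" for g
          unfolding kk_def by (rule someI_ex) (use that in \<open>auto simp: Ex_def E_def\<close>)
        have Ex: "finite Ex" "Ex \<subseteq> G" "Ex \<subseteq> Bl n" unfolding Ex_def using finite_balls Bl_G by auto
        have "finite Ex \<and> Ex \<subseteq> G \<and> (\<forall>g\<in>Ex. 0 < real (kk g))" using Ex kk by fastforce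
        from C0[THEN spec, THEN spec, THEN mp, OF this]
        obtain F where F: "F \<subseteq> Ex" and cov: "\<And>y. y \<in> G \<Longrightarrow> (indicator Ex y :: real) \<le> (\<Sum>c\<in>F. indicator (cball_in G d c (kk c)) y)"
          and mul: "\<And>y. y \<in> G \<Longrightarrow> (\<Sum>c\<in>F. indicator (cball_in G d c (kk c)) y) \<le> C0" by blast
        have cb: "cball_in G d c (kk c) \<subseteq> BB n" "finite (cball_in G d c (kk c))" if "c \<in> F" for c
        proof -
          have "c \<in> Ex" using that F by blast
          then have c: "c \<in> Bl n" "c \<in> G" "real (kk c) \<le> n" using Ex kk[of c] unfolding n_def by auto
          show "cball_in G d c (kk c) \<subseteq> BB n" by (rule cball_BB[OF c(1,3)])
          show "finite (cball_in G d c (kk c))" by (rule finite_cball[OF c(2)])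
        qed
        have swap: "(\<Sum>y\<in>BB n. v y * (\<Sum>c\<in>F. indicator (cball_in G d c (kk c)) y)) = (\<Sum>c\<in>F. \<Sum>y\<in>cball_in G d c (kk c). v y)"
          for v :: "'g \<Rightarrow> real"
        proof -
          have "(\<Sum>y\<in>BB n. v y * (\<Sum>c\<in>F. indicator (cball_in G d c (kk c)) y))
              = (\<Sum>c\<in>F. \<Sum>y\<in>BB n. v y * indicator (cball_in G d c (kk c)) y)"
            unfolding sum_distrib_left by (rule sum.swap)
          also have "\<dots> = (\<Sum>c\<in>F. \<Sum>y\<in>cball_in G d c (kk c). v y)"
          proof (rule sum.cong[OF refl])
            fix c assume "c \<in> F"
            then have "BB n \<inter> cball_in G d c (kk c) = cball_in G d c (kk c)" using cb(1) by blast
            moreover have "(\<Sum>y\<in>BB n. v y * indicator (cball_in G d c (kk c)) y)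
                = (\<Sum>y\<in>BB n. if y \<in> cball_in G d c (kk c) then v y else 0)"
              by (intro sum.cong) (auto simp: indicator_def)
            ultimately show "(\<Sum>y\<in>BB n. v y * indicator (cball_in G d c (kk c)) y) = (\<Sum>y\<in>cball_in G d c (kk c). v y)"
              using sum.inter_restrict[OF finite_BB, of v n "cball_in G d c (kk c)"] by simp
          qed
          finally show ?thesis .
        qed
        have "(\<Sum>g\<in>Bl n. hat g (indicator (E K)) x) = (\<Sum>g\<in>Bl n. om g x * indicator Ex g)"
          unfolding hat_op_def Ex_def by (intro sum.cong) (auto simp: indicator_def)
        also have "\<dots> \<le> (\<Sum>g\<in>BB n. om g x * indicator Ex g)"
          using Bl_BB finite_BB by (intro sum_mono2) auto
        also have "\<dots> \<le> (\<Sum>g\<in>BB n. om g x * (\<Sum>c\<in>F. indicator (cball_in G d c (kk c)) g))"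
        proof (intro sum_mono mult_left_mono)
          fix g assume "g \<in> BB n"
          then have "g \<in> G" using BB_G by blast
          then show "indicator Ex g \<le> (\<Sum>c\<in>F. indicator (cball_in G d c (kk c)) g :: real)" by (rule cov)
        qed simp
        also have "\<dots> = (\<Sum>c\<in>F. \<Sum>y\<in>cball_in G d c (kk c). om y x)" by (rule swap)
        also have "\<dots> \<le> (\<Sum>c\<in>F. (\<Sum>y\<in>cball_in G d c (kk c). hat y h x) / l)"
        proof (rule sum_mono)
          fix c assume c: "c \<in> F"
          then have cG: "c \<in> G" "big (kk c) (a c x)" using F Ex kk by blast+
          then have "(l * (\<Sum>g\<in>Bl (kk c). om g (a c x))) * om c x \<le> (\<Sum>g\<in>Bl (kk c). hat g h (a c x)) * om c x"
            unfolding big_def by (intro mult_right_mono) auto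
          then have "l * (\<Sum>y\<in>cball_in G d c (kk c). om y x) \<le> (\<Sum>y\<in>cball_in G d c (kk c). hat y h x)"
            unfolding orbit_sum[OF x cG(1), symmetric] orbit_sum_om[OF x cG(1), symmetric] by (simp add: mult.assoc)
          then show "(\<Sum>y\<in>cball_in G d c (kk c). om y x) \<le> (\<Sum>y\<in>cball_in G d c (kk c). hat y h x) / l"
            using l by (simp add: field_simps)
        qed
        also have "\<dots> = (\<Sum>y\<in>BB n. hat y h x * (\<Sum>c\<in>F. indicator (cball_in G d c (kk c)) y)) / l"
          unfolding swap sum_divide_distrib ..
        also have "\<dots> \<le> (\<Sum>y\<in>BB n. hat y h x * C) / l"
        proof (intro divide_right_mono sum_mono mult_left_mono)
          fix y assume "y \<in> BB n"
          then have "y \<in> G" using BB_G by blast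
          then show "(\<Sum>c\<in>F. indicator (cball_in G d c (kk c)) y) \<le> C" using mul[of y] C by linarith
          show "0 \<le> hat y h x" unfolding hat_op_def using h by simp
        qed (use l in simp)
        also have "\<dots> = C / l * (\<Sum>y\<in>BB n. hat y h x)" by (simp add: sum_distrib_right[symmetric])
        finally show ?thesis .
      qed
      \<comment> \<open>Integration replaces the orbit sums by cardinalities; doubling compares
        \<open>BB n\<close> with \<open>Bl n\<close>, which then cancels.\<close>
      have "card (Bl n) * prob (E K) = (\<integral>x. (\<Sum>g\<in>Bl n. hat g (indicator (E K)) x) \<partial>M)"
        using integral_hat_sum[OF Bl_G iE] by simp
      also have "\<dots> \<le> (\<integral>x. C / l * (\<Sum>y\<in>BB n. hat y h x) \<partial>M)"
      proof (rule integral_mono_AE)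
        show "AE x in M. (\<Sum>g\<in>Bl n. hat g (indicator (E K)) x) \<le> C / l * (\<Sum>y\<in>BB n. hat y h x)"
          using AE_nice by eventually_elim (rule pt)
        show "integrable M (\<lambda>x. \<Sum>g\<in>Bl n. hat g (indicator (E K)) x)" by (rule integrable_hat_sum[OF Bl_G iE])
        show "integrable M (\<lambda>x. C / l * (\<Sum>y\<in>BB n. hat y h x))"
          by (intro integrable_mult_right integrable_hat_sum[OF BB_G h(1)])
      qed
      also have "\<dots> = C / l * (card (BB n) * (\<integral>x. h x \<partial>M))"
        using integral_hat_sum[OF BB_G h(1)] by simp
      also have "\<dots> \<le> C / l * ((D * card (Bl n)) * (\<integral>x. h x \<partial>M))"
        using dblD[of n] C l h(2) unfolding n_def by (intro mult_left_mono mult_right_mono) auto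
      also have "\<dots> = card (Bl n) * ((C * D) / l * (\<integral>x. h x \<partial>M))" by simp
      finally show ?thesis using card_Bl[of n] by (simp only: mult_le_cancel_left_pos of_nat_0_less_iff)
    qed
    have "(\<lambda>K. prob (E K)) \<longlonglongrightarrow> prob (\<Union>K. E K)"
    proof (rule finite_Lim_measure_incseq)
      show "range E \<subseteq> sets M" using Em by blast
      show "incseq E" unfolding E_def incseq_def by fastforce
    qed
    then have "prob (\<Union>K. E K) \<le> (C * D) / l * (\<integral>x. h x \<partial>M)"
      by (rule LIMSEQ_le_const2) (use EK in blast)
    moreover have "(\<Union>K. E K) = {x\<in>space M. \<exists>k\<ge>1. big k x}"
    proof -
      have "x \<in> E k" if "x \<in> space M" "1 \<le> k" "big k x" for x k using that unfolding E_def by auto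
      then show ?thesis unfolding E_def by fastforce
    qed
    ultimately show ?thesis unfolding big_def h_def by simp
  qed
  show ?thesis by (rule that[of "C * D"]) (use C D main in auto)
qed


text \<open>This is the symmetric difference of \<open>Bl k\<close> and its left translate by
  \<open>s\<close>. The form used pairs each element with a partner on the other side of the
  boundary of \<open>Bl k\<close>.\<close>

definition bdry_shift :: "'g \<Rightarrow> nat \<Rightarrow> 'g set" where
  "bdry_shift s k = {g\<in>G. (g \<in> Bl k) \<noteq> (inv\<^bsub>Gt\<^esub> s \<otimes>\<^bsub>Gt\<^esub> g \<in> Bl k)}"

lemma bdry_shift_eq:
  assumes s: "s \<in> G"
  shows "bdry_shift s k = (Bl k - (\<lambda>g. s \<otimes>\<^bsub>Gt\<^esub> g) ` Bl k) \<union> ((\<lambda>g. s \<otimes>\<^bsub>Gt\<^esub> g) ` Bl k - Bl k)"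
proof -
  have "inv\<^bsub>Gt\<^esub> s \<otimes>\<^bsub>Gt\<^esub> g \<in> Bl k \<longleftrightarrow> g \<in> (\<lambda>g. s \<otimes>\<^bsub>Gt\<^esub> g) ` Bl k" if g: "g \<in> G" for g
  proof
    assume "inv\<^bsub>Gt\<^esub> s \<otimes>\<^bsub>Gt\<^esub> g \<in> Bl k"
    moreover have "g = s \<otimes>\<^bsub>Gt\<^esub> (inv\<^bsub>Gt\<^esub> s \<otimes>\<^bsub>Gt\<^esub> g)" using s g by (simp add: Gt.m_assoc[symmetric])
    ultimately show "g \<in> (\<lambda>g. s \<otimes>\<^bsub>Gt\<^esub> g) ` Bl k" by blast
  next
    assume "g \<in> (\<lambda>g. s \<otimes>\<^bsub>Gt\<^esub> g) ` Bl k"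
    then obtain h where h: "h \<in> Bl k" "g = s \<otimes>\<^bsub>Gt\<^esub> h" by blast
    moreover have "h \<in> G" using h Bl_G by blast
    then have "inv\<^bsub>Gt\<^esub> s \<otimes>\<^bsub>Gt\<^esub> (s \<otimes>\<^bsub>Gt\<^esub> h) = h" using s by (simp add: Gt.m_assoc[symmetric])
    ultimately show "inv\<^bsub>Gt\<^esub> s \<otimes>\<^bsub>Gt\<^esub> g \<in> Bl k" by simp
  qed
  moreover have "(\<lambda>g. s \<otimes>\<^bsub>Gt\<^esub> g) ` Bl k \<subseteq> G" using s Bl_G by (auto intro!: G_closed)
  ultimately show ?thesis unfolding bdry_shift_def using Bl_G[of k] by (auto; blast)
qed

lemma bdry_shift_G: "bdry_shift s k \<subseteq> G"
  unfolding bdry_shift_def by auto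

definition heavy :: "'g \<Rightarrow> real \<Rightarrow> nat \<Rightarrow> 'x \<Rightarrow> bool" where
  "heavy s e k x \<longleftrightarrow> e * (\<Sum>g\<in>Bl k. om g x) < (\<Sum>g\<in>bdry_shift s k. om g x)"

lemma heavy_sets: "{x\<in>space M. heavy s e k x} \<in> sets M"
  unfolding heavy_def
  by (intro borel_measurable_less borel_measurable_times borel_measurable_const borel_measurable_sum om_meas)

text \<open>A point and its partner under \<open>s\<close> lie on opposite sides of the ball at
  distance at most \<open>sg\<close>, so both lie on the thickened sphere. The factor 1/2 arises
  because the mass of the fattened ball is split into the ball and the added shell, each bounded
  separately by the sphere.\<close>

lemma heavy_thick:
  assumes x: "nice x" and c: "c \<in> G" and k: "1 \<le> k" and h: "heavy s e k (a c x)" and e: "0 < e" "e \<le> 1"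
    and s: "s \<in> G" "d s \<one>\<^bsub>Gt\<^esub> \<le> sg" and void: "voidless (carrier Gt) d"
  shows "e/2 * (\<Sum>g\<in>nbhd G d sg (cball_in G d c (real k)). om g x)
       \<le> (\<Sum>g\<in>nbhd G d sg (cball_in G d c (real k)) \<inter> thick_bdry G (carrier Gt) d sg (real k) c. om g x)"
proof -
  let ?B = "cball_in G d c (real k)" and ?T = "thick_bdry G (carrier Gt) d sg (real k) c"
  let ?N = "nbhd G d sg ?B" and ?H = "(\<lambda>h. h \<otimes>\<^bsub>Gt\<^esub> c) ` bdry_shift s k"
  have sg: "0 \<le> sg" using metric_on_set_nonneg[OF metric_G s(1) G_closed(1)] s(2) by linarith
  have BG: "?B \<subseteq> G" "finite ?B" using finite_cball[OF c] unfolding cball_in_def by auto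
  have N: "finite ?N" "?N \<subseteq> G" by (rule finite_nbhd[OF finite_cball BG(2,1)], assumption, rule nbhd_subset_carrier)
  have BN: "?B \<subseteq> ?N" by (rule subset_nbhd[OF metric_G BG(1) sg])
  have cross: "p \<in> ?N \<inter> ?T \<and> q \<in> ?N \<inter> ?T" if pq: "p \<in> ?B" "q \<in> G - ?B" "d p q \<le> sg" for p q
  proof -
    have "d c p \<le> real k" "real k < d c q" "p \<in> G" using pq unfolding cball_in_def by auto
    then have "p \<in> ?T \<and> q \<in> ?T"
      using voidless_crossing[OF metric_d G_carrier void c, of p q "real k" sg] pq k by simp
    moreover have "p \<in> ?N" using BN pq by blast
    moreover have "q \<in> ?N" using pq unfolding nbhd_def by blast
    ultimately show ?thesis by blast
  qed
  have inB: "h \<in> Bl k \<longleftrightarrow> h \<otimes>\<^bsub>Gt\<^esub> c \<in> ?B" if "h \<in> G" for h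
    using d_shift[OF G_closed(1) that c] d_sym[OF that G_closed(1)] that c
    unfolding int_ball_def cball_in_def by simp
  have HN: "?H \<subseteq> ?N \<inter> ?T"
  proof (rule image_subsetI)
    fix h assume "h \<in> bdry_shift s k"
    then have h: "h \<in> G" "(h \<in> Bl k) \<noteq> (inv\<^bsub>Gt\<^esub> s \<otimes>\<^bsub>Gt\<^esub> h \<in> Bl k)" unfolding bdry_shift_def by auto
    let ?y = "h \<otimes>\<^bsub>Gt\<^esub> c" and ?z = "inv\<^bsub>Gt\<^esub> s \<otimes>\<^bsub>Gt\<^esub> h \<otimes>\<^bsub>Gt\<^esub> c"
    have G: "?y \<in> G" "?z \<in> G" "inv\<^bsub>Gt\<^esub> s \<otimes>\<^bsub>Gt\<^esub> h \<in> G" "inv\<^bsub>Gt\<^esub> s \<in> G" using h s c by auto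
    \<comment> \<open>Right invariance cancels \<open>c\<close> and then \<open>h\<close>: left
      multiplication by the inverse of \<open>s\<close> moves every point equally far.\<close>
    have "d ?y ?z = d h (inv\<^bsub>Gt\<^esub> s \<otimes>\<^bsub>Gt\<^esub> h)" by (rule d_shift[OF h(1) G(3) c])
    also have "\<dots> = d \<one>\<^bsub>Gt\<^esub> (inv\<^bsub>Gt\<^esub> s)" using d_shift[OF G_closed(1) G(4) h(1)] h by simp
    also have "\<dots> = d s \<one>\<^bsub>Gt\<^esub>" using d_shift[OF G_closed(1) G(4) s(1)] s by simp
    finally have dyz: "d ?y ?z \<le> sg" "d ?z ?y \<le> sg" using s(2) d_sym[OF G(1,2)] by simp_all
    show "?y \<in> ?N \<inter> ?T"
      using cross[of ?y ?z] cross[of ?z ?y] dyz inB[OF h(1)] inB[OF G(3)] h(2) G by blast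
  qed
  have inj: "inj_on (\<lambda>h. h \<otimes>\<^bsub>Gt\<^esub> c) (bdry_shift s k)"
    by (rule inj_on_subset[OF Gt.inj_on_multc[OF G_closed(4)[OF c]] order_trans[OF bdry_shift_G G_carrier]])
  have pos: "0 \<le> om g x" for g by simp
  have "(e * (\<Sum>g\<in>Bl k. om g (a c x))) * om c x \<le> (\<Sum>g\<in>bdry_shift s k. om g (a c x)) * om c x"
    using h unfolding heavy_def by (intro mult_right_mono) auto
  then have "e * (\<Sum>y\<in>?B. om y x) \<le> (\<Sum>g\<in>bdry_shift s k. om g (a c x)) * om c x"
    unfolding orbit_sum_om[OF x c, symmetric] by (simp add: mult.assoc)
  also have "\<dots> = (\<Sum>g\<in>bdry_shift s k. om (g \<otimes>\<^bsub>Gt\<^esub> c) x)"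
    unfolding sum_distrib_right
    by (rule sum.cong[OF refl]) (rule nice_cocycle[OF x _ c, symmetric], rule subsetD[OF bdry_shift_G])
  also have "\<dots> = (\<Sum>y\<in>?H. om y x)" using sum.reindex[OF inj, of "\<lambda>y. om y x"] by simp
  also have "\<dots> \<le> (\<Sum>y\<in>?N \<inter> ?T. om y x)" using HN N by (intro sum_mono2) auto
  finally have 1: "e * (\<Sum>y\<in>?B. om y x) \<le> (\<Sum>y\<in>?N \<inter> ?T. om y x)" .
  \<comment> \<open>The added shell needs no heaviness: each of its points is within
    \<open>sg\<close> of a point of the ball, so voidlessness puts it on the thickened
    sphere.\<close>
  have "?N - ?B \<subseteq> ?N \<inter> ?T"
  proof
    fix q assume q: "q \<in> ?N - ?B"
    then obtain p where "p \<in> ?B" "d p q \<le> sg" "q \<in> G" unfolding nbhd_def by blast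
    then show "q \<in> ?N \<inter> ?T" using cross[of p q] q by blast
  qed
  then have 2: "(\<Sum>y\<in>?N - ?B. om y x) \<le> (\<Sum>y\<in>?N \<inter> ?T. om y x)" using N by (intro sum_mono2) auto
  have 3: "e * (\<Sum>y\<in>?N - ?B. om y x) \<le> 1 * (\<Sum>y\<in>?N - ?B. om y x)"
    using e by (intro mult_right_mono sum_nonneg) auto
  have "(\<Sum>y\<in>?N. om y x) = (\<Sum>y\<in>?N - ?B. om y x) + (\<Sum>y\<in>?B. om y x)"
    by (rule sum.subset_diff[OF BN N(1)])
  then have 4: "e/2 * (\<Sum>y\<in>?N. om y x) = (e * (\<Sum>y\<in>?N - ?B. om y x) + e * (\<Sum>y\<in>?B. om y x)) / 2"
    by (simp add: field_simps)
  have "z \<le> t" if "q \<le> t" "u \<le> t" "p \<le> 1 * u" "z = (p + q) / 2" for z t u p q :: real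
  proof -
    have "p + q \<le> 2 * t" using that(1,2,3) by simp
    then show ?thesis unfolding that(4) by simp
  qed
  from this[OF 1 2 3 4] show ?thesis .
qed


section \<open>Recurrent heavy boundaries form a null set\<close>

lemma frequently_heavy_sets: "{x\<in>space M. \<forall>n. \<exists>k\<ge>n. heavy s e k x} \<in> sets M"
proof -
  have "{x\<in>space M. \<forall>n. \<exists>k\<ge>n. heavy s e k x} = (\<Inter>n. \<Union>k\<in>{n..}. {x\<in>space M. heavy s e k x})" by auto
  also have "\<dots> \<in> sets M" using heavy_sets by (intro sets.countable_INT sets.countable_UN') auto
  finally show ?thesis .
qed

lemma act_sets: "g \<in> G \<Longrightarrow> A \<in> sets M \<Longrightarrow> {x\<in>space M. a g x \<in> A} \<in> sets M"
proof -
  assume "g \<in> G" "A \<in> sets M"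
  then have "a g -` A \<inter> space M \<in> sets M" by (intro measurable_sets[OF a_meas])
  then show ?thesis by (simp add: vimage_def Int_def conj_commute)
qed

lemma Bl_exhaust: "g \<in> G \<Longrightarrow> \<exists>n. g \<in> Bl n"
  unfolding int_ball_def using real_nat_ceiling_ge[of "d g \<one>\<^bsub>Gt\<^esub>"] by blast

lemma nice_point_if_integral_pos:
  fixes I :: "'x \<Rightarrow> real"
  assumes "integrable M I" "0 < (\<integral>x. I x \<partial>M)"
  obtains x where "nice x" "0 < I x"
proof -
  have "\<exists>x. nice x \<and> 0 < I x"
  proof (rule ccontr)
    assume "\<not> ?thesis"
    then have "AE x in M. I x \<le> 0" using AE_nice by (auto simp: not_less elim!: eventually_mono)
    then have "(\<integral>x. I x \<partial>M) \<le> (\<integral>x. 0 \<partial>M)" using assms(1) by (intro integral_mono_AE) auto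
    then show False using assms(2) by simp
  qed
  then show ?thesis using that by blast
qed

text \<open>If heavy boundaries recurred on a set of positive measure, then by ergodicity almost every orbit
  point would have, within a fixed distance, a centre with heavy boundaries at all of any number of
  scales; averaging the orbit weights over a large ball gives an orbit contradicting the
  combinatorial theorem.\<close>
lemma frequently_heavy_null:
  assumes erg: "ergodic_action G M a" and ws: "well_separable G d" and dbl: "mult_doubling Gt G d"
    and void: "voidless (carrier Gt) d" and fid: "finite_intersection_dim G (carrier Gt) d"
    and s: "s \<in> G" and e: "0 < e" "e \<le> 1"
  shows "prob {x\<in>space M. \<forall>n. \<exists>k\<ge>n. heavy s e k x} = 0"
proof (rule well_separableE[OF ws], rule ccontr)
  define A where "A = {x\<in>space M. \<forall>n. \<exists>k\<ge>n. heavy s e k x}"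
  assume "prob {x\<in>space M. \<forall>n. \<exists>k\<ge>n. heavy s e k x} \<noteq> 0"
  then have pA: "0 < prob A" unfolding A_def using measure_nonneg[of M] by (simp add: less_le)
  have Am [measurable]: "A \<in> sets M" unfolding A_def by (rule frequently_heavy_sets)
  fix chi :: nat
  assume chi: "0 < chi" and sep: "\<And>E r L. \<lbrakk>finite E; E \<subseteq> G; 0 < L; \<And>x. x \<in> E \<Longrightarrow> L \<le> r x\<rbrakk> \<Longrightarrow>
       \<exists>F c. F \<subseteq> E \<and> E \<subseteq> (\<Union>x\<in>F. cball_in G d x (r x)) \<and> (\<forall>x\<in>F. c x < chi) \<and>
         (\<forall>x\<in>F. \<forall>y\<in>F. c x = c y \<longrightarrow> x \<noteq> y \<longrightarrow>
            (\<forall>p\<in>cball_in G d x (r x). \<forall>q\<in>cball_in G d y (r y). L \<le> d p q))"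
  obtain kappa :: nat and R :: real where fidR: "R > 1 \<and>
      (\<forall>t r x. (\<forall>i\<in>{1..kappa}. t i \<ge> 1 \<and> r i \<ge> (\<Prod>j=1..i. t j) * R \<and> x i \<in> G \<and>
                  (\<forall>j\<in>{1..<i}. x i \<in> thick_bdry G (carrier Gt) d (t j) (r j) (x j)))
         \<longrightarrow> (\<Inter>i\<in>{1..kappa}. thick_bdry G (carrier Gt) d (t i) (r i) (x i)) = {})"
    using fid unfolding finite_intersection_dim_def by (elim exE) (rule that)
  obtain D1 K where D1: "1 \<le> D1" and dblD: "\<And>k. K \<le> k \<Longrightarrow> real (card (BB k)) \<le> D1 * real (card (Bl k))"
    by (rule doubling_constant[OF dbl]) blast
  \<comment> \<open>With this \<open>D\<close> and with \<open>beta\<close> below, the two penalties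
    in \<open>I\<close> each have integral at most a quarter of \<open>card (Bl n)\<close>.\<close>
  define D where "D = 4 * D1"
  define cc where "cc = e/2 / (8 * chi)"
  define Q where "Q = depth cc D kappa"
  define eta where "eta = tol cc kappa"
  have cc: "0 < cc" "cc \<le> 1" unfolding cc_def using e chi by (auto simp: field_simps)
  have eta: "0 < eta" unfolding eta_def using tol_bounds[OF cc] by blast
  define beta where "beta = eta / (8 * D1)"
  have beta: "0 < beta" unfolding beta_def using eta D1 by simp
  define U where "U n = {x\<in>space M. \<exists>g\<in>Bl n. a g x \<in> A}" for n
  have Um: "U n \<in> sets M" for n
  proof -
    have "U n = (\<Union>g\<in>Bl n. {x\<in>space M. a g x \<in> A})" unfolding U_def by auto
    also have "\<dots> \<in> sets M" using finite_balls Bl_G Am by (intro sets.finite_UN act_sets) auto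
    finally show ?thesis .
  qed
  have UU: "(\<Union>n. U n) = {x\<in>space M. \<exists>g\<in>G. a g x \<in> A}"
  proof (intro equalityI subsetI)
    fix x assume "x \<in> {x\<in>space M. \<exists>g\<in>G. a g x \<in> A}"
    then obtain g where g: "x \<in> space M" "g \<in> G" "a g x \<in> A" by blast
    obtain n where "g \<in> Bl n" using Bl_exhaust[OF g(2)] by blast
    then show "x \<in> (\<Union>n. U n)" using g unfolding U_def by blast
  qed (use Bl_G in \<open>auto simp: U_def\<close>)
  have "A \<subseteq> {x\<in>space M. \<exists>g\<in>G. a g x \<in> A}"
  proof
    fix x assume x: "x \<in> A"
    then have "x \<in> space M" "a \<one>\<^bsub>Gt\<^esub> x \<in> A" using a_one[of x] unfolding A_def by auto
    then show "x \<in> {x\<in>space M. \<exists>g\<in>G. a g x \<in> A}" using G_closed(1) by blast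
  qed
  then have "prob A \<le> prob {x\<in>space M. \<exists>g\<in>G. a g x \<in> A}"
    by (intro finite_measure_mono orbit_sets Am)
  then have pU: "prob (\<Union>n. U n) = 1" using ergodic_orbit[OF erg Am] pA unfolding UU by linarith
  have "(\<lambda>n. prob (U n)) \<longlonglongrightarrow> prob (\<Union>n. U n)"
  proof (rule finite_Lim_measure_incseq)
    show "range U \<subseteq> sets M" using Um by blast
    show "incseq U" unfolding incseq_def U_def using Bl_mono by blast
  qed
  then have "eventually (\<lambda>n. 1 - beta < prob (U n)) sequentially"
    unfolding pU by (rule order_tendstoD) (use beta in simp)
  then obtain n0 where n0: "\<And>n. n0 \<le> n \<Longrightarrow> 1 - beta < prob (U n)"
    unfolding eventually_sequentially by blast
  \<comment> \<open>Large enough that \<open>Bl sg\<close> brings all but \<open>beta\<close> of the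
    space into \<open>A\<close>, and that it contains \<open>s\<close>.\<close>
  define sg where "sg = max n0 (max 1 (nat \<lceil>d s \<one>\<^bsub>Gt\<^esub>\<rceil>))"
  have sg: "1 \<le> sg" "d s \<one>\<^bsub>Gt\<^esub> \<le> real sg" "1 - beta < prob (U sg)"
    unfolding sg_def using n0 real_nat_ceiling_ge[of "d s \<one>\<^bsub>Gt\<^esub>"] by (auto simp: le_max_iff_disj intro: order_trans)
  \<comment> \<open>Points having some translate in \<open>A\<close> within reach \<open>sg\<close>
    that is not heavy at any scale from \<open>m\<close> to \<open>m'\<close>. Off these sets every
    such translate serves, so one centre works for all scales at once.\<close>
  define X where "X m m' = (\<Union>g\<in>Bl sg. {x\<in>space M. a g x \<in> A - (\<Union>k\<in>{m..m'}. {x\<in>space M. heavy s e k x})})" for m m'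
  have Xm: "X m m' \<in> sets M" for m m'
    unfolding X_def using finite_balls Bl_G Am heavy_sets by (intro sets.finite_UN act_sets) auto
  \<comment> \<open>Besides the growth conditions, the next scale must make the exceptional set so
    small that \<open>Q\<close> of them together have measure at most \<open>beta\<close>.\<close>
  have next_scale: "\<exists>m'. 4 * m \<le> m' \<and> real m ^ kappa * R \<le> real m' \<and> prob (X m m') < beta / real (Suc Q)" for m
  proof -
    have "(\<lambda>m'. prob (X m m')) \<longlonglongrightarrow> prob (\<Inter>m'. X m m')"
    proof (rule finite_Lim_measure_decseq)
      show "range (X m) \<subseteq> sets M" using Xm by blast
      show "decseq (X m)" unfolding decseq_def X_def by fastforce
    qed
    moreover have "(\<Inter>m'. X m m') = {}"
    proof (rule ccontr)
      assume "\<not> ?thesis"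
      then obtain x where x: "\<And>m'. x \<in> X m m'" by blast
      \<comment> \<open>\<open>Bl sg\<close> is finite, so the largest of the heavy scales chosen
        for its elements is an upper end \<open>m'\<close> excluding \<open>x\<close> from
        \<open>X m m'\<close>.\<close>
      have "\<exists>k\<in>{m..}. heavy s e k (a g x)" if "a g x \<in> A" for g using that unfolding A_def by blast
      then have "\<forall>g. \<exists>k. a g x \<in> A \<longrightarrow> m \<le> k \<and> heavy s e k (a g x)" by auto
      then obtain kf where kf: "\<And>g. a g x \<in> A \<Longrightarrow> m \<le> kf g \<and> heavy s e (kf g) (a g x)" by metis
      obtain g where g: "g \<in> Bl sg" "a g x \<in> A" "\<And>k. k \<in> {m..Max (kf ` Bl sg)} \<Longrightarrow> a g x \<in> space M \<Longrightarrow> \<not> heavy s e k (a g x)"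
        using x[of "Max (kf ` Bl sg)"] unfolding X_def by blast
      have "kf g \<le> Max (kf ` Bl sg)" using g finite_balls by (intro Max_ge) auto
      then show False using g(3)[of "kf g"] kf[OF g(2)] g(2) unfolding A_def by auto
    qed
    ultimately have "(\<lambda>m'. prob (X m m')) \<longlonglongrightarrow> 0" by simp
    then have "eventually (\<lambda>m'. prob (X m m') < beta / real (Suc Q)) sequentially"
      by (rule order_tendstoD) (use beta in simp)
    then obtain m0 where m0: "\<And>m'. m0 \<le> m' \<Longrightarrow> prob (X m m') < beta / real (Suc Q)"
      unfolding eventually_sequentially by blast
    let ?m = "max m0 (max (4 * m) (nat \<lceil>real m ^ kappa * R\<rceil>))"
    have "real m ^ kappa * R \<le> real ?m" using real_nat_ceiling_ge[of "real m ^ kappa * R"] by linarith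
    then show ?thesis using m0[of ?m] by (intro exI[of _ ?m]) auto
  qed
  then obtain nx where nx: "\<And>m. 4 * m \<le> nx m \<and> real m ^ kappa * R \<le> real (nx m) \<and> prob (X m (nx m)) < beta / real (Suc Q)"
    by metis
  define b where "b = rec_nat sg (\<lambda>_. nx)"
  have b0: "b 0 = sg" and bS: "b (Suc i) = nx (b i)" for i unfolding b_def by simp_all
  have b1: "1 \<le> b i" for i
  proof (induction i)
    case 0
    then show ?case using sg b0 by simp
  next
    case (Suc i)
    then show ?case using nx[of "b i"] unfolding bS by linarith
  qed
  define ok where "ok c x \<longleftrightarrow> c \<in> G \<and> a c x \<in> space M \<and> (\<forall>i<Q. \<exists>k\<in>{b i..b (Suc i)}. heavy s e k (a c x))" for c x
  define Bad where "Bad = (space M - U sg) \<union> (\<Union>i<Q. X (b i) (b (Suc i)))"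
  have Badm [measurable]: "Bad \<in> sets M" unfolding Bad_def using Um Xm by auto
  have pBad: "prob Bad \<le> 2 * beta"
  proof -
    have "prob Bad \<le> prob (space M - U sg) + prob (\<Union>i<Q. X (b i) (b (Suc i)))"
      unfolding Bad_def using Um Xm by (intro measure_Un_le) auto
    also have "prob (space M - U sg) \<le> beta" using prob_compl[OF Um[of sg]] sg(3) by simp
    also have "prob (\<Union>i<Q. X (b i) (b (Suc i))) \<le> (\<Sum>i<Q. prob (X (b i) (b (Suc i))))"
      using Xm by (intro measure_UNION_le) auto
    also have "\<dots> \<le> (\<Sum>i<Q. beta / real (Suc Q))"
      using nx unfolding bS by (intro sum_mono) (simp add: less_imp_le)
    also have "\<dots> \<le> beta" using beta by (simp add: field_simps)
    finally show ?thesis by simp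
  qed
  have okBad: "\<exists>g\<in>Bl sg. ok g y" if y: "y \<in> space M" "y \<notin> Bad" for y
  proof -
    obtain g where g: "g \<in> Bl sg" "a g y \<in> A" using y unfolding Bad_def U_def by auto
    have "\<exists>k\<in>{b i..b (Suc i)}. heavy s e k (a g y)" if "i < Q" for i
    proof (rule ccontr)
      assume "\<not> ?thesis"
      then have "y \<in> X (b i) (b (Suc i))" unfolding X_def using g y by blast
      then show False using y that unfolding Bad_def by blast
    qed
    moreover have "g \<in> G" using g Bl_G by blast
    ultimately show ?thesis using g a_space[of g y] y unfolding ok_def by blast
  qed
  define n where "n = max K (b Q)"
  have iB: "integrable M (indicator Bad :: _ \<Rightarrow> real)"
    by (rule integrable_bounded[of _ 1]) (auto simp: indicator_def)
  have i1: "integrable M (\<lambda>_. 1 :: real)" by simp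
  \<comment> \<open>A single function with positive integral gives both requirements at one point:
    positivity of \<open>I x\<close> forces doubling of the orbit weights and smallness of the bad
    mass.\<close>
  define I where "I x = (\<Sum>g\<in>Bl n. hat g (\<lambda>_. 1) x) - (\<Sum>g\<in>BB n. hat g (\<lambda>_. 1) x) / D
      - (\<Sum>g\<in>BB n. hat g (indicator Bad) x) / eta" for x
  have iI: "integrable M I" unfolding I_def[abs_def]
    by (intro Bochner_Integration.integrable_diff integrable_divide integrable_hat_sum Bl_G BB_G iB i1)
  have "(\<integral>x. I x \<partial>M) = card (Bl n) - card (BB n) / D - card (BB n) * prob Bad / eta"
    unfolding I_def using integrable_hat_sum[OF Bl_G i1] integrable_hat_sum[OF BB_G i1] integrable_hat_sum[OF BB_G iB]
    by (simp add: integral_hat_sum[OF Bl_G i1] integral_hat_sum[OF BB_G i1] integral_hat_sum[OF BB_G iB] prob_space)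
  moreover have "card (BB n) / D \<le> card (Bl n) / 4"
    using dblD[of n] D1 unfolding D_def n_def by (simp add: field_simps)
  moreover have "card (BB n) * prob Bad / eta \<le> card (Bl n) / 4"
  proof -
    have "card (BB n) * prob Bad \<le> (D1 * card (Bl n)) * (2 * beta)"
      using dblD[of n] D1 pBad unfolding n_def by (intro mult_mono) auto
    also have "\<dots> = eta * (card (Bl n) / 4)" unfolding beta_def using D1 by (simp add: field_simps)
    finally show ?thesis using eta by (simp add: field_simps)
  qed
  moreover have "0 < real (card (Bl n))" using card_Bl by simp
  ultimately have "0 < (\<integral>x. I x \<partial>M)" by linarith
  then obtain x where x: "nice x" "0 < I x" by (rule nice_point_if_integral_pos[OF iI])
  define w where "w g = om g x" for g
  define bad where "bad = {g\<in>G. a g x \<in> Bad}"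
  define ctr where "ctr y = (SOME c. ok c x \<and> d y c \<le> real sg)" for y
  define rad where "rad i c = real (SOME k. k \<in> {b i..b (Suc i)} \<and> heavy s e k (a c x))" for i c
  have ctr: "ok (ctr y) x \<and> d y (ctr y) \<le> real sg" if y: "y \<in> G - bad" for y
    unfolding ctr_def
  proof (rule someI_ex)
    have yG: "y \<in> G" and "a y x \<notin> Bad" using y unfolding bad_def by auto
    then obtain g where g: "g \<in> Bl sg" "ok g (a y x)" using okBad[of "a y x"] a_space[OF yG nice_space[OF x(1)]] by blast
    have gG: "g \<in> G" "d g \<one>\<^bsub>Gt\<^esub> \<le> real sg" using g(1) unfolding int_ball_def by auto
    have "d y (g \<otimes>\<^bsub>Gt\<^esub> y) = d g \<one>\<^bsub>Gt\<^esub>"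
      using d_shift[OF G_closed(1) gG(1) yG] d_sym[OF gG(1) G_closed(1)] yG by simp
    moreover have "ok (g \<otimes>\<^bsub>Gt\<^esub> y) x"
      using g(2) gG(1) yG unfolding ok_def a_mult[OF gG(1) yG nice_space[OF x(1)]] by simp
    ultimately show "\<exists>c. ok c x \<and> d y c \<le> real sg" using gG by (intro exI[of _ "g \<otimes>\<^bsub>Gt\<^esub> y"]) simp
  qed
  have rad: "\<exists>k. rad i (ctr y) = real k \<and> k \<in> {b i..b (Suc i)} \<and> heavy s e k (a (ctr y) x)"
    if y: "y \<in> G - bad" and i: "i < Q" for y i
  proof -
    have "\<exists>k. k \<in> {b i..b (Suc i)} \<and> heavy s e k (a (ctr y) x)" using ctr[OF y] i unfolding ok_def by blast
    from someI_ex[OF this] show ?thesis unfolding rad_def by blast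
  qed
  interpret hs: heavy_spheres "carrier Gt" G d chi kappa Q R "e/2" D "real sg" "\<lambda>i. real (b i)" w bad ctr rad
  proof
    show "metric_on_set (carrier Gt) d" "G \<subseteq> carrier Gt" by (rule metric_d, rule G_carrier)
    show "\<And>x r. x \<in> G \<Longrightarrow> finite (cball_in G d x r)" by (rule finite_cball)
    show "0 < chi" "1 < R" by (rule chi, rule fidR[THEN conjunct1])
    show "\<And>E r L. \<lbrakk>finite E; E \<subseteq> G; 0 < L; \<And>x. x \<in> E \<Longrightarrow> L \<le> r x\<rbrakk> \<Longrightarrow>
       \<exists>F c. F \<subseteq> E \<and> E \<subseteq> (\<Union>x\<in>F. cball_in G d x (r x)) \<and> (\<forall>x\<in>F. c x < chi) \<and>
         (\<forall>x\<in>F. \<forall>y\<in>F. c x = c y \<longrightarrow> x \<noteq> y \<longrightarrow>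
            (\<forall>p\<in>cball_in G d x (r x). \<forall>q\<in>cball_in G d y (r y). L \<le> d p q))" by (rule sep)
    show "\<And>t r x. (\<forall>i\<in>{1..kappa}. t i \<ge> 1 \<and> r i \<ge> (\<Prod>j=1..i. t j) * R \<and> x i \<in> G \<and>
                  (\<forall>j\<in>{1..<i}. x i \<in> thick_bdry G (carrier Gt) d (t j) (r j) (x j)))
         \<Longrightarrow> (\<Inter>i\<in>{1..kappa}. thick_bdry G (carrier Gt) d (t i) (r i) (x i)) = {}" 
      by (rule fidR[THEN conjunct2, THEN spec, THEN spec, THEN spec, THEN mp])
    show "0 < e/2" "e/2 \<le> 1" using e by simp_all
    show "2 \<le> D" using D1 unfolding D_def by simp
    show "1 \<le> real sg" "real sg \<le> real (b 0)" using sg b0 by simp_all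
    show "4 * real (b i) \<le> real (b (Suc i))" for i
    proof -
      have "4 * b i \<le> b (Suc i)" using nx[of "b i"] unfolding bS by blast
      then show ?thesis by linarith
    qed
    show "real (b i) ^ kappa * R \<le> real (b (Suc i))" for i using nx[of "b i"] unfolding bS by blast
    show "0 \<le> w y" for y unfolding w_def by simp
    show "ctr y \<in> G \<and> d y (ctr y) \<le> real sg" if "y \<in> G - bad" for y using ctr[OF that] unfolding ok_def by blast
    show "real (b i) \<le> rad i (ctr y) \<and> rad i (ctr y) \<le> real (b (Suc i))" if "y \<in> G - bad" "i < Q" for y i
      using rad[OF that] by auto
    show "e/2 * sum w (nbhd G d (real sg) (cball_in G d (ctr y) (rad i (ctr y))))
          \<le> sum w (nbhd G d (real sg) (cball_in G d (ctr y) (rad i (ctr y)))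
                   \<inter> thick_bdry G (carrier Gt) d (real sg) (rad i (ctr y)) (ctr y))"
      if y: "y \<in> G - bad" "i < Q" for y i
    proof -
      obtain k where k: "rad i (ctr y) = real k" "k \<in> {b i..b (Suc i)}" "heavy s e k (a (ctr y) x)" using rad[OF y] by blast
      have "1 \<le> k" using k(2) b1[of i] by simp
      moreover have "ctr y \<in> G" using ctr[OF y(1)] unfolding ok_def by blast
      ultimately show ?thesis unfolding k(1) w_def
        by (intro heavy_thick[OF x(1) _ _ k(3) e s sg(2) void])
    qed
  qed
  have NB: "nbhd G d (real (b Q)) (Bl n) \<subseteq> BB n" by (rule nbhd_Bl) (simp add: n_def)
  have Iw: "sum w (BB n) / D + sum w (BB n \<inter> bad) / eta < sum w (Bl n)"
  proof -
    have "(\<Sum>g\<in>BB n. hat g (indicator Bad) x) = sum w (BB n \<inter> bad)"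
    proof -
      have "(\<Sum>g\<in>BB n. hat g (indicator Bad) x) = (\<Sum>g\<in>BB n. if g \<in> bad then w g else 0)"
      proof (rule sum.cong[OF refl])
        fix g assume "g \<in> BB n"
        then have "g \<in> G" using BB_G by blast
        then show "hat g (indicator Bad) x = (if g \<in> bad then w g else 0)"
          unfolding hat_op_def w_def bad_def by (simp add: indicator_def)
      qed
      then show ?thesis using sum.inter_restrict[OF finite_BB, of w n bad] by simp
    qed
    then show ?thesis using x(2) unfolding I_def hat_one w_def by simp
  qed
  have D0: "0 < D" using D1 unfolding D_def by simp
  have pos: "0 \<le> sum w (BB n)" "0 \<le> sum w (BB n \<inter> bad)" unfolding w_def by (auto intro: sum_nonneg)
  then have pos': "0 \<le> sum w (BB n) / D" "0 \<le> sum w (BB n \<inter> bad) / eta" using D0 eta by simp_all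
  have wB: "0 < sum w (Bl n)" using Iw pos' by linarith
  have "sum w (BB n) / D \<le> sum w (Bl n)" using Iw pos' by linarith
  then have DB: "sum w (BB n) \<le> D * sum w (Bl n)" using D0 by (simp add: field_simps)
  have "sum w (BB n \<inter> bad) / eta \<le> sum w (Bl n)" using Iw pos' by linarith
  then have EB: "sum w (BB n \<inter> bad) \<le> eta * sum w (Bl n)" using eta by (simp add: field_simps)
  have N1: "sum w (nbhd G d (real (b Q)) (Bl n)) \<le> sum w (BB n)"
    using NB finite_BB by (intro sum_mono2) (auto simp: w_def)
  have N2: "sum w (nbhd G d (real (b Q)) (Bl n) \<inter> bad) \<le> sum w (BB n \<inter> bad)"
    using NB finite_BB by (intro sum_mono2) (auto simp: w_def)
  have "eta * sum w (Bl n) < sum w (nbhd G d (real (b Q)) (Bl n) \<inter> bad)"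
    unfolding eta_def cc_def
    by (rule hs.bad_mass_lower_bound) (use wB finite_balls Bl_G N1 DB in \<open>simp_all add: Q_def cc_def\<close>)
  then show False using N2 EB by linarith
qed

lemma boundary_negligible:
  assumes erg: "ergodic_action G M a" and ws: "well_separable G d" and dbl: "mult_doubling Gt G d"
    and void: "voidless (carrier Gt) d" and fid: "finite_intersection_dim G (carrier Gt) d"
    and s: "s \<in> G"
  shows "AE x in M. (\<lambda>k. (\<Sum>g\<in>bdry_shift s k. om g x) / (\<Sum>g\<in>Bl k. om g x)) \<longlonglongrightarrow> 0"
proof -
  have "AE x in M. \<not> (\<forall>n. \<exists>k\<ge>n. heavy s (1 / real (Suc m)) k x)" for m
  proof -
    have "prob {x\<in>space M. \<forall>n. \<exists>k\<ge>n. heavy s (1 / real (Suc m)) k x} = 0"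
      by (rule frequently_heavy_null[OF assms]) simp_all
    then have "{x\<in>space M. \<forall>n. \<exists>k\<ge>n. heavy s (1 / real (Suc m)) k x} \<in> null_sets M"
      by (intro null_setsI frequently_heavy_sets) (simp only: emeasure_eq_measure ennreal_0)
    then have "AE x in M. x \<notin> {x\<in>space M. \<forall>n. \<exists>k\<ge>n. heavy s (1 / real (Suc m)) k x}" by (rule AE_not_in)
    then show ?thesis using AE_space by eventually_elim blast
  qed
  then have "AE x in M. \<forall>m. \<not> (\<forall>n. \<exists>k\<ge>n. heavy s (1 / real (Suc m)) k x)"
    by (intro AE_all_countable[THEN iffD2] allI)
  with AE_nice show ?thesis
  proof eventually_elim
    case (elim x)
    let ?r = "\<lambda>k. (\<Sum>g\<in>bdry_shift s k. om g x) / (\<Sum>g\<in>Bl k. om g x)"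
    have pos: "0 < (\<Sum>g\<in>Bl k. om g x)" for k
    proof (rule sum_pos)
      show "Bl k \<noteq> {}" using one_Bl by blast
      show "0 < om g x" if "g \<in> Bl k" for g using nice_pos[OF elim(1)] that Bl_G by blast
    qed (rule finite_balls)
    show ?case
    proof (rule LIMSEQ_I)
      fix r :: real assume "0 < r"
      then obtain m where m: "1 / real (Suc m) < r" using nat_approx_posE by (auto simp: inverse_eq_divide)
      obtain n where n: "\<And>k. n \<le> k \<Longrightarrow> \<not> heavy s (1 / real (Suc m)) k x" using elim(2) by blast
      have "norm (?r k - 0) < r" if "n \<le> k" for k
      proof -
        have "0 \<le> ?r k" using pos[of k] by (intro divide_nonneg_pos sum_nonneg) auto
        moreover have "?r k \<le> 1 / real (Suc m)"
          using n[OF that] pos[of k] unfolding heavy_def not_less by (simp only: pos_divide_le_eq)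
        ultimately show ?thesis using m by simp
      qed
      then show "\<exists>no. \<forall>k\<ge>no. norm (?r k - 0) < r" by blast
    qed
  qed
qed


section \<open>Convergence of the averages\<close>

abbreviation "avg k F x \<equiv> (\<Sum>g\<in>Bl k. hat g F x) / (\<Sum>g\<in>Bl k. om g x)"

lemma om_sum_pos: "nice x \<Longrightarrow> 0 < (\<Sum>g\<in>Bl k. om g x)"
proof (rule sum_pos)
  show "Bl k \<noteq> {}" using one_Bl by blast
  show "0 < om g x" if "nice x" "g \<in> Bl k" for g using nice_pos[OF that(1)] that(2) Bl_G by blast
qed (rule finite_balls)

text \<open>The sums over \<open>Bl k\<close> and its left translate by \<open>s\<close> cancel
  except on \<open>bdry_shift s k\<close>, where each term is at most
  \<open>c * om g x\<close>.\<close>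

lemma coboundary_average:
  assumes erg: "ergodic_action G M a" and ws: "well_separable G d" and dbl: "mult_doubling Gt G d"
    and void: "voidless (carrier Gt) d" and fid: "finite_intersection_dim G (carrier Gt) d"
    and s: "s \<in> G" and F: "\<And>x. \<bar>F x\<bar> \<le> (c::real)"
  shows "AE x in M. (\<lambda>k. avg k (\<lambda>x. F x - hat s F x) x) \<longlonglongrightarrow> 0"
  using boundary_negligible[OF erg ws dbl void fid s] AE_nice
proof eventually_elim
  case (elim x)
  let ?L = "\<lambda>g. s \<otimes>\<^bsub>Gt\<^esub> g"
  have hatb: "\<bar>hat g F x\<bar> \<le> c * om g x" for g
    unfolding hat_op_def abs_mult using F by (simp add: mult_right_mono)
  have bound: "\<bar>\<Sum>g\<in>Bl k. hat g (\<lambda>x. F x - hat s F x) x\<bar> \<le> c * (\<Sum>g\<in>bdry_shift s k. om g x)" for k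
  proof -
    let ?h = "\<lambda>g. hat g F x"
    have inj: "inj_on ?L (Bl k)"
      by (rule inj_on_subset[OF Gt.inj_on_cmult[OF G_closed(4)[OF s]] order_trans[OF Bl_G G_carrier]])
    have fin: "finite (Bl k)" "finite (?L ` Bl k)" using finite_balls by auto
    have "hat g (\<lambda>x. F x - hat s F x) x = ?h g - ?h (?L g)" if "g \<in> Bl k" for g
    proof -
      have g: "g \<in> G" using that Bl_G by blast
      have "hat g (\<lambda>x. F x - hat s F x) x = ?h g - hat s F (a g x) * om g x"
        unfolding hat_op_def by (simp add: algebra_simps)
      then show ?thesis unfolding hat_orbit[OF elim(2) s g] .
    qed
    then have "(\<Sum>g\<in>Bl k. hat g (\<lambda>x. F x - hat s F x) x) = sum ?h (Bl k) - (\<Sum>g\<in>Bl k. ?h (?L g))"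
      by (simp add: sum_subtractf)
    also have "(\<Sum>g\<in>Bl k. ?h (?L g)) = sum ?h (?L ` Bl k)" using sum.reindex[OF inj, of ?h] by simp
    also have "sum ?h (Bl k) - sum ?h (?L ` Bl k) = sum ?h (Bl k - ?L ` Bl k) - sum ?h (?L ` Bl k - Bl k)"
      using sum.Int_Diff[OF fin(1), of ?h "?L ` Bl k"] sum.Int_Diff[OF fin(2), of ?h "Bl k"] by (simp add: Int_commute)
    finally have diff: "(\<Sum>g\<in>Bl k. hat g (\<lambda>x. F x - hat s F x) x)
        = sum ?h (Bl k - ?L ` Bl k) - sum ?h (?L ` Bl k - Bl k)" .
    have "\<bar>sum ?h (Bl k - ?L ` Bl k) - sum ?h (?L ` Bl k - Bl k)\<bar> \<le> (\<Sum>g\<in>Bl k - ?L ` Bl k. c * om g x) + (\<Sum>g\<in>?L ` Bl k - Bl k. c * om g x)"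
    proof -
      have "\<bar>sum ?h A\<bar> \<le> (\<Sum>g\<in>A. c * om g x)" for A
        by (rule order_trans[OF sum_abs sum_mono]) (rule hatb)
      then show ?thesis by (intro order_trans[OF abs_triangle_ineq4] add_mono)
    qed
    also have "\<dots> = c * (\<Sum>g\<in>bdry_shift s k. om g x)"
    proof -
      have 1: "finite (Bl k - ?L ` Bl k)" "finite (?L ` Bl k - Bl k)" 
        by (rule finite_Diff[OF fin(1)], rule finite_Diff[OF fin(2)])
      have 2: "(Bl k - ?L ` Bl k) \<inter> (?L ` Bl k - Bl k) = {}" by (rule equals0I) (elim IntE DiffE notE)
      have "bdry_shift s k = (Bl k - ?L ` Bl k) \<union> (?L ` Bl k - Bl k)" by (rule bdry_shift_eq[OF s])
      then show ?thesis using sum.union_disjoint[OF 1 2, of "\<lambda>g. c * om g x"] by (simp only: sum_distrib_left)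
    qed
    finally show ?thesis unfolding diff .
  qed
  show ?case
  proof (rule Lim_null_comparison)
    show "\<forall>\<^sub>F k in sequentially. norm (avg k (\<lambda>x. F x - hat s F x) x)
        \<le> c * ((\<Sum>g\<in>bdry_shift s k. om g x) / (\<Sum>g\<in>Bl k. om g x))"
    proof (rule always_eventually, rule allI)
      fix k
      have "norm (avg k (\<lambda>x. F x - hat s F x) x) = \<bar>\<Sum>g\<in>Bl k. hat g (\<lambda>x. F x - hat s F x) x\<bar> / (\<Sum>g\<in>Bl k. om g x)"
        using om_sum_pos[OF elim(2), of k] by (simp add: abs_divide)
      also have "\<dots> \<le> c * (\<Sum>g\<in>bdry_shift s k. om g x) / (\<Sum>g\<in>Bl k. om g x)"
        using om_sum_pos[OF elim(2), of k] bound[of k] by (intro divide_right_mono) auto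
      finally show "norm (avg k (\<lambda>x. F x - hat s F x) x) \<le> c * ((\<Sum>g\<in>bdry_shift s k. om g x) / (\<Sum>g\<in>Bl k. om g x))"
        by simp
    qed
    show "(\<lambda>k. c * ((\<Sum>g\<in>bdry_shift s k. om g x) / (\<Sum>g\<in>Bl k. om g x))) \<longlonglongrightarrow> 0"
      using tendsto_mult_left[OF elim(1), of c] by simp
  qed
qed

text \<open>Three errors below \<open>del / 4\<close> add up: truncating \<open>f\<close>, the
  resulting change of mean, and the exhaustion for the truncated function. The approximant is a
  finite sum of bounded coboundaries.\<close>

lemma good_approx:
  assumes erg: "ergodic_action G M a" and ws: "well_separable G d" and dbl: "mult_doubling Gt G d"
    and void: "voidless (carrier Gt) d" and fid: "finite_intersection_dim G (carrier Gt) d"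
    and f: "integrable M f" and del: "0 < del"
  shows "\<exists>v. integrable M v \<and> (AE x in M. (\<lambda>k. avg k v x) \<longlonglongrightarrow> 0) \<and>
     (\<integral>x. \<bar>f x - (\<integral>y. f y \<partial>M) - v x\<bar> \<partial>M) < del"
proof -
  have [measurable]: "f \<in> borel_measurable M" using f by simp
  define tr where "tr n x = max (- real n) (min (real n) (f x))" for n x
  have trm [measurable]: "tr n \<in> borel_measurable M" for n unfolding tr_def[abs_def] by measurable
  have trb: "- real n \<le> tr n x \<and> tr n x \<le> real n" for n x unfolding tr_def by auto
  have "(\<lambda>n. \<integral>x. \<bar>f x - tr n x\<bar> \<partial>M) \<longlonglongrightarrow> (\<integral>x. 0 \<partial>M)"
  proof (rule integral_dominated_convergence[where w = "\<lambda>x. \<bar>f x\<bar>"])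
    show "integrable M (\<lambda>x. \<bar>f x\<bar>)" using f by simp
    show "AE x in M. (\<lambda>n. \<bar>f x - tr n x\<bar>) \<longlonglongrightarrow> 0"
    proof (rule AE_I2)
      fix x
      have "\<bar>f x - tr n x\<bar> = 0" if "nat \<lceil>\<bar>f x\<bar>\<rceil> \<le> n" for n
      proof -
        have "\<bar>f x\<bar> \<le> real n" using that by linarith
        then show ?thesis unfolding tr_def by auto
      qed
      then have "\<forall>\<^sub>F n in sequentially. \<bar>f x - tr n x\<bar> = 0" unfolding eventually_sequentially by blast
      then show "(\<lambda>n. \<bar>f x - tr n x\<bar>) \<longlonglongrightarrow> 0" by (rule tendsto_eventually)
    qed
    show "AE x in M. norm \<bar>f x - tr n x\<bar> \<le> \<bar>f x\<bar>" for n
      by (rule AE_I2) (auto simp: tr_def max_def min_def)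
  qed simp_all
  then have "eventually (\<lambda>n. (\<integral>x. \<bar>f x - tr n x\<bar> \<partial>M) < del / 4) sequentially"
    by (rule order_tendstoD(2)) (use del in simp)
  then obtain n where n: "(\<integral>x. \<bar>f x - tr n x\<bar> \<partial>M) < del / 4" unfolding eventually_sequentially by blast
  have itr: "integrable M (tr n)" by (rule integrable_bounded[of _ "real n"]) (use trb in \<open>auto simp: abs_le_iff minus_le_iff\<close>)
  \<comment> \<open>The exhaustion needs a nonnegative function; on a probability space adding a
    constant leaves \<open>u\<close> minus its integral unchanged.\<close>
  define u where "u x = tr n x + real n" for x
  have iu: "integrable M u" unfolding u_def[abs_def] using itr by simp
  have um: "u \<in> borel_measurable M" using iu by simp
  have ub: "0 \<le> u x \<and> u x \<le> 2 * real n" for x using trb[of n x] unfolding u_def by linarith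
  have d4: "0 < del / 4" using del by simp
  obtain p :: nat and F s where Fs: "\<forall>j<p. F j \<in> borel_measurable M \<and> (\<forall>x. \<bar>F j x\<bar> \<le> 2 * real n) \<and> s j \<in> G"
    and Fi: "(\<integral>x. \<bar>u x - (\<integral>y. u y \<partial>M) - (\<Sum>j<p. F j x - hat (s j) (F j) x)\<bar> \<partial>M) < del / 4"
    using coboundary_approx[OF erg um ub d4] by (elim exE conjE) (rule that)
  define v where "v x = (\<Sum>j<p. F j x - hat (s j) (F j) x)" for x
  have iF: "integrable M (\<lambda>x. F j x - hat (s j) (F j) x)" if "j < p" for j
  proof -
    have "integrable M (F j)" by (rule integrable_bounded[of _ "2 * real n"]) (use Fs that in auto)
    then show ?thesis using integrable_hat[of "s j" "F j"] Fs that by (intro Bochner_Integration.integrable_diff) auto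
  qed
  have iv: "integrable M v" unfolding v_def[abs_def] using iF by (intro Bochner_Integration.integrable_sum) auto
  have "AE x in M. (\<lambda>k. avg k v x) \<longlonglongrightarrow> 0"
  proof -
    have "AE x in M. \<forall>j\<in>{..<p}. (\<lambda>k. avg k (\<lambda>x. F j x - hat (s j) (F j) x) x) \<longlonglongrightarrow> 0"
    proof (rule AE_finite_allI)
      fix j assume "j \<in> {..<p}"
      then have "s j \<in> G" "\<And>x. \<bar>F j x\<bar> \<le> 2 * real n" using Fs by auto
      then show "AE x in M. (\<lambda>k. avg k (\<lambda>x. F j x - hat (s j) (F j) x) x) \<longlonglongrightarrow> 0"
        by (rule coboundary_average[OF erg ws dbl void fid])
    qed simp
    then show ?thesis
    proof eventually_elim
      case (elim x)
      have "avg k v x = (\<Sum>j<p. avg k (\<lambda>x. F j x - hat (s j) (F j) x) x)" for k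
        unfolding hat_op_def v_def sum_distrib_right sum_divide_distrib[symmetric]
        by (subst sum.swap) simp
      moreover have "(\<lambda>k. \<Sum>j<p. avg k (\<lambda>x. F j x - hat (s j) (F j) x) x) \<longlonglongrightarrow> (\<Sum>j<p. 0)"
        using elim by (intro tendsto_sum) auto
      ultimately show ?case by simp
    qed
  qed
  moreover have "(\<integral>x. \<bar>f x - (\<integral>y. f y \<partial>M) - v x\<bar> \<partial>M) < del"
  proof -
    let ?c = "(\<integral>y. f y \<partial>M) - (\<integral>y. tr n y \<partial>M)"
    have uI: "u x - (\<integral>y. u y \<partial>M) = tr n x - (\<integral>y. tr n y \<partial>M)" for x
      unfolding u_def using itr by (simp add: prob_space)
    have "\<bar>?c\<bar> = \<bar>\<integral>y. f y - tr n y \<partial>M\<bar>" using f itr by simp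
    also have "\<dots> \<le> (\<integral>x. \<bar>f x - tr n x\<bar> \<partial>M)" by (rule integral_abs_bound)
    finally have c: "\<bar>?c\<bar> < del / 4" using n by linarith
    have i1: "integrable M (\<lambda>x. \<bar>f x - tr n x\<bar>)" and i2: "integrable M (\<lambda>x. \<bar>u x - (\<integral>y. u y \<partial>M) - v x\<bar>)"
      using f itr iu iv by auto
    have "(\<integral>x. \<bar>f x - (\<integral>y. f y \<partial>M) - v x\<bar> \<partial>M)
        \<le> (\<integral>x. (\<bar>f x - tr n x\<bar> + \<bar>?c\<bar>) + \<bar>u x - (\<integral>y. u y \<partial>M) - v x\<bar> \<partial>M)"
    proof (rule integral_mono)
      fix x
      show "\<bar>f x - (\<integral>y. f y \<partial>M) - v x\<bar> \<le> (\<bar>f x - tr n x\<bar> + \<bar>?c\<bar>) + \<bar>u x - (\<integral>y. u y \<partial>M) - v x\<bar>"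
        unfolding uI by linarith
    qed (use f iv i1 i2 in auto)
    also have "\<dots> = (\<integral>x. \<bar>f x - tr n x\<bar> \<partial>M) + \<bar>?c\<bar> + (\<integral>x. \<bar>u x - (\<integral>y. u y \<partial>M) - v x\<bar> \<partial>M)"
      using i1 i2 by (simp add: prob_space)
    also have "\<dots> < del" using n c Fi del unfolding v_def by linarith
    finally show ?thesis .
  qed
  ultimately show ?thesis using iv by blast
qed

lemma sum_hat_meas: "F \<in> borel_measurable M \<Longrightarrow> (\<lambda>x. \<Sum>g\<in>Bl k. hat g F x) \<in> borel_measurable M"
  by (rule borel_measurable_sum, rule hat_meas, rule subsetD[OF Bl_G])

lemma sum_om_meas: "(\<lambda>x. \<Sum>g\<in>Bl k. om g x) \<in> borel_measurable M"
  by (intro borel_measurable_sum om_meas)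

text \<open>Banach's principle: the averages of \<open>v\<close> vanish in the limit, so recurrent
  deviations of those of \<open>f\<close> are charged to the small remainder \<open>h\<close>
  through the maximal inequality.\<close>

theorem ratio_ergodic:
  assumes erg: "ergodic_action G M a" and ws: "well_separable G d" and dbl: "mult_doubling Gt G d"
    and void: "voidless (carrier Gt) d" and fid: "finite_intersection_dim G (carrier Gt) d"
    and bcp: "besicovitch G d" and f: "integrable M f"
  shows "AE x in M. (\<lambda>k. avg k f x) \<longlonglongrightarrow> (\<integral>y. f y \<partial>M)"
proof (rule maximal_inequality[OF bcp dbl])
  fix C :: real
  assume C: "0 < C" and max_ineq: "\<And>f l. integrable M f \<Longrightarrow> 0 < l \<Longrightarrow>
     prob {x\<in>space M. \<exists>k\<ge>1. l * (\<Sum>g\<in>Bl k. om g x) < (\<Sum>g\<in>Bl k. hat g (\<lambda>x. \<bar>f x\<bar>) x)} \<le> C / l * (\<integral>x. \<bar>f x\<bar> \<partial>M)"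
  let ?I = "\<integral>y. f y \<partial>M"
  define Z where "Z l = {x\<in>space M. \<forall>n. \<exists>k\<ge>n. l < \<bar>avg k f x - ?I\<bar>}" for l
  have Zm: "Z l \<in> sets M" for l
  proof -
    have "Z l = (\<Inter>n. \<Union>k\<in>{n..}. {x\<in>space M. l < \<bar>avg k f x - ?I\<bar>})" unfolding Z_def by auto
    also have "\<dots> \<in> sets M"
    proof (intro sets.countable_INT sets.countable_UN' image_subsetI)
      fix k
      have "(\<lambda>x. \<bar>avg k f x - ?I\<bar>) \<in> borel_measurable M"
        using sum_hat_meas[OF borel_measurable_integrable[OF f], of k] sum_om_meas[of k] by measurable
      then show "{x\<in>space M. l < \<bar>avg k f x - ?I\<bar>} \<in> sets M" by measurable
    qed auto
    finally show ?thesis .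
  qed
  have Z0: "prob (Z l) = 0" if l: "0 < l" for l
  proof (rule ccontr)
    assume "prob (Z l) \<noteq> 0"
    then have pZ: "0 < prob (Z l)" using measure_nonneg[of M] by (simp add: less_le)
    \<comment> \<open>Chosen so that the maximal inequality at level \<open>l/2\<close> bounds
      \<open>prob (Z l)\<close> strictly by itself.\<close>
    define del where "del = prob (Z l) * (l/2) / C"
    have del: "0 < del" unfolding del_def using pZ l C by simp
    obtain v where v: "integrable M v" "AE x in M. (\<lambda>k. avg k v x) \<longlonglongrightarrow> 0"
      "(\<integral>x. \<bar>f x - ?I - v x\<bar> \<partial>M) < del"
      using good_approx[OF erg ws dbl void fid f del] by blast
    define h where "h x = f x - ?I - v x" for x
    have h: "integrable M h" unfolding h_def[abs_def] using f v by simp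
    let ?m = "{x\<in>space M. \<exists>k\<ge>1. l/2 * (\<Sum>g\<in>Bl k. om g x) < (\<Sum>g\<in>Bl k. hat g (\<lambda>x. \<bar>h x\<bar>) x)}"
    have mm: "?m \<in> sets M"
    proof -
      have "?m = (\<Union>k\<in>{1..}. {x\<in>space M. l/2 * (\<Sum>g\<in>Bl k. om g x) < (\<Sum>g\<in>Bl k. hat g (\<lambda>x. \<bar>h x\<bar>) x)})" by auto
      also have "\<dots> \<in> sets M"
      proof (intro sets.countable_UN' image_subsetI)
        fix k
        have "(\<lambda>x. \<bar>h x\<bar>) \<in> borel_measurable M" using h by simp
        from sum_hat_meas[OF this, of k]
        show "{x\<in>space M. l/2 * (\<Sum>g\<in>Bl k. om g x) < (\<Sum>g\<in>Bl k. hat g (\<lambda>x. \<bar>h x\<bar>) x)} \<in> sets M"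
          using sum_om_meas[of k] by measurable
      qed auto
      finally show ?thesis .
    qed
    have "prob (Z l) \<le> prob ?m"
    proof (rule finite_measure_mono_AE[OF _ mm])
      show "AE x in M. x \<in> Z l \<longrightarrow> x \<in> ?m" using v(2) AE_nice
      proof eventually_elim
        case (elim x)
        show ?case
        proof
          assume x: "x \<in> Z l"
          have "eventually (\<lambda>k. \<bar>avg k v x\<bar> < l/2) sequentially"
            using tendsto_rabs[OF elim(1)] l by (intro order_tendstoD) auto
          then obtain n where n: "\<And>k. n \<le> k \<Longrightarrow> \<bar>avg k v x\<bar> < l/2" unfolding eventually_sequentially by blast
          obtain k where k: "max 1 n \<le> k" "l < \<bar>avg k f x - ?I\<bar>" using x unfolding Z_def by blast
          have k1: "1 \<le> k" "n \<le> k" using k(1) by auto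
          let ?S = "\<Sum>g\<in>Bl k. om g x"
          have S: "0 < ?S" by (rule om_sum_pos[OF elim(2)])
          have "(\<Sum>g\<in>Bl k. hat g h x) = (\<Sum>g\<in>Bl k. hat g f x) - ?I * ?S - (\<Sum>g\<in>Bl k. hat g v x)"
            unfolding hat_op_def h_def by (simp add: algebra_simps sum_subtractf sum.distrib sum_distrib_left)
          then have "avg k h x = avg k f x - ?I - avg k v x" using S by (simp add: diff_divide_distrib)
          then have "l/2 < \<bar>avg k h x\<bar>" using k(2) n[OF k1(2)] by linarith
          then have "l/2 < \<bar>\<Sum>g\<in>Bl k. hat g h x\<bar> / ?S" using S by (simp add: abs_divide)
          then have "l/2 * ?S < \<bar>\<Sum>g\<in>Bl k. hat g h x\<bar>" using S by (simp only: pos_less_divide_eq)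
          also have "\<dots> \<le> (\<Sum>g\<in>Bl k. \<bar>hat g h x\<bar>)" by (rule sum_abs)
          also have "\<dots> = (\<Sum>g\<in>Bl k. hat g (\<lambda>x. \<bar>h x\<bar>) x)" unfolding hat_op_def by (simp add: abs_mult)
          finally show "x \<in> ?m" using k1(1) nice_space[OF elim(2)] by blast
        qed
      qed
    qed
    also have "\<dots> \<le> C / (l/2) * (\<integral>x. \<bar>h x\<bar> \<partial>M)" using l by (intro max_ineq h) simp
    also have "\<dots> < C / (l/2) * del" using v(3) C l unfolding h_def by (intro mult_strict_left_mono) auto
    also have "\<dots> = prob (Z l)" unfolding del_def using C l by simp
    finally show False by simp
  qed
  have "AE x in M. x \<notin> Z (1 / real (Suc m))" for m
  proof (rule AE_not_in, rule null_setsI[OF _ Zm])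
    have "prob (Z (1 / real (Suc m))) = 0" by (rule Z0) simp
    then show "emeasure M (Z (1 / real (Suc m))) = 0" by (simp only: emeasure_eq_measure ennreal_0)
  qed
  then have "AE x in M. \<forall>m. x \<notin> Z (1 / real (Suc m))" by (intro AE_all_countable[THEN iffD2] allI)
  then show ?thesis using AE_space
  proof eventually_elim
    case (elim x)
    show ?case
    proof (rule LIMSEQ_I)
      fix r :: real assume r: "0 < r"
      obtain m where m: "1 / real (Suc m) < r" using nat_approx_posE[OF r] .
      then obtain n where n: "\<And>k. n \<le> k \<Longrightarrow> \<bar>avg k f x - ?I\<bar> \<le> 1 / real (Suc m)"
        using elim(1)[THEN spec, of m] elim(2) unfolding Z_def by (auto simp: not_less)
      then have "\<forall>k\<ge>n. norm (avg k f x - ?I) < r" using m by (auto intro: le_less_trans)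
      then show "\<exists>n. \<forall>k\<ge>n. norm (avg k f x - ?I) < r" by blast
    qed
  qed
qed

end

section \<open>Transfer of the hypotheses to the extended metric\<close>

lemma cball_in_cong: "\<forall>x\<in>S. \<forall>y\<in>S. d' x y = d x y \<Longrightarrow> x \<in> S \<Longrightarrow> cball_in S d' x r = cball_in S d x r"
  unfolding cball_in_def by auto

lemma well_separable_cong:
  assumes eq: "\<forall>x\<in>S. \<forall>y\<in>S. d' x y = d x y" and ws: "well_separable S d"
  shows "well_separable S d'"
proof -
  obtain chi :: nat where chi: "\<forall>E r. finite E \<and> E \<subseteq> S \<and> (\<forall>x\<in>E. r x > (0::real)) \<longrightarrow>
      (\<exists>F c. F \<subseteq> E \<and> E \<subseteq> (\<Union>x\<in>F. cball_in S d x (r x)) \<and> (\<forall>x\<in>F. c x < chi) \<and>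
         (\<forall>i<chi. \<forall>x\<in>F. \<forall>y\<in>F. c x = i \<and> c y = i \<and> cball_in S d x (r x) \<noteq> cball_in S d y (r y)
             \<longrightarrow> (\<forall>a\<in>cball_in S d x (r x). \<forall>b\<in>cball_in S d y (r y).
                    d a b \<ge> Min (r ` {z\<in>F. c z = (i::nat)}))))"
    using ws unfolding well_separable_def by (rule exE)
  show ?thesis unfolding well_separable_def
  proof (intro exI[of _ chi] allI impI)
    fix E r assume E: "finite E \<and> E \<subseteq> S \<and> (\<forall>x\<in>E. r x > (0::real))"
    obtain F c where F: "F \<subseteq> E" "E \<subseteq> (\<Union>x\<in>F. cball_in S d x (r x))" "\<forall>x\<in>F. c x < chi"
      and Fs: "\<forall>i<chi. \<forall>x\<in>F. \<forall>y\<in>F. c x = i \<and> c y = i \<and> cball_in S d x (r x) \<noteq> cball_in S d y (r y)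
             \<longrightarrow> (\<forall>a\<in>cball_in S d x (r x). \<forall>b\<in>cball_in S d y (r y). d a b \<ge> Min (r ` {z\<in>F. c z = (i::nat)}))"
      using chi[THEN spec, THEN spec, THEN mp, OF E] by (elim exE conjE) (rule that; assumption)
    have B: "cball_in S d' x (r x) = cball_in S d x (r x)" if "x \<in> F" for x
      using cball_in_cong[OF eq] that F(1) E by blast
    have "E \<subseteq> (\<Union>x\<in>F. cball_in S d' x (r x))" using F(2) B by simp
    moreover have "\<forall>i<chi. \<forall>x\<in>F. \<forall>y\<in>F. c x = i \<and> c y = i \<and> cball_in S d' x (r x) \<noteq> cball_in S d' y (r y)
             \<longrightarrow> (\<forall>a\<in>cball_in S d' x (r x). \<forall>b\<in>cball_in S d' y (r y). d' a b \<ge> Min (r ` {z\<in>F. c z = (i::nat)}))"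
    proof (intro allI impI ballI)
      fix i x y p q
      assume h: "i < chi" "x \<in> F" "y \<in> F" "c x = i \<and> c y = i \<and> cball_in S d' x (r x) \<noteq> cball_in S d' y (r y)"
        "p \<in> cball_in S d' x (r x)" "q \<in> cball_in S d' y (r y)"
      have "Min (r ` {z\<in>F. c z = i}) \<le> d p q"
        by (rule Fs[rule_format, OF h(1-3)]) (use h B in simp_all)
      moreover have "p \<in> S" "q \<in> S" using h unfolding cball_in_def by auto
      ultimately show "Min (r ` {z\<in>F. c z = i}) \<le> d' p q" using eq by simp
    qed
    ultimately show "\<exists>F c. F \<subseteq> E \<and> E \<subseteq> (\<Union>x\<in>F. cball_in S d' x (r x)) \<and> (\<forall>x\<in>F. c x < chi) \<and>
         (\<forall>i<chi. \<forall>x\<in>F. \<forall>y\<in>F. c x = i \<and> c y = i \<and> cball_in S d' x (r x) \<noteq> cball_in S d' y (r y)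
             \<longrightarrow> (\<forall>a\<in>cball_in S d' x (r x). \<forall>b\<in>cball_in S d' y (r y).
                    d' a b \<ge> Min (r ` {z\<in>F. c z = (i::nat)})))"
      by (intro exI[of _ F] exI[of _ c] conjI F(1,3))
  qed
qed

lemma besicovitch_cong:
  assumes eq: "\<forall>x\<in>S. \<forall>y\<in>S. d' x y = d x y" and bc: "besicovitch S d"
  shows "besicovitch S d'"
proof -
  obtain C :: real where C: "\<forall>E r. finite E \<and> E \<subseteq> S \<and> (\<forall>x\<in>E. r x > (0::real)) \<longrightarrow>
      (\<exists>F\<subseteq>E. \<forall>y\<in>S. (indicator E y :: real) \<le> (\<Sum>x\<in>F. indicator (cball_in S d x (r x)) y)
                   \<and> (\<Sum>x\<in>F. indicator (cball_in S d x (r x)) y) \<le> C)"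
    using bc unfolding besicovitch_def by (rule exE)
  show ?thesis unfolding besicovitch_def
  proof (intro exI[of _ C] allI impI)
    fix E r assume E: "finite E \<and> E \<subseteq> S \<and> (\<forall>x\<in>E. r x > (0::real))"
    obtain F where F: "F \<subseteq> E" "\<forall>y\<in>S. (indicator E y :: real) \<le> (\<Sum>x\<in>F. indicator (cball_in S d x (r x)) y)
                   \<and> (\<Sum>x\<in>F. indicator (cball_in S d x (r x)) y) \<le> C"
      using C[THEN spec, THEN spec, THEN mp, OF E] by (elim exE conjE) (rule that)
    have "(\<Sum>x\<in>F. indicator (cball_in S d' x (r x)) y :: real) = (\<Sum>x\<in>F. indicator (cball_in S d x (r x)) y)" for y
      using cball_in_cong[OF eq] F(1) E by (intro sum.cong) (auto simp: subset_eq)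
    then show "\<exists>F\<subseteq>E. \<forall>y\<in>S. (indicator E y :: real) \<le> (\<Sum>x\<in>F. indicator (cball_in S d' x (r x)) y)
                   \<and> (\<Sum>x\<in>F. indicator (cball_in S d' x (r x)) y) \<le> C"
      using F by (intro exI[of _ F]) simp
  qed
qed

theorem theorem8:
  fixes Gt :: "('g, 'b) monoid_scheme"
    and G :: "'g set"
    and dt :: "'g \<Rightarrow> 'g \<Rightarrow> real"
    and d :: "'g \<Rightarrow> 'g \<Rightarrow> real"
    and M :: "'x::polish_space measure"
    and a :: "'g \<Rightarrow> 'x \<Rightarrow> 'x"
    and f :: "'x \<Rightarrow> real"
  assumes Gt_group: "group Gt"
    and G_sub: "subgroup G Gt"
    and G_countable: "countable G"
    and d_metric: "metric_on_set G d"
    and finite_balls: "\<And>k. finite (int_ball G d \<one>\<^bsub>Gt\<^esub> k)"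
    and M_borel: "sets M = sets borel"
    and M_prob: "prob_space M"
    and action: "nonsingular_action Gt G M a"
    and ergodic: "ergodic_action G M a"
    and ws: "well_separable G d"
    and doubling: "mult_doubling Gt G d"
    and dt_metric: "metric_on_set (carrier Gt) dt"
    and dt_rinv: "right_invariant Gt dt"
    and dt_extends: "\<forall>x\<in>G. \<forall>y\<in>G. dt x y = d x y"
    and void: "voidless (carrier Gt) dt"
    and fid: "finite_intersection_dim G (carrier Gt) dt"
    and bcp: "besicovitch G d"
    and f_int: "integrable M f"
  shows "AE x in M. ((\<lambda>k. (\<Sum>g\<in>int_ball G d \<one>\<^bsub>Gt\<^esub> k. hat_op Gt M a g f x)
                          / (\<Sum>g\<in>int_ball G d \<one>\<^bsub>Gt\<^esub> k. hat_op Gt M a g (\<lambda>_. 1) x))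
                     \<longlongrightarrow> (\<integral>y. f y \<partial>M)) sequentially"
proof -
  have one: "\<one>\<^bsub>Gt\<^esub> \<in> G" by (rule subgroup.one_closed[OF G_sub])
  have balls: "int_ball G dt \<one>\<^bsub>Gt\<^esub> k = int_ball G d \<one>\<^bsub>Gt\<^esub> k" for k
    unfolding int_ball_def using dt_extends one by auto
  \<comment> \<open>The spheres live in the larger group, so the system is built on
    \<open>dt\<close>; on \<open>G\<close> it gives the same balls as \<open>d\<close>.\<close>
  interpret ball_system M Gt G a dt
    by (intro ball_system.intro nonsingular_system.intro nonsingular_system_axioms.intro ball_system_axioms.intro
        M_prob Gt_group G_sub G_countable action dt_metric dt_rinv)
       (simp only: balls finite_balls)
  have "AE x in M. (\<lambda>k. avg k f x) \<longlonglongrightarrow> (\<integral>y. f y \<partial>M)"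
  proof (rule ratio_ergodic[OF ergodic _ _ void fid _ f_int])
    show "well_separable G dt" by (rule well_separable_cong[OF dt_extends ws])
    show "besicovitch G dt" by (rule besicovitch_cong[OF dt_extends bcp])
    show "mult_doubling Gt G dt" using doubling unfolding mult_doubling_def balls .
  qed
  then show ?thesis unfolding balls hat_one .
qed

end
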